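(* Let $n\ge1$ and let $(X,S)$ have joint density $\frac{s^{n-1}}{\sigma^{n+1}}f\left(\frac{(x-\mu)^2+s^2}{\sigma^2}\right)$ on $\mathbb{R}\times(0,\infty)$, where $f:\mathbb{R}^+\to\mathbb{R}^+$ satisfies $f'<0$ and $tf'(t)/f(t)$ decreases in $t$ for $t>0$, and $\mu\ge0$, $\sigma>0$ are unknown. Consider estimating $\mu$ under the loss $\rho_{c_1,c_2}\left(\frac{d-\mu}{\sigma}\right)$, where $\rho_{c_1,c_2}(t)=c_1|t|^p1_{(-\infty,0)}(t)+c_2|t|^p1_{[0,\infty)}(t)$ with $p\ge1$ and $c_2\ge c_1>0$. Then: (a) the condition $g\le g_{\pi_0}$ suffices for an estimator $\delta_g\in C$ to be minimax; (b) such minimax estimators include the generalized Bayes estimator $\delta_{\pi_0}$, as well as all generalized Bayes estimators $\delta_{\pi_l}$, $l>0$, in the symmetric case $c_1=c_2$.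
   Context: $f$ is a known differentiable function, normalized so that the given expression is a density. (This is the reduction to $(X,S=\|U\|)$ of $(X,U)\in\mathbb{R}\times\mathbb{R}^n$ with density proportional to $\sigma^{-(n+1)}f(((x-\mu)^2+\|u\|^2)/\sigma^2)$.) Parameter space $\Theta=\{\theta=(\mu,\sigma):\mu\ge0,\sigma>0\}$; write $\rho=\rho_{c_1,c_2}$ and $R(\theta,\delta)=E_\theta[\rho((\delta(X,S)-\mu)/\sigma)]$. MRE estimator: it is assumed that a unique minimum risk equivariant estimator with finite risk exists for the unconstrained problem; it is $\delta_0(X,S)=X+c_0S$, $c_0=\mathrm{argmin}_c E_{0,1}[\rho(X+cS)]$, uniquely determined by $E_{0,1}[S\rho'(X+c_0S)]=0$ (subscript $0,1$ means $\mu=0,\sigma=1$). Its risk is constant, and it is known that $\delta_0$ is minimax over $\Theta$; hence "an estimator $\delta$ is minimax" means $R(\theta,\delta)\le R(\theta,\delta_0)$ for all $\theta\in\Theta$. Bayes estimators: for $l\ge-(n-1)$, $\delta_{\pi_l}$ is the generalized Bayes estimator for the prior $\pi_l(\mu,\sigma)=\sigma^{-(l+1)}1_{[0,\infty)}(\mu)1_{(0,\infty)}(\sigma)$, assumed to exist; it has the form $X+c_0S+g_{\pi_l}(X/S)S$, where $g_{\pi_l}(y)$ is the (unique) minimizer in $g$ of $\int_0^\infty\int_{-\infty}^{vy}\rho(u+c_0v+gv)f(u^2+v^2)v^{n+l-1}\,du\,dv$, and satisfies $\int_0^\infty\int_{-\infty}^{vy}\rho'(u+c_0v+g_{\pi_l}(y)v)\,v^{n+l}f(u^2+v^2)\,du\,dv=0$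 for all $y\in\mathbb{R}$. Class $C$: the estimators $\delta_g(X,S)=\delta_0(X,S)+g(X/S)S$ with $g:\mathbb{R}\to\mathbb{R}$ absolutely continuous, nonincreasing, non-constant, and $\lim_{t\to\infty}g(t)=0$. *)

theory Defs
  imports "HOL-Analysis.Analysis" "HOL-Probability.Probability"
begin

definition loss :: "real \<Rightarrow> real \<Rightarrow> real \<Rightarrow> real \<Rightarrow> real" where
  "loss c1 c2 p t = (if t < 0 then c1 * \<bar>t\<bar> powr p else c2 * \<bar>t\<bar> powr p)"

definition likelihood ::
  "nat \<Rightarrow> (real \<Rightarrow> real) \<Rightarrow> real \<Rightarrow> real \<Rightarrow> real \<Rightarrow> real \<Rightarrow> real" where
  "likelihood n f \<mu> \<sigma> x s = s ^ (n - 1) / \<sigma> ^ (n + 1) * f (((x - \<mu>)\<^sup>2 + s\<^sup>2) / \<sigma>\<^sup>2)"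

definition model ::
  "nat \<Rightarrow> (real \<Rightarrow> real) \<Rightarrow> real \<Rightarrow> real \<Rightarrow> (real \<times> real) measure" where
  "model n f \<mu> \<sigma> =
     density lborel (\<lambda>(x, s). indicator {0<..} s * ennreal (likelihood n f \<mu> \<sigma> x s))"

text \<open>Estimators are functions of the observation \<open>(x, s)\<close>; only their values for
  \<open>s > 0\<close> matter. Risks and posterior losses are extended nonnegative reals,
  so that they may be infinite.\<close>

definition risk ::
  "nat \<Rightarrow> (real \<Rightarrow> real) \<Rightarrow> real \<Rightarrow> real \<Rightarrow> real \<Rightarrow> real \<Rightarrow> real \<Rightarrow> (real \<Rightarrow> real \<Rightarrow> real) \<Rightarrow> ennreal" where
  "risk n f c1 c2 p \<mu> \<sigma> \<delta> =
     (\<integral>\<^sup>+ (x, s). ennreal (loss c1 c2 p ((\<delta> x s - \<mu>) / \<sigma>)) \<partial>model n f \<mu> \<sigma>)"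

text \<open>For an \<open>ennreal\<close>-valued \<open>F\<close>, strict inequality forces \<open>F a\<close> to be finite.\<close>

definition unique_minimizer :: "(real \<Rightarrow> ennreal) \<Rightarrow> real \<Rightarrow> bool" where
  "unique_minimizer F a \<longleftrightarrow> (\<forall>b. b \<noteq> a \<longrightarrow> F a < F b)"

text \<open>\<open>x + c s\<close> is the general form of a location-scale equivariant estimator, and its
  risk does not depend on the parameter. The minimum risk equivariant estimator is
  \<open>equivariant_est c0\<close> for the constant \<open>c0\<close> with \<open>is_mre_constant\<close>.\<close>

definition equivariant_est :: "real \<Rightarrow> real \<Rightarrow> real \<Rightarrow> real" where
  "equivariant_est c x s = x + c * s"

definition is_mre_constant ::
  "nat \<Rightarrow> (real \<Rightarrow> real) \<Rightarrow> real \<Rightarrow> real \<Rightarrow> real \<Rightarrow> real \<Rightarrow> bool" where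
  "is_mre_constant n f c1 c2 p c0 \<longleftrightarrow>
     unique_minimizer (\<lambda>c. risk n f c1 c2 p 0 1 (equivariant_est c)) c0"

definition est :: "real \<Rightarrow> (real \<Rightarrow> real) \<Rightarrow> real \<Rightarrow> real \<Rightarrow> real" where
  "est c0 g x s = equivariant_est c0 x s + g (x / s) * s"

text \<open>The minimum risk equivariant estimator has constant risk and is itself minimax over the
  restricted parameter space \<open>\<mu> \<ge> 0\<close>, \<open>\<sigma> > 0\<close>; an estimator is therefore minimax
  iff its risk never exceeds that constant.\<close>

definition minimax ::
  "nat \<Rightarrow> (real \<Rightarrow> real) \<Rightarrow> real \<Rightarrow> real \<Rightarrow> real \<Rightarrow> real \<Rightarrow> (real \<Rightarrow> real \<Rightarrow> real) \<Rightarrow> bool" where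
  "minimax n f c1 c2 p c0 \<delta> \<longleftrightarrow>
     (\<forall>\<mu>\<ge>0. \<forall>\<sigma>>0. risk n f c1 c2 p \<mu> \<sigma> \<delta> \<le> risk n f c1 c2 p \<mu> \<sigma> (equivariant_est c0))"

definition prior :: "real \<Rightarrow> real \<Rightarrow> real \<Rightarrow> real" where
  "prior l \<mu> \<sigma> = \<sigma> powr (- (l + 1)) * indicator {0..} \<mu> * indicator {0<..} \<sigma>"

text \<open>Posterior expected loss of the decision \<open>d\<close> given \<open>(x, s)\<close>, up to the normalizing
  factor, which does not depend on \<open>d\<close>.\<close>

definition posterior_loss ::
  "nat \<Rightarrow> (real \<Rightarrow> real) \<Rightarrow> real \<Rightarrow> real \<Rightarrow> real \<Rightarrow> (real \<Rightarrow> real \<Rightarrow> real) \<Rightarrow>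
   real \<Rightarrow> real \<Rightarrow> real \<Rightarrow> ennreal" where
  "posterior_loss n f c1 c2 p \<pi> x s d =
     (\<integral>\<^sup>+ (\<mu>, \<sigma>). ennreal (loss c1 c2 p ((d - \<mu>) / \<sigma>) * likelihood n f \<mu> \<sigma> x s * \<pi> \<mu> \<sigma>) \<partial>lborel)"

definition generalized_bayes ::
  "nat \<Rightarrow> (real \<Rightarrow> real) \<Rightarrow> real \<Rightarrow> real \<Rightarrow> real \<Rightarrow> (real \<Rightarrow> real \<Rightarrow> real) \<Rightarrow>
   (real \<Rightarrow> real \<Rightarrow> real) \<Rightarrow> bool" where
  "generalized_bayes n f c1 c2 p \<pi> \<delta> \<longleftrightarrow>
     (\<forall>x. \<forall>s>0. unique_minimizer (posterior_loss n f c1 c2 p \<pi> x s) (\<delta> x s))"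

text \<open>The criterion minimized by \<open>g_\<pi>\<^sub>l(y)\<close>; it arises from \<open>posterior_loss\<close> with
  \<open>d = x + c0 s + g s\<close>, \<open>y = x / s\<close> by substituting \<open>u = (x - \<mu>) / \<sigma>\<close>, \<open>v = s / \<sigma>\<close>.\<close>

definition bayes_criterion ::
  "nat \<Rightarrow> (real \<Rightarrow> real) \<Rightarrow> real \<Rightarrow> real \<Rightarrow> real \<Rightarrow> real \<Rightarrow> real \<Rightarrow> real \<Rightarrow> real \<Rightarrow> ennreal" where
  "bayes_criterion n f c1 c2 p c0 l y g =
     (\<integral>\<^sup>+ v\<in>{0<..}. (\<integral>\<^sup>+ u\<in>{..v * y}.
        ennreal (loss c1 c2 p (u + c0 * v + g * v) * f (u\<^sup>2 + v\<^sup>2) * v powr (real n + l - 1))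
      \<partial>lborel) \<partial>lborel)"

definition is_g_bayes ::
  "nat \<Rightarrow> (real \<Rightarrow> real) \<Rightarrow> real \<Rightarrow> real \<Rightarrow> real \<Rightarrow> real \<Rightarrow> real \<Rightarrow> (real \<Rightarrow> real) \<Rightarrow> bool" where
  "is_g_bayes n f c1 c2 p c0 l g \<longleftrightarrow>
     (\<forall>y. unique_minimizer (bayes_criterion n f c1 c2 p c0 l y) (g y))"

definition abs_cont_on_interval :: "real \<Rightarrow> real \<Rightarrow> (real \<Rightarrow> real) \<Rightarrow> bool" where
  "abs_cont_on_interval a b g \<longleftrightarrow>
     (\<forall>\<epsilon>>0. \<exists>\<eta>>0. \<forall>(N::nat) u v.
        (\<forall>i<N. a \<le> u i \<and> u i \<le> v i \<and> v i \<le> b) \<and>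
        disjoint_family_on (\<lambda>i. {u i<..<v i}) {..<N} \<and>
        (\<Sum>i<N. v i - u i) < \<eta>
        \<longrightarrow> (\<Sum>i<N. \<bar>g (v i) - g (u i)\<bar>) < \<epsilon>)"

text \<open>On the whole line, absolute continuity is meant locally: on every compact interval.\<close>

definition class_C :: "(real \<Rightarrow> real) set" where
  "class_C = {g. (\<forall>a b. abs_cont_on_interval a b g) \<and> antimono g \<and>
                 \<not> g constant_on UNIV \<and> (g \<longlongrightarrow> 0) at_top}"

end

theory Submission
  imports Defs
begin

text \<open>With \<open>w = u / v\<close> every criterion becomes a multiple of an integral of the loss against
  \<open>(1 + w\<^sup>2) powr (- \<kappa> / 2)\<close>, so that \<open>c\<^sub>0\<close> and \<open>c\<^sub>0 + g y\<close> are roots of first-order conditions that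
  no longer involve \<open>f\<close>. For the risk, \<open>\<rho> (q + g v) - \<rho> q\<close> is written as an integral of
  \<open>v \<rho>'(q + h v)\<close> over \<open>0 \<le> h \<le> g\<close>; as \<open>{t. h \<le> g t}\<close> is a half line \<open>{..\<tau>}\<close>, the risk difference is
  an integral over \<open>h\<close> of terms with \<open>\<rho>'\<close> on wedges \<open>u \<le> v \<tau> - \<mu> / \<sigma>\<close>. Slicing the wedge by the
  parallel lines \<open>u = v \<tau> - \<eta>\<close>, the contribution of a line changes sign at most once, from \<open>+\<close> to
  \<open>-\<close>, as \<open>\<eta>\<close> grows: \<open>f (\<eta>\<^sup>2 A)\<close> has monotone likelihood ratio in \<open>A\<close> because \<open>t f' t / f t\<close>
  decreases, and after folding the line at the minimum of the quadratic \<open>A\<close> the factor with \<open>\<rho>'\<close>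
  changes sign once because \<open>c2 \<ge> c1\<close>. All lines together contribute \<open>0\<close> at the Bayes root, so the
  tail \<open>\<eta> \<ge> \<mu> / \<sigma>\<close> contributes at most \<open>0\<close>.\<close>

text \<open>Two obstacles shape the proof. The first is the kink of the loss: for p = 1 its
  derivative jumps at 0, for p > 2 its second derivative vanishes there. Stationarity is therefore
  obtained from subgradients, and strict growth of the first-order condition in the shift from
  second differences of the loss over a window of positive length. The same growth gives the local
  Lipschitz bound that puts the Bayes functions into \<open>class_C\<close>. The second is
  finiteness: the moment of \<open>f\<close> that governs the risk is not assumed finite. The
  information sits in the strict inequalities between extended values: a unique minimizer of a
  constant times a positive criterion forces that constant to be positive and finite. On the risk
  side \<open>\<rho>'\<close> is split into its nonnegative parts \<open>dpos\<close> and
  \<open>dneg\<close>, so that Tonelli applies throughout, and subtraction is postponed until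
  finiteness is known.\<close>

section \<open>Asymmetric power loss\<close>

text \<open>Since \<open>0 powr 0 = 0\<close>, the case \<open>q = 0\<close> is the indicator of t >
  0. This keeps p = 1 inside the uniform treatment, where the derivative has exponent p - 1.\<close>

definition pos_powr :: "real \<Rightarrow> real \<Rightarrow> real" where
  "pos_powr q t = max 0 t powr q"

lemma pos_powr_simps:
  "t \<le> 0 \<Longrightarrow> pos_powr q t = 0" "t \<ge> 0 \<Longrightarrow> pos_powr q t = t powr q"
  by (auto simp: pos_powr_def max_def)

lemma pos_powr_nonneg [simp]: "pos_powr q t \<ge> 0"
  by (simp add: pos_powr_def)

lemma pos_powr_mono: "q \<ge> 0 \<Longrightarrow> s \<le> t \<Longrightarrow> pos_powr q s \<le> pos_powr q t"
  by (auto simp: pos_powr_def intro!: powr_mono2)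

lemma pos_powr_scale: "v > 0 \<Longrightarrow> pos_powr q (v * t) = v powr q * pos_powr q t"
  by (cases "t \<ge> 0") (simp_all add: pos_powr_simps powr_mult mult_nonneg_nonpos)

lemma pos_powr_measurable [measurable]: "pos_powr q \<in> borel_measurable borel"
  unfolding pos_powr_def by measurable

lemma isCont_pos_powr: "t \<noteq> 0 \<Longrightarrow> isCont (pos_powr q) t"
proof -
  assume t: "t \<noteq> 0"
  show ?thesis
  proof (cases "t > 0")
    case True
    have "eventually (\<lambda>x. x \<in> {0<..}) (nhds t)"
      using True by (intro eventually_nhds_in_open) auto
    then have "eventually (\<lambda>x. pos_powr q x = x powr q) (nhds t)"
      by eventually_elim (simp add: pos_powr_simps)
    moreover have "isCont (\<lambda>x. x powr q) t" using True by (intro continuous_intros) auto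
    ultimately show ?thesis using isCont_cong by fastforce
  next
    case False
    have "eventually (\<lambda>x. x \<in> {..<0}) (nhds t)"
      using False t by (intro eventually_nhds_in_open) auto
    then have "eventually (\<lambda>x. pos_powr q x = 0) (nhds t)"
      by eventually_elim (simp add: pos_powr_simps)
    moreover have "isCont (\<lambda>x. 0::real) t" by simp
    ultimately show ?thesis using isCont_cong by fastforce
  qed
qed

lemma continuous_on_pos_powr: "q > 0 \<Longrightarrow> continuous_on A (pos_powr q)"
  unfolding pos_powr_def by (intro continuous_intros continuous_on_powr') auto

lemma DERIV_pos_powr:
  assumes "t \<noteq> 0"
  shows "(pos_powr q has_real_derivative q * pos_powr (q - 1) t) (at t)"
proof (cases "t > 0")
  case True
  have "((\<lambda>x. x powr q) has_real_derivative q * t powr (q - 1)) (at t)"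
    by (rule has_real_derivative_powr[OF True])
  moreover have "eventually (\<lambda>x. x powr q = pos_powr q x) (nhds t)"
    using eventually_nhds_in_open[of "{0<..}" t] True
    by (auto elim!: eventually_mono simp: pos_powr_simps)
  ultimately show ?thesis
    using DERIV_cong_ev[OF refl] True by (fastforce simp: pos_powr_simps)
next
  case False
  have "((\<lambda>x. 0) has_real_derivative 0) (at t)" by simp
  moreover have "eventually (\<lambda>x. 0 = pos_powr q x) (nhds t)"
    using eventually_nhds_in_open[of "{..<0}" t] False assms
    by (auto elim!: eventually_mono simp: pos_powr_simps)
  ultimately show ?thesis
    using DERIV_cong_ev[OF refl] False by (fastforce simp: pos_powr_simps)
qed

text \<open>The kink at \<open>- a / v\<close> is an exceptional point of the fundamental theorem,
  where continuity of the antiderivative is enough; the integrand itself jumps there when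
  \<open>q = 1\<close>. Negative \<open>v\<close> is allowed and serves the left branch of the
  loss.\<close>

lemma has_integral_pos_powr:
  assumes "q > 0" "v \<noteq> 0" "x \<le> y"
  shows "((\<lambda>h. v * q * pos_powr (q - 1) (a + h * v)) has_integral
    (pos_powr q (a + y * v) - pos_powr q (a + x * v))) {x..y}"
proof (rule fundamental_theorem_of_calculus_strong[where S = "{- a / v}"])
  fix h assume "h \<in> {x..y} - {- a / v}"
  then have "a + h * v \<noteq> 0" using assms by (auto simp: field_simps)
  have "((\<lambda>h. pos_powr q (a + h * v)) has_real_derivative
      q * pos_powr (q - 1) (a + h * v) * v) (at h)"
    by (rule DERIV_chain2[where f = "pos_powr q", OF DERIV_pos_powr])
      (use \<open>a + h * v \<noteq> 0\<close> in \<open>auto intro!: derivative_eq_intros\<close>)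
  then show "((\<lambda>h. pos_powr q (a + h * v)) has_vector_derivative
      v * q * pos_powr (q - 1) (a + h * v)) (at h)"
    by (simp add: has_real_derivative_iff_has_vector_derivative mult_ac)
next
  show "continuous_on {x..y} (\<lambda>h. pos_powr q (a + h * v))"
    by (rule continuous_on_compose2[OF continuous_on_pos_powr[OF assms(1), of UNIV]])
      (auto intro!: continuous_intros)
qed (use assms in auto)

lemma nn_integral_pos_powr:
  assumes "q > 0" "v > 0" "0 \<le> y"
  shows "(\<integral>\<^sup>+h. ennreal (v * (q * pos_powr (q - 1) (a + h * v))) * indicator {0..y} h \<partial>lborel)
      = ennreal (pos_powr q (a + y * v) - pos_powr q a)" (is ?A)
    and "(\<integral>\<^sup>+h. ennreal (v * (q * pos_powr (q - 1) (- (a + h * v)))) * indicator {0..y} h \<partial>lborel)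
      = ennreal (pos_powr q (- a) - pos_powr q (- (a + y * v)))" (is ?B)
proof -
  have *: "(\<integral>\<^sup>+h. ennreal (g h) * indicator {0..y} h \<partial>lborel) = ennreal I"
    if "(g has_integral I) {0..y}" "g \<in> borel_measurable borel" "\<And>h. g h \<ge> 0" for g :: "real \<Rightarrow> real" and I
    using nn_integral_has_integral_lebesgue[of "{0..y}" g I] that
    by (simp add: mult.commute ennreal_mult' ennreal_indicator flip: ennreal_mult'')
  show ?A
    by (rule *) (use has_integral_pos_powr[of q v 0 y a] assms in \<open>auto simp: mult_ac\<close>)
  show ?B
  proof (rule *)
    have "((\<lambda>h. (- v) * q * pos_powr (q - 1) ((- a) + h * (- v))) has_integral
      (pos_powr q ((- a) + y * (- v)) - pos_powr q ((- a) + 0 * (- v)))) {0..y}"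
      by (rule has_integral_pos_powr) (use assms in auto)
    then have "((\<lambda>h. - ((- v) * q * pos_powr (q - 1) ((- a) + h * (- v)))) has_integral
      - (pos_powr q ((- a) + y * (- v)) - pos_powr q ((- a) + 0 * (- v)))) {0..y}"
      by (rule has_integral_neg)
    then show "((\<lambda>h. v * (q * pos_powr (q - 1) (- (a + h * v)))) has_integral
        (pos_powr q (- a) - pos_powr q (- (a + y * v)))) {0..y}"
      by (simp add: mult_ac)
  qed (use assms in auto)
qed

section \<open>Derivative, convexity and growth of the loss\<close>

locale asym_power_loss =
  fixes c1 c2 p :: real
  assumes p: "p \<ge> 1" and c1: "c1 > 0" and c12: "c1 \<le> c2"
begin

abbreviation "\<rho> \<equiv> loss c1 c2 p"

text \<open>The derivative is split by sign so that each half can enter a nonnegative extended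
  integral. Both halves are 0 at the kink, also for p = 1.\<close>

definition dpos :: "real \<Rightarrow> real" where "dpos t = c2 * (p * pos_powr (p - 1) t)"
definition dneg :: "real \<Rightarrow> real" where "dneg t = c1 * (p * pos_powr (p - 1) (- t))"
definition dloss :: "real \<Rightarrow> real" where "dloss t = dpos t - dneg t"

lemma loss_eq: "\<rho> t = c1 * pos_powr p (- t) + c2 * pos_powr p t"
  by (auto simp: loss_def pos_powr_def max_def)

lemma measurable_loss [measurable]:
  "\<rho> \<in> borel_measurable borel" "dpos \<in> borel_measurable borel"
  "dneg \<in> borel_measurable borel" "dloss \<in> borel_measurable borel"
  unfolding dloss_def dpos_def dneg_def loss_eq[abs_def] by measurable

lemma dpos_nonneg [simp]: "dpos t \<ge> 0" and dneg_nonneg [simp]: "dneg t \<ge> 0"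
  and loss_nonneg [simp]: "\<rho> t \<ge> 0"
  using p c1 c12 by (auto simp: dpos_def dneg_def loss_eq)

lemma dpos_mono: "s \<le> t \<Longrightarrow> dpos s \<le> dpos t" and dneg_antimono: "s \<le> t \<Longrightarrow> dneg t \<le> dneg s"
  using p c1 c12 by (auto simp: dpos_def dneg_def intro!: mult_left_mono pos_powr_mono)

lemma dloss_mono: "s \<le> t \<Longrightarrow> dloss s \<le> dloss t"
  using dpos_mono dneg_antimono by (fastforce simp: dloss_def)

lemma dloss_pos: "t > 0 \<Longrightarrow> dloss t > 0" and dloss_neg: "t < 0 \<Longrightarrow> dloss t < 0"
  and dloss_0 [simp]: "dloss 0 = 0"
  using p c1 c12 by (auto simp: dloss_def dpos_def dneg_def pos_powr_simps)

lemma dpos_scale: "v > 0 \<Longrightarrow> dpos (v * t) = v powr (p - 1) * dpos t"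
  and dneg_scale: "v > 0 \<Longrightarrow> dneg (v * t) = v powr (p - 1) * dneg t"
  and loss_scale: "v > 0 \<Longrightarrow> \<rho> (v * t) = v powr p * \<rho> t"
  using pos_powr_scale[of v _ t] pos_powr_scale[of v _ "- t"]
  by (simp_all add: dpos_def dneg_def loss_eq algebra_simps)

lemma isCont_dloss: "t \<noteq> 0 \<Longrightarrow> isCont dloss t"
  unfolding dloss_def[abs_def] dpos_def[abs_def] dneg_def[abs_def]
  by (intro continuous_intros isCont_pos_powr isCont_o2[where g = "pos_powr _"]) auto

lemma loss_has_integral:
  assumes "x \<le> y"
  shows "((\<lambda>w. dloss (w + a)) has_integral (\<rho> (y + a) - \<rho> (x + a))) {x..y}"
proof -
  have "((\<lambda>h. c2 * (1 * p * pos_powr (p - 1) (a + h * 1)) + c1 * ((- 1) * p * pos_powr (p - 1) (- a + h * (- 1))))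
     has_integral (c2 * (pos_powr p (a + y * 1) - pos_powr p (a + x * 1))
        + c1 * (pos_powr p (- a + y * (- 1)) - pos_powr p (- a + x * (- 1))))) {x..y}"
    by (intro has_integral_add has_integral_mult_right has_integral_pos_powr) (use assms p in auto)
  then show ?thesis
    by (simp add: dloss_def dpos_def dneg_def loss_eq algebra_simps)
qed

text \<open>Convexity in integrated form: the loss is an integral of the monotone
  \<open>dloss\<close>, so the kink causes no exception.\<close>

lemma loss_subgradient: "\<rho> t - \<rho> s \<ge> dloss s * (t - s)"
proof (cases "s \<le> t")
  case True
  have "((\<lambda>w. dloss s) has_integral dloss s * (t - s)) {s..t}"
    using has_integral_const_real[of "dloss s" s t] True by (simp add: mult_ac)
  then show ?thesis
    by (rule has_integral_le[OF _ loss_has_integral[OF True, of 0, simplified]])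
      (auto intro: dloss_mono)
next
  case False
  have "((\<lambda>w. dloss s) has_integral dloss s * (s - t)) {t..s}"
    using has_integral_const_real[of "dloss s" t s] False by (simp add: mult_ac)
  then have "\<rho> s - \<rho> t \<le> dloss s * (s - t)"
    using False by (intro has_integral_le[OF loss_has_integral[of t s 0, simplified]])
      (auto intro: dloss_mono)
  then show ?thesis by (simp add: algebra_simps)
qed

text \<open>The product (1 + |a|) (1 + |w|) dominates both 1 and |w + a|. Being at least 1, it lets
  the exponent p - 1 be raised to p; being a product, it separates the shift from the integration
  variable, as dominated convergence requires.\<close>

lemma dloss_loss_bounds:
  "dpos (w + a) \<le> c2 * p * ((1 + \<bar>a\<bar>) powr p * (1 + \<bar>w\<bar>) powr p)"
  "dneg (w + a) \<le> c2 * p * ((1 + \<bar>a\<bar>) powr p * (1 + \<bar>w\<bar>) powr p)"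
  "\<bar>dloss (w + a)\<bar> \<le> c2 * p * ((1 + \<bar>a\<bar>) powr p * (1 + \<bar>w\<bar>) powr p)"
  "\<rho> (w + a) \<le> c2 * p * ((1 + \<bar>a\<bar>) powr p * (1 + \<bar>w\<bar>) powr p)"
proof -
  define B where "B = ((1 + \<bar>a\<bar>) * (1 + \<bar>w\<bar>)) powr p"
  have B: "B = (1 + \<bar>a\<bar>) powr p * (1 + \<bar>w\<bar>) powr p" by (simp add: B_def powr_mult)
  have "1 + \<bar>a\<bar> + \<bar>w\<bar> \<le> (1 + \<bar>a\<bar>) * (1 + \<bar>w\<bar>)" by (simp add: algebra_simps)
  then have 1: "\<bar>w + a\<bar> \<le> (1 + \<bar>a\<bar>) * (1 + \<bar>w\<bar>)" "1 \<le> (1 + \<bar>a\<bar>) * (1 + \<bar>w\<bar>)" by linarith+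
  have *: "pos_powr q t \<le> B" if "\<bar>t\<bar> \<le> \<bar>w + a\<bar>" "0 \<le> q" "q \<le> p" for q t
  proof -
    have "max 0 t powr q \<le> ((1 + \<bar>a\<bar>) * (1 + \<bar>w\<bar>)) powr q"
      using 1 that by (intro powr_mono2) auto
    also have "\<dots> \<le> B" unfolding B_def using 1 that by (intro powr_mono) auto
    finally show ?thesis by (simp add: pos_powr_def)
  qed
  show P: "dpos (w + a) \<le> c2 * p * ((1 + \<bar>a\<bar>) powr p * (1 + \<bar>w\<bar>) powr p)"
    unfolding dpos_def B[symmetric] mult.assoc using p c1 c12 by (intro mult_left_mono *) auto
  have "dneg (w + a) \<le> c1 * (p * B)"
    unfolding dneg_def mult.assoc using p c1 c12 by (intro mult_left_mono *) auto
  also have "\<dots> \<le> c2 * (p * B)" using c12 p by (intro mult_right_mono) (auto simp: B_def)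
  finally show N: "dneg (w + a) \<le> c2 * p * ((1 + \<bar>a\<bar>) powr p * (1 + \<bar>w\<bar>) powr p)"
    unfolding B by (simp add: mult.assoc)
  show "\<bar>dloss (w + a)\<bar> \<le> c2 * p * ((1 + \<bar>a\<bar>) powr p * (1 + \<bar>w\<bar>) powr p)"
    unfolding dloss_def using P N dpos_nonneg[of "w+a"] dneg_nonneg[of "w+a"] by linarith
  have "\<rho> (w + a) \<le> c2 * \<bar>w + a\<bar> powr p"
    using c12 by (auto simp: loss_def intro!: mult_right_mono)
  also have "\<dots> \<le> c2 * B" unfolding B_def using c1 c12 p 1 by (intro mult_left_mono powr_mono2) auto
  also have "\<dots> \<le> c2 * p * B" using c1 c12 p mult_right_mono[of 1 p B] by (auto simp: B_def)
  finally show "\<rho> (w + a) \<le> c2 * p * ((1 + \<bar>a\<bar>) powr p * (1 + \<bar>w\<bar>) powr p)"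
    unfolding B .
qed

end

section \<open>First-order conditions for the weighted loss\<close>

text \<open>What remains of the density of u / v once the radius is integrated out: up to scaling
  and normalization a Student density.\<close>

definition kern :: "real \<Rightarrow> real \<Rightarrow> real" where
  "kern \<kappa> w = (1 + w\<^sup>2) powr (- \<kappa> / 2)"

lemma one_plus_square_pos [simp]: "0 < 1 + (w::real)\<^sup>2" "1 + (w::real)\<^sup>2 \<noteq> 0"
  by (smt (verit) zero_le_power2)+

lemma kern_pos [simp]: "kern \<kappa> w > 0" and kern_nonneg [simp]: "kern \<kappa> w \<ge> 0"
  by (simp_all add: kern_def)

lemma kern_minus [simp]: "kern \<kappa> (- w) = kern \<kappa> w"
  by (simp add: kern_def)

lemma kern_add: "kern (\<kappa> + l) w = kern \<kappa> w * kern l w"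
  by (simp add: kern_def diff_divide_distrib flip: powr_add)

lemma measurable_kern [measurable]: "kern \<kappa> \<in> borel_measurable borel"
  unfolding kern_def by measurable

lemma kern_mono_abs: "\<kappa> \<ge> 0 \<Longrightarrow> \<bar>w\<bar> \<le> \<bar>r\<bar> \<Longrightarrow> kern \<kappa> r \<le> kern \<kappa> w"
  unfolding kern_def by (intro powr_mono2') (auto simp: abs_le_square_iff)

text \<open>The constant 2^(p/2) comes from (1 + |w|)^2 \<le> 2 (1 + w^2), and the two extra units
  in \<open>\<kappa> \<ge> p + 2\<close> leave a multiple of the Cauchy density. The cruder second
  bound feeds the Lipschitz constant of the roots.\<close>

lemma powr_kern_le:
  assumes "p \<ge> 0" "\<kappa> \<ge> p + 2"
  shows "(1 + \<bar>w\<bar>) powr p * kern \<kappa> w \<le> 2 powr (p / 2) * inverse (1 + w\<^sup>2)"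
    and "(1 + \<bar>w\<bar>) powr p * kern \<kappa> w \<le> 2 powr (p / 2)"
proof -
  have "(1 + \<bar>w\<bar>)\<^sup>2 \<le> 2 * (1 + w\<^sup>2)"
    using sum_squares_bound[of 1 "\<bar>w\<bar>"] by (simp add: power2_sum)
  then have "((1 + \<bar>w\<bar>)\<^sup>2) powr (p / 2) \<le> (2 * (1 + w\<^sup>2)) powr (p / 2)"
    using assms by (intro powr_mono2) auto
  moreover have "((1 + \<bar>w\<bar>)\<^sup>2) powr (p / 2) = (1 + \<bar>w\<bar>) powr p"
    by (simp add: powr_powr flip: powr_numeral)
  ultimately have "(1 + \<bar>w\<bar>) powr p * kern \<kappa> w \<le> (2 powr (p / 2) * (1 + w\<^sup>2) powr (p / 2)) * kern \<kappa> w"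
    by (intro mult_right_mono) (auto simp: powr_mult[of 2 "1 + w\<^sup>2", symmetric])
  also have "\<dots> = 2 powr (p / 2) * (1 + w\<^sup>2) powr ((p - \<kappa>) / 2)"
    by (simp add: kern_def diff_divide_distrib flip: powr_add)
  also have "\<dots> \<le> 2 powr (p / 2) * (1 + w\<^sup>2) powr (- 1)"
    using assms by (intro mult_left_mono powr_mono) auto
  also have "(1 + w\<^sup>2) powr (- 1) = inverse (1 + w\<^sup>2)"
    by (simp add: powr_minus)
  finally show *: "(1 + \<bar>w\<bar>) powr p * kern \<kappa> w \<le> 2 powr (p / 2) * inverse (1 + w\<^sup>2)" .
  also have "\<dots> \<le> 2 powr (p / 2) * 1"
    by (intro mult_left_mono) (auto simp: field_simps)
  finally show "(1 + \<bar>w\<bar>) powr p * kern \<kappa> w \<le> 2 powr (p / 2)" by simp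
qed

lemma integrable_powr_kern:
  assumes "p \<ge> 0" "\<kappa> \<ge> p + 2"
  shows "integrable lborel (\<lambda>w. (1 + \<bar>w\<bar>) powr p * kern \<kappa> w)"
proof (rule Bochner_Integration.integrable_bound)
  show "integrable lborel (\<lambda>w::real. 2 powr (p / 2) * inverse (1 + w\<^sup>2))"
    using integrable_inverse_1_plus_square by (intro integrable_mult_right) (simp add: set_integrable_def)
qed (use powr_kern_le(1)[OF assms] in auto)

section \<open>The criterion and its derivative in the shift\<close>

context asym_power_loss
begin

text \<open>The formal derivative of \<open>crit\<close> in \<open>a\<close>; its link with
  minimizers is \<open>foc_eq_0\<close>.\<close>

definition foc :: "real \<Rightarrow> real set \<Rightarrow> real \<Rightarrow> real" where
  "foc \<kappa> A a = (\<integral>w. indicator A w * (dloss (w + a) * kern \<kappa> w) \<partial>lborel)"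

definition crit :: "real \<Rightarrow> real set \<Rightarrow> real \<Rightarrow> ennreal" where
  "crit \<kappa> A a = (\<integral>\<^sup>+w\<in>A. ennreal (\<rho> (w + a) * kern \<kappa> w) \<partial>lborel)"

definition crit_real :: "real \<Rightarrow> real set \<Rightarrow> real \<Rightarrow> real" where
  "crit_real \<kappa> A a = (\<integral>w. indicator A w * (\<rho> (w + a) * kern \<kappa> w) \<partial>lborel)"

lemma bounded_kern_le:
  assumes "\<bar>h (w + a)\<bar> \<le> c2 * p * ((1 + \<bar>a\<bar>) powr p * (1 + \<bar>w\<bar>) powr p)" "\<bar>a\<bar> \<le> R"
  shows "\<bar>indicator A w * (h (w + a) * kern \<kappa> w)\<bar> \<le>
    c2 * p * (1 + R) powr p * ((1 + \<bar>w\<bar>) powr p * kern \<kappa> w)"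
proof -
  have "\<bar>indicator A w * (h (w + a) * kern \<kappa> w)\<bar> \<le> \<bar>h (w + a)\<bar> * kern \<kappa> w"
    by (auto simp: indicator_def abs_mult)
  also have "\<dots> \<le> c2 * p * ((1 + \<bar>a\<bar>) powr p * (1 + \<bar>w\<bar>) powr p) * kern \<kappa> w"
    using assms by (intro mult_right_mono) auto
  also have "\<dots> \<le> c2 * p * ((1 + R) powr p * (1 + \<bar>w\<bar>) powr p) * kern \<kappa> w"
    using assms p c1 c12 by (intro mult_right_mono mult_left_mono powr_mono2) auto
  finally show ?thesis by (simp add: mult_ac)
qed

lemma integrable_bounded_kern:
  assumes "\<And>w. \<bar>h (w + a)\<bar> \<le> c2 * p * ((1 + \<bar>a\<bar>) powr p * (1 + \<bar>w\<bar>) powr p)"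
    and "\<kappa> \<ge> p + 2" "A \<in> sets borel" and [measurable]: "h \<in> borel_measurable borel"
  shows "integrable lborel (\<lambda>w. indicator A w * (h (w + a) * kern \<kappa> w) :: real)"
proof (rule Bochner_Integration.integrable_bound)
  show "integrable lborel (\<lambda>w. c2 * p * (1 + \<bar>a\<bar>) powr p * ((1 + \<bar>w\<bar>) powr p * kern \<kappa> w))"
    using assms p by (intro integrable_mult_right integrable_powr_kern) auto
  show "AE w in lborel. norm (indicator A w * (h (w + a) * kern \<kappa> w)) \<le>
      norm (c2 * p * (1 + \<bar>a\<bar>) powr p * ((1 + \<bar>w\<bar>) powr p * kern \<kappa> w))"
  proof (intro AE_I2)
    fix w
    show "norm (indicator A w * (h (w + a) * kern \<kappa> w)) \<le>
      norm (c2 * p * (1 + \<bar>a\<bar>) powr p * ((1 + \<bar>w\<bar>) powr p * kern \<kappa> w))"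
      using bounded_kern_le[of h w a "\<bar>a\<bar>" A \<kappa>, OF assms(1) order_refl] unfolding real_norm_def by linarith
  qed
qed (use assms(3) in measurable)

lemma integrable_foc: "\<kappa> \<ge> p + 2 \<Longrightarrow> A \<in> sets borel \<Longrightarrow>
    integrable lborel (\<lambda>w. indicator A w * (dloss (w + a) * kern \<kappa> w))"
  and integrable_crit: "\<kappa> \<ge> p + 2 \<Longrightarrow> A \<in> sets borel \<Longrightarrow>
    integrable lborel (\<lambda>w. indicator A w * (\<rho> (w + a) * kern \<kappa> w))"
  and integrable_dpos_kern: "\<kappa> \<ge> p + 2 \<Longrightarrow> A \<in> sets borel \<Longrightarrow>
    integrable lborel (\<lambda>w. indicator A w * (dpos (w + a) * kern \<kappa> w))"
  and integrable_dneg_kern: "\<kappa> \<ge> p + 2 \<Longrightarrow> A \<in> sets borel \<Longrightarrow>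
    integrable lborel (\<lambda>w. indicator A w * (dneg (w + a) * kern \<kappa> w))"
  by (rule integrable_bounded_kern; use dloss_loss_bounds in simp)+

lemma crit_eq_real: "\<kappa> \<ge> p + 2 \<Longrightarrow> A \<in> sets borel \<Longrightarrow> crit \<kappa> A a = ennreal (crit_real \<kappa> A a)"
  unfolding crit_def crit_real_def
  by (subst nn_integral_eq_integral[symmetric])
    (auto intro!: integrable_crit nn_integral_cong split: split_indicator)

lemma foc_mono:
  assumes "\<kappa> \<ge> p + 2" "A \<in> sets borel" "a \<le> b"
  shows "foc \<kappa> A a \<le> foc \<kappa> A b"
  unfolding foc_def using assms
  by (intro integral_mono integrable_foc mult_left_mono mult_right_mono dloss_mono) auto

text \<open>Dominated convergence. For p = 1 the integrand is discontinuous in the shift only at w =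
  - a, a null set, so integration smooths the jump of \<open>dloss\<close>.\<close>

lemma foc_tendsto:
  assumes \<kappa>: "\<kappa> \<ge> p + 2" and A: "A \<in> sets borel" and b: "b \<longlonglongrightarrow> a"
  shows "(\<lambda>n. foc \<kappa> A (b n)) \<longlonglongrightarrow> foc \<kappa> A a"
proof -
  obtain R where R: "\<And>n. \<bar>b n\<bar> \<le> R"
    using convergent_imp_Bseq[OF convergentI[OF b]] by (auto simp: Bseq_def)
  show ?thesis unfolding foc_def
  proof (rule integral_dominated_convergence)
    show "integrable lborel (\<lambda>w. c2 * p * (1 + R) powr p * ((1 + \<bar>w\<bar>) powr p * kern \<kappa> w))"
      using \<kappa> p by (intro integrable_mult_right integrable_powr_kern) auto
    show "AE w in lborel. (\<lambda>n. indicator A w * (dloss (w + b n) * kern \<kappa> w))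
        \<longlonglongrightarrow> indicator A w * (dloss (w + a) * kern \<kappa> w)"
      using AE_lborel_singleton[of "- a"]
    proof eventually_elim
      fix w :: real assume "w \<noteq> - a"
      then have "isCont dloss (w + a)" by (intro isCont_dloss) auto
      moreover have "(\<lambda>n. w + b n) \<longlonglongrightarrow> w + a" by (intro tendsto_intros b)
      ultimately have "(\<lambda>n. dloss (w + b n)) \<longlonglongrightarrow> dloss (w + a)"
        by (rule isCont_tendsto_compose)
      then show "(\<lambda>n. indicator A w * (dloss (w + b n) * kern \<kappa> w))
        \<longlonglongrightarrow> indicator A w * (dloss (w + a) * kern \<kappa> w)"
        by (intro tendsto_intros)
    qed
    show "AE w in lborel. norm (indicator A w * (dloss (w + b n) * kern \<kappa> w)) \<le>
        c2 * p * (1 + R) powr p * ((1 + \<bar>w\<bar>) powr p * kern \<kappa> w)" for n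
      using bounded_kern_le[of dloss _ "b n", OF dloss_loss_bounds(3) R] by auto
  qed (use A in measurable)
qed

lemma crit_real_subgradient:
  assumes "\<kappa> \<ge> p + 2" "A \<in> sets borel"
  shows "crit_real \<kappa> A b - crit_real \<kappa> A a \<ge> foc \<kappa> A a * (b - a)"
proof -
  have "foc \<kappa> A a * (b - a) + crit_real \<kappa> A a =
    (\<integral>w. indicator A w * (dloss (w + a) * kern \<kappa> w) * (b - a)
      + indicator A w * (\<rho> (w + a) * kern \<kappa> w) \<partial>lborel)"
    unfolding foc_def crit_real_def
    by (subst Bochner_Integration.integral_add) (use assms in \<open>auto intro!: integrable_foc integrable_crit\<close>)
  also have "\<dots> \<le> crit_real \<kappa> A b"
    unfolding crit_real_def
  proof (intro integral_mono integrable_crit assms Bochner_Integration.integrable_add integrable_mult_left integrable_foc)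
    fix w
    have "dloss (w + a) * (b - a) + \<rho> (w + a) \<le> \<rho> (w + b)"
      using loss_subgradient[of "w + a" "w + b"] by simp
    then have "indicator A w * ((dloss (w + a) * (b - a) + \<rho> (w + a)) * kern \<kappa> w)
        \<le> indicator A w * (\<rho> (w + b) * kern \<kappa> w)"
      by (intro mult_left_mono mult_right_mono) auto
    then show "indicator A w * (dloss (w + a) * kern \<kappa> w) * (b - a) + indicator A w * (\<rho> (w + a) * kern \<kappa> w)
        \<le> indicator A w * (\<rho> (w + b) * kern \<kappa> w)"
      by (simp add: algebra_simps)
  qed
  finally show ?thesis by simp
qed

text \<open>The subgradient inequality, taken at b and compared with the minimizer a, shows that the
  condition at b is at least 0 for b > a and at most 0 for b < a. Approaching a from both sides
  leaves 0, and no derivative is moved under the integral sign.\<close>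

lemma foc_eq_0:
  assumes \<kappa>: "\<kappa> \<ge> p + 2" and A: "A \<in> sets borel" and min: "unique_minimizer (crit \<kappa> A) a"
  shows "foc \<kappa> A a = 0"
proof -
  have "crit_real \<kappa> A a \<le> crit_real \<kappa> A b" for b
  proof (cases "b = a")
    case False
    then have "ennreal (crit_real \<kappa> A a) < ennreal (crit_real \<kappa> A b)"
      using min \<kappa> A by (auto simp: unique_minimizer_def crit_eq_real)
    then show ?thesis by (meson ennreal_leI leD le_cases)
  qed simp
  then have *: "foc \<kappa> A b * (a - b) \<le> 0" for b
    using crit_real_subgradient[OF \<kappa> A, of b a] by (smt (verit))
  have "(\<lambda>n. foc \<kappa> A (a + s / real (Suc n))) \<longlonglongrightarrow> foc \<kappa> A a" for s
    by (rule foc_tendsto[OF \<kappa> A]) real_asymp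
  moreover have "foc \<kappa> A (a + 1 / real (Suc n)) \<ge> 0" for n
    using *[of "a + 1 / real (Suc n)"] by (simp add: mult_le_0_iff zero_le_divide_iff del: of_nat_Suc)
  moreover have "foc \<kappa> A (a + (- 1) / real (Suc n)) \<le> 0" for n
    using *[of "a + (- 1) / real (Suc n)"]
    by (simp add: mult_le_0_iff divide_le_0_iff zero_le_divide_iff del: of_nat_Suc)
  ultimately have "0 \<le> foc \<kappa> A a" "foc \<kappa> A a \<le> 0"
    by (meson LIMSEQ_le_const LIMSEQ_le_const2)+
  then show ?thesis by simp
qed

text \<open>On the window the increments of the derivative integrate to a second difference of the
  loss, which is at least linear for every exponent \<open>p \<ge> 1\<close>, including those where the
  derivative of the loss jumps or its second derivative vanishes.\<close>

lemma foc_gap: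
  assumes \<kappa>: "\<kappa> \<ge> p + 2" and A: "A \<in> sets borel" and ab: "a \<le> b" "{- b - 1..- a} \<subseteq> A"
    and R: "\<bar>a\<bar> \<le> R" "\<bar>b\<bar> \<le> R"
  shows "c1 * kern \<kappa> (R + 1) * (b - a) \<le> foc \<kappa> A b - foc \<kappa> A a"
proof -
  \<comment> \<open>On this window w + b runs over {- 1..b - a} and w + a over {a - b - 1..0}. The
    extra unit on the left is essential: {- b..- a} alone would give only a multiple of (b - a)^p,
    which for p > 1 is not linear near 0.\<close>
  define W where "W = {- b - 1..- a}"
  define \<Delta> where "\<Delta> w = dloss (w + b) - dloss (w + a)" for w
  have \<Delta>: "\<Delta> w \<ge> 0" for w using dloss_mono ab by (simp add: \<Delta>_def)
  have [measurable]: "\<Delta> \<in> borel_measurable borel" unfolding \<Delta>_def by measurable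
  have hi: "(\<Delta> has_integral (\<rho> (- a + b) - \<rho> (- b - 1 + b)) - (\<rho> (- a + a) - \<rho> (- b - 1 + a))) W"
    unfolding \<Delta>_def W_def using ab by (intro has_integral_diff loss_has_integral) auto
  have eq: "foc \<kappa> A b - foc \<kappa> A a = (\<integral>w. indicator A w * (\<Delta> w * kern \<kappa> w) \<partial>lborel)"
    unfolding foc_def \<Delta>_def
    by (subst Bochner_Integration.integral_diff[symmetric])
      (use \<kappa> A in \<open>auto intro!: integrable_foc simp: left_diff_distrib right_diff_distrib\<close>)
  have int: "integrable lborel (\<lambda>w. indicator A w * (\<Delta> w * kern \<kappa> w))"
    using Bochner_Integration.integrable_diff[OF integrable_foc[OF \<kappa> A, of b] integrable_foc[OF \<kappa> A, of a]]
    by (simp add: \<Delta>_def algebra_simps)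
  define d where "d = b - a"
  have d: "d \<ge> 0" using ab by (simp add: d_def)
  \<comment> \<open>Bernoulli: (1 + d)^p \<ge> 1 + d. The right branch of the loss adds c2 d^p,
    which is dropped.\<close>
  have "c1 * d \<le> c1 * ((1 + d) powr p - 1)"
    using c1 d p powr_mono[of 1 p "1 + d"] by (intro mult_left_mono) auto
  also have "\<dots> \<le> c2 * d powr p + c1 * ((1 + d) powr p - 1)"
    using c1 c12 by simp
  also have "\<dots> = (\<rho> (- a + b) - \<rho> (- b - 1 + b)) - (\<rho> (- a + a) - \<rho> (- b - 1 + a))"
    using d p unfolding d_def by (auto simp: loss_def algebra_simps)
  finally have D: "c1 * d \<le> (\<rho> (- a + b) - \<rho> (- b - 1 + b)) - (\<rho> (- a + a) - \<rho> (- b - 1 + a))" .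
  have "ennreal (c1 * kern \<kappa> (R + 1) * d) \<le> ennreal (kern \<kappa> (R + 1)) * ennreal ((\<rho> (- a + b) - \<rho> (- b - 1 + b)) - (\<rho> (- a + a) - \<rho> (- b - 1 + a)))"
    using D by (subst ennreal_mult'[symmetric]) (auto intro!: ennreal_leI simp: mult_ac)
  also have "\<dots> = ennreal (kern \<kappa> (R + 1)) * (\<integral>\<^sup>+w. ennreal (indicator W w * \<Delta> w) \<partial>lborel)"
    using nn_integral_has_integral_lebesgue[OF _ hi] \<Delta> by simp
  also have "\<dots> = (\<integral>\<^sup>+w. ennreal (kern \<kappa> (R + 1)) * ennreal (indicator W w * \<Delta> w) \<partial>lborel)"
    by (rule nn_integral_cmult[symmetric]) (simp add: W_def)
  also have "\<dots> \<le> (\<integral>\<^sup>+w. ennreal (indicator A w * (\<Delta> w * kern \<kappa> w)) \<partial>lborel)"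
  proof (intro nn_integral_mono)
    fix w
    show "ennreal (kern \<kappa> (R + 1)) * ennreal (indicator W w * \<Delta> w) \<le> ennreal (indicator A w * (\<Delta> w * kern \<kappa> w))"
    proof (cases "w \<in> W")
      case True
      then have "kern \<kappa> (R + 1) \<le> kern \<kappa> w"
        using \<kappa> p R by (intro kern_mono_abs) (auto simp: W_def)
      then show ?thesis using True ab \<Delta>[of w]
        by (subst ennreal_mult'[symmetric]) (auto simp: W_def mult.commute intro!: ennreal_leI mult_left_mono)
    qed simp
  qed
  also have "\<dots> = ennreal (foc \<kappa> A b - foc \<kappa> A a)"
    unfolding eq using int \<Delta> by (intro nn_integral_eq_integral) auto
  finally show ?thesis
    using c1 d foc_mono[OF \<kappa> A ab(1)] by (subst (asm) ennreal_le_iff) (auto simp: d_def)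
qed

lemma foc_strict_mono:
  assumes "\<kappa> \<ge> p + 2" "A \<in> sets borel" "a < b" "{- b - 1..- a} \<subseteq> A"
  shows "foc \<kappa> A a < foc \<kappa> A b"
proof -
  have "0 < c1 * kern \<kappa> (max \<bar>a\<bar> \<bar>b\<bar> + 1) * (b - a)"
    using c1 assms by (intro mult_pos_pos) auto
  also have "\<dots> \<le> foc \<kappa> A b - foc \<kappa> A a"
    using assms by (intro foc_gap) auto
  finally show ?thesis by simp
qed

lemma foc_split:
  assumes "\<kappa> \<ge> p + 2" "A \<in> sets borel" "B \<in> sets borel" "A \<inter> B = {}"
  shows "foc \<kappa> (A \<union> B) a = foc \<kappa> A a + foc \<kappa> B a"
proof -
  have "indicator (A \<union> B) w = (indicator A w + indicator B w :: real)" for w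
    using assms by (auto simp: indicator_def)
  then show ?thesis
    unfolding foc_def using assms by (subst Bochner_Integration.integral_add[symmetric])
      (auto intro!: integrable_foc simp: distrib_right)
qed

lemma foc_nonneg: "A \<subseteq> {- a..} \<Longrightarrow> foc \<kappa> A a \<ge> 0"
  unfolding foc_def using dloss_pos dloss_0
  by (intro Bochner_Integration.integral_nonneg)
    (force simp: indicator_def order.order_iff_strict zero_less_mult_iff add_eq_0_iff)

text \<open>For such a shift w + a \<le> 0 on the whole half line, so the derivative never becomes
  positive. This locates the roots: a root on {..y} exceeds - y, which makes the integrand positive
  near the endpoint y.\<close>

lemma foc_atMost_neg:
  assumes \<kappa>: "\<kappa> \<ge> p + 2" and "a \<le> - y"
  shows "foc \<kappa> {..y} a < 0"
proof -
  have "\<not> (\<integral>w. - (indicator {..y} w * (dloss (w + a) * kern \<kappa> w)) \<partial>lborel) \<le> 0"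
  proof
    assume *: "(\<integral>w. - (indicator {..y} w * (dloss (w + a) * kern \<kappa> w)) \<partial>lborel) \<le> 0"
    have nonneg: "0 \<le> - (indicator {..y} w * (dloss (w + a) * kern \<kappa> w))" for w
      using dloss_mono[of "w + a" 0] assms by (auto simp: indicator_def mult_le_0_iff)
    have int: "integrable lborel (\<lambda>w. - (indicator {..y} w * (dloss (w + a) * kern \<kappa> w)))"
      using \<kappa> by (intro integrable_minus integrable_foc) auto
    have "(\<integral>w. - (indicator {..y} w * (dloss (w + a) * kern \<kappa> w)) \<partial>lborel) = 0"
      by (rule antisym[OF * Bochner_Integration.integral_nonneg[OF nonneg]])
    then have "AE w in lborel. - (indicator {..y} w * (dloss (w + a) * kern \<kappa> w)) = 0"
      using integral_nonneg_eq_0_iff_AE[OF int AE_I2[OF nonneg]] by blast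
    then have "AE w in lborel. w \<notin> {..<y}"
    proof eventually_elim
      case (elim w)
      then show ?case using dloss_neg[of "w + a"] assms kern_pos[of \<kappa> w] by auto
    qed
    then have "AE w in lborel. w \<notin> {y - 1<..<y}" by eventually_elim auto
    then have "emeasure lborel {y - 1<..<y} = 0"
      by (subst (asm) AE_iff_measurable[OF _ refl]) (auto simp: greaterThanLessThan_def greaterThan_def lessThan_def Int_def)
    then show False by simp
  qed
  then show ?thesis by (simp add: foc_def)
qed

lemma foc_atMost_tendsto:
  assumes "\<kappa> \<ge> p + 2"
  shows "((\<lambda>y. foc \<kappa> {..y} a) \<longlongrightarrow> foc \<kappa> UNIV a) at_top"
  using tendsto_integral_at_top[OF _ integrable_foc[OF assms, of UNIV a]] by (simp add: foc_def)

end

section \<open>Roots of the first-order condition\<close>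

lemma abs_cont_on_interval_lipschitz:
  assumes L: "\<And>x y. a \<le> x \<Longrightarrow> x \<le> y \<Longrightarrow> y \<le> b \<Longrightarrow> \<bar>g y - g x\<bar> \<le> L * (y - x)"
  shows "abs_cont_on_interval a b g"
  unfolding abs_cont_on_interval_def
proof (intro allI impI)
  fix \<epsilon> :: real assume "\<epsilon> > 0"
  show "\<exists>\<eta>>0. \<forall>(N::nat) u v. (\<forall>i<N. a \<le> u i \<and> u i \<le> v i \<and> v i \<le> b) \<and>
        disjoint_family_on (\<lambda>i. {u i<..<v i}) {..<N} \<and> (\<Sum>i<N. v i - u i) < \<eta> \<longrightarrow>
        (\<Sum>i<N. \<bar>g (v i) - g (u i)\<bar>) < \<epsilon>"
  proof (intro exI[of _ "\<epsilon> / (\<bar>L\<bar> + 1)"] conjI allI impI)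
    fix N :: nat and u v :: "nat \<Rightarrow> real"
    assume *: "(\<forall>i<N. a \<le> u i \<and> u i \<le> v i \<and> v i \<le> b) \<and>
      disjoint_family_on (\<lambda>i. {u i<..<v i}) {..<N} \<and> (\<Sum>i<N. v i - u i) < \<epsilon> / (\<bar>L\<bar> + 1)"
    have "(\<Sum>i<N. \<bar>g (v i) - g (u i)\<bar>) \<le> (\<Sum>i<N. (\<bar>L\<bar> + 1) * (v i - u i))"
    proof (intro sum_mono)
      fix i assume "i \<in> {..<N}"
      then have "\<bar>g (v i) - g (u i)\<bar> \<le> L * (v i - u i)" "u i \<le> v i" using * L by auto
      moreover have "L * (v i - u i) \<le> (\<bar>L\<bar> + 1) * (v i - u i)"
        using \<open>u i \<le> v i\<close> by (intro mult_right_mono) auto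
      ultimately show "\<bar>g (v i) - g (u i)\<bar> \<le> (\<bar>L\<bar> + 1) * (v i - u i)" by linarith
    qed
    also have "\<dots> = (\<bar>L\<bar> + 1) * (\<Sum>i<N. v i - u i)" by (simp add: sum_distrib_left)
    also have "\<dots> < \<epsilon>" using * by (simp add: field_simps)
    finally show "(\<Sum>i<N. \<bar>g (v i) - g (u i)\<bar>) < \<epsilon>" .
  qed (use \<open>\<epsilon> > 0\<close> in auto)
qed

lemma abs_cont_imp_isCont:
  assumes "\<And>a b. abs_cont_on_interval a b g"
  shows "isCont g x"
  unfolding continuous_at_eps_delta
proof (intro allI impI)
  fix \<epsilon> :: real assume "\<epsilon> > 0"
  with assms[of "x - 1" "x + 1"] obtain \<eta> where \<eta>: "\<eta> > 0"
    and *: "\<And>(N::nat) u v. (\<forall>i<N. x - 1 \<le> u i \<and> u i \<le> v i \<and> v i \<le> x + 1) \<and>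
        disjoint_family_on (\<lambda>i. {u i<..<v i}) {..<N} \<and> (\<Sum>i<N. v i - u i) < \<eta> \<Longrightarrow>
        (\<Sum>i<N. \<bar>g (v i) - g (u i)\<bar>) < \<epsilon>"
    unfolding abs_cont_on_interval_def by meson
  show "\<exists>d>0. \<forall>x'. dist x' x < d \<longrightarrow> dist (g x') (g x) < \<epsilon>"
  proof (intro exI[of _ "min \<eta> 1"] conjI allI impI)
    fix x' assume x': "dist x' x < min \<eta> 1"
    have "\<bar>g (max x x') - g (min x x')\<bar> < \<epsilon>"
      using *[of 1 "\<lambda>_. min x x'" "\<lambda>_. max x x'"] x'
      by (auto simp: dist_real_def disjoint_family_on_def) linarith
    then show "dist (g x') (g x) < \<epsilon>"
      by (auto simp: dist_real_def min_def max_def split: if_splits)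
  qed (use \<eta> in auto)
qed

section \<open>Dependence of the root on the half line\<close>

context asym_power_loss
begin

lemma foc_root_gt:
  assumes "\<kappa> \<ge> p + 2" "foc \<kappa> {..y} a = 0"
  shows "- y < a"
  using foc_atMost_neg[OF assms(1), of a y] assms(2) by force

lemma foc_atMost_split:
  assumes "\<kappa> \<ge> p + 2" "y1 \<le> y2"
  shows "foc \<kappa> {..y2} a = foc \<kappa> {..y1} a + foc \<kappa> {y1<..y2} a"
proof -
  have "{..y2} = {..y1} \<union> {y1<..y2}" using assms by auto
  then show ?thesis by (metis foc_split[OF assms(1)] atMost_borel greaterThanAtMost_borel
      disjoint_iff atMost_iff greaterThanAtMost_iff not_le)
qed

text \<open>On {y1<..y2} the argument w + a1 is positive by \<open>foc_root_gt\<close>, so enlarging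
  the half line adds nonnegative mass and pushes the root down.\<close>

lemma foc_root_antimono:
  assumes \<kappa>: "\<kappa> \<ge> p + 2" and root: "foc \<kappa> {..y1} a1 = 0" "foc \<kappa> {..y2} a2 = 0" and y: "y1 \<le> y2"
  shows "a2 \<le> a1"
proof (rule ccontr)
  assume "\<not> a2 \<le> a1"
  have "foc \<kappa> {y1<..y2} a1 \<ge> 0"
    using foc_root_gt[OF \<kappa> root(1)] by (intro foc_nonneg) auto
  then have "foc \<kappa> {..y2} a1 \<ge> 0"
    using foc_atMost_split[OF \<kappa> y, of a1] root by simp
  moreover have "foc \<kappa> {..y2} a1 < foc \<kappa> {..y2} a2"
    using \<open>\<not> a2 \<le> a1\<close> foc_root_gt[OF \<kappa> root(1)] y by (intro foc_strict_mono \<kappa>) auto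
  ultimately show False using root by simp
qed

text \<open>An implicit function argument with finite increments. \<open>foc_gap\<close> bounds the
  slope in the shift from below, the strip {y1<..y2} changes the value by at most its length times a
  bound of the integrand, and the constant is the quotient of the two.\<close>

lemma foc_root_lipschitz:
  assumes \<kappa>: "\<kappa> \<ge> p + 2" and root: "foc \<kappa> {..y1} a1 = 0" "foc \<kappa> {..y2} a2 = 0" and y: "y1 \<le> y2"
    and R: "\<bar>a1\<bar> \<le> R" "\<bar>a2\<bar> \<le> R"
  shows "a1 - a2 \<le> c2 * p * (1 + R) powr p * 2 powr (p / 2) / (c1 * kern \<kappa> (R + 1)) * (y2 - y1)"
proof -
  define K where "K = c2 * p * (1 + R) powr p * 2 powr (p / 2)"
  have "c1 * kern \<kappa> (R + 1) * (a1 - a2) \<le> foc \<kappa> {..y2} a1 - foc \<kappa> {..y2} a2"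
    using foc_root_antimono[OF \<kappa> root y] foc_root_gt[OF \<kappa> root(2)] R by (intro foc_gap \<kappa>) auto
  also have "\<dots> = foc \<kappa> {y1<..y2} a1"
    using foc_atMost_split[OF \<kappa> y, of a1] root by simp
  also have "\<dots> \<le> (\<integral>w. indicator {y1<..y2} w * K \<partial>lborel)"
    unfolding foc_def
  proof (intro integral_mono integrable_foc \<kappa>)
    fix w
    have "\<bar>indicator UNIV w * (dloss (w + a1) * kern \<kappa> w)\<bar>
        \<le> c2 * p * (1 + R) powr p * ((1 + \<bar>w\<bar>) powr p * kern \<kappa> w)"
      by (rule bounded_kern_le[of dloss, OF dloss_loss_bounds(3) R(1)])
    also have "\<dots> \<le> K"
      unfolding K_def using powr_kern_le(2)[OF _ \<kappa>, of w] p c1 c12 by (intro mult_left_mono) auto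
    finally show "indicator {y1<..y2} w * (dloss (w + a1) * kern \<kappa> w) \<le> indicator {y1<..y2} w * K"
      by (auto simp: indicator_def)
  qed (auto simp: integrable_indicator_iff y)
  also have "\<dots> = K * (y2 - y1)" using y by simp
  finally have "(a1 - a2) * (c1 * kern \<kappa> (R + 1)) \<le> K * (y2 - y1)" by (simp add: mult_ac)
  moreover have "c1 * kern \<kappa> (R + 1) > 0" using c1 by simp
  ultimately have "a1 - a2 \<le> K * (y2 - y1) / (c1 * kern \<kappa> (R + 1))"
    by (subst pos_le_divide_eq)
  then show ?thesis
    unfolding K_def[symmetric] by simp
qed

text \<open>The missing part {y<..} contributes nonnegatively at \<open>a\<close>, so the condition
  on the whole line is already at least 0 there.\<close>

lemma foc_root_ge:
  assumes \<kappa>: "\<kappa> \<ge> p + 2" and root: "foc \<kappa> {..y} a = 0" and c: "foc \<kappa> UNIV c = 0"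
  shows "c \<le> a"
proof (rule ccontr)
  assume "\<not> c \<le> a"
  then have "foc \<kappa> UNIV a < foc \<kappa> UNIV c" by (intro foc_strict_mono \<kappa>) auto
  moreover have "UNIV = {..y} \<union> {y<..}" by auto
  then have "foc \<kappa> UNIV a = foc \<kappa> {..y} a + foc \<kappa> {y<..} a"
    by (metis foc_split[OF \<kappa>] atMost_borel greaterThan_borel disjoint_iff atMost_iff
        greaterThan_iff not_le)
  moreover have "foc \<kappa> {y<..} a \<ge> 0"
    using foc_root_gt[OF \<kappa> root] by (intro foc_nonneg) auto
  ultimately show False using root c by simp
qed

text \<open>At c + e the condition is strictly positive on the whole line, hence on {..y} for large
  y; this traps the root between c and c + e.\<close>

lemma foc_root_tendsto:
  assumes \<kappa>: "\<kappa> \<ge> p + 2" and root: "\<And>y. foc \<kappa> {..y} (a y) = 0" and c: "foc \<kappa> UNIV c = 0"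
  shows "(a \<longlongrightarrow> c) at_top"
proof (rule tendstoI)
  fix e :: real assume "e > 0"
  then have "foc \<kappa> UNIV c < foc \<kappa> UNIV (c + e)" by (intro foc_strict_mono \<kappa>) auto
  then have "eventually (\<lambda>y. 0 < foc \<kappa> {..y} (c + e)) at_top"
    using c order_tendstoD(1)[OF foc_atMost_tendsto[OF \<kappa>]] by auto
  then show "eventually (\<lambda>y. dist (a y) c < e) at_top"
  proof eventually_elim
    case (elim y)
    have "a y < c + e"
      using foc_mono[OF \<kappa>, of "{..y}" "c + e" "a y"] elim root[of y] by force
    then show ?case
      using foc_root_ge[OF \<kappa> root c, of y] by (auto simp: dist_real_def)
  qed
qed

lemma foc_root_class_C:
  assumes \<kappa>: "\<kappa> \<ge> p + 2" and root: "\<And>y. foc \<kappa> {..y} (c + g y) = 0" and c: "foc \<kappa> UNIV c = 0"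
  shows "g \<in> class_C"
proof -
  have anti: "g y2 \<le> g y1" if "y1 \<le> y2" for y1 y2
    using foc_root_antimono[OF \<kappa> root root that] by simp
  have "abs_cont_on_interval \<alpha> \<beta> g" for \<alpha> \<beta>
  proof (rule abs_cont_on_interval_lipschitz)
    fix x y assume xy: "\<alpha> \<le> x" "x \<le> y" "y \<le> \<beta>"
    define R where "R = max \<bar>c + g \<alpha>\<bar> \<bar>c + g \<beta>\<bar>"
    have "g \<beta> \<le> g x" "g x \<le> g \<alpha>" "g \<beta> \<le> g y" "g y \<le> g x" "g y \<le> g \<alpha>" using anti xy by auto
    then have "\<bar>c + g x\<bar> \<le> R" "\<bar>c + g y\<bar> \<le> R" by (auto simp: R_def)
    from foc_root_lipschitz[OF \<kappa> root root xy(2) this] \<open>g y \<le> g x\<close>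
    show "\<bar>g y - g x\<bar> \<le> c2 * p * (1 + R) powr p * 2 powr (p / 2) / (c1 * kern \<kappa> (R + 1)) * (y - x)"
      by simp
  qed
  moreover have "antimono g" using anti by (auto simp: antimono_def)
  \<comment> \<open>A root on {..y} exceeds - y, so \<open>g\<close> is unbounded towards minus
    infinity.\<close>
  moreover have "\<not> g constant_on UNIV"
  proof
    assume "g constant_on UNIV"
    then obtain k where k: "g y = k" for y by (auto simp: constant_on_def)
    show False using foc_root_gt[OF \<kappa> root, of "- (c + k)"] by (simp add: k)
  qed
  moreover have "(g \<longlongrightarrow> 0) at_top"
  proof -
    have "((\<lambda>y. (c + g y) - c) \<longlongrightarrow> c - c) at_top"
      by (intro tendsto_intros foc_root_tendsto[OF \<kappa> root c])
    then show ?thesis by simp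
  qed
  ultimately show ?thesis by (auto simp: class_C_def)
qed

end

section \<open>Dependence of the root on the kernel exponent for the symmetric loss\<close>

lemma integral_reflect_lborel: "(\<integral>w. f (- w) \<partial>lborel) = (\<integral>w. f (w::real) \<partial>lborel :: real)"
  using lborel_integral_real_affine[of "-1" f 0] by simp

lemma crit_UNIV_minus:
  assumes "asym_power_loss c c p"
  shows "asym_power_loss.crit c c p \<kappa> UNIV (- a) = asym_power_loss.crit c c p \<kappa> UNIV a"
proof -
  interpret asym_power_loss c c p by fact
  have *: "\<rho> (- t) = \<rho> t" for t by (simp add: loss_eq)
  have "(\<integral>\<^sup>+w. ennreal (\<rho> (w + a) * kern \<kappa> w) \<partial>lborel) = (\<integral>\<^sup>+w. ennreal (\<rho> (- w + a) * kern \<kappa> w) \<partial>lborel)"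
    using nn_integral_real_affine[of "\<lambda>w. ennreal (\<rho> (w + a) * kern \<kappa> w)" "-1" 0] by simp
  also have "\<dots> = (\<integral>\<^sup>+w. ennreal (\<rho> (w + (- a)) * kern \<kappa> w) \<partial>lborel)"
    using *[of "_ - a"] by (simp add: add.commute)
  finally show ?thesis by (simp add: crit_def)
qed

lemma foc_UNIV_0:
  assumes "asym_power_loss c c p"
  shows "asym_power_loss.foc c c p \<kappa> UNIV 0 = 0"
proof -
  interpret asym_power_loss c c p by fact
  have *: "dloss (- t) = - dloss t" for t by (simp add: dloss_def dpos_def dneg_def)
  show ?thesis
    using integral_reflect_lborel[of "\<lambda>w. dloss w * kern \<kappa> w"] by (simp add: foc_def *)
qed

text \<open>Folding the line at the origin turns the first-order condition into one whose integrand
  changes sign once, from \<open>+\<close> to \<open>-\<close>, as \<open>\<bar>w\<bar>\<close> grows past \<open>max y a\<close>; the additional factor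
  \<open>kern l\<close> decreases in \<open>\<bar>w\<bar>\<close>.\<close>

lemma foc_nonneg_of_root:
  assumes "asym_power_loss c c p" and \<kappa>: "\<kappa> \<ge> p + 2" and l: "l \<ge> 0" and a: "a \<ge> 0"
    and root: "asym_power_loss.foc c c p \<kappa> {..y} a = 0"
  shows "asym_power_loss.foc c c p (\<kappa> + l) {..y} a \<ge> 0"
proof -
  interpret asym_power_loss c c p by fact
  have odd: "dloss (- t) = - dloss t" for t by (simp add: dloss_def dpos_def dneg_def)
  have sgn: "t \<ge> 0 \<Longrightarrow> dloss t \<ge> 0" "t \<le> 0 \<Longrightarrow> dloss t \<le> 0" for t
    using dloss_mono[of 0 t] dloss_mono[of t 0] by auto
  define r where "r = max y a"
  \<comment> \<open>Subtracting \<open>kern l r\<close> times the root equation does not change the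
    integral, and it makes the weight vanish at |w| = r, so that its sign is known on either
    side.\<close>
  define E where "E w = kern \<kappa> w * (kern l w - kern l r)" for w
  have E_even: "E (- w) = E w" for w by (simp add: E_def)
  have E_nonneg: "E w \<ge> 0" if "\<bar>w\<bar> \<le> r" for w
    using kern_mono_abs[OF l, of w r] that a by (auto simp: E_def r_def)
  have E_nonpos: "E w \<le> 0" if "\<bar>w\<bar> \<ge> r" for w
    using kern_mono_abs[OF l, of r w] that a by (auto simp: E_def r_def mult_le_0_iff)
  have [measurable]: "E \<in> borel_measurable borel" unfolding E_def by measurable
  have split: "indicator B w * (dloss (w + a) * E w) = indicator B w * (dloss (w + a) * kern (\<kappa> + l) w)
      - kern l r * (indicator B w * (dloss (w + a) * kern \<kappa> w))" for B w
    by (simp add: E_def kern_add algebra_simps)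
  have int: "integrable lborel (\<lambda>w. indicator B w * (dloss (w + a) * E w))" if "B \<in> sets borel" for B
    unfolding split using \<kappa> l that
    by (intro Bochner_Integration.integrable_diff integrable_mult_right integrable_foc) auto
  have "foc (\<kappa> + l) {..y} a = (\<integral>w. indicator {..y} w * (dloss (w + a) * E w) \<partial>lborel) + kern l r * foc \<kappa> {..y} a"
    unfolding split foc_def using \<kappa> l
    by (subst Bochner_Integration.integral_diff) (auto intro!: integrable_mult_right integrable_foc)
  also have "\<dots> = (\<integral>w. indicator {..y} w * (dloss (w + a) * E w) \<partial>lborel)"
    using root by simp
  also have "\<dots> \<ge> 0"
  \<comment> \<open>For y \<le> a no folding is necessary: r = a, and on {..y} both factors change
    sign at w = - a. For a < y the weight changes sign at - y but \<open>dloss (w + a)\<close> at -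
    a, and the disagreement lies in {- y..y}, which is folded.\<close>
  proof (cases "y \<le> a")
    case True
    show ?thesis
    proof (intro Bochner_Integration.integral_nonneg)
      fix w
      show "0 \<le> indicator {..y} w * (dloss (w + a) * E w)"
      proof (cases "w \<ge> - a")
        case True
        then show ?thesis
          using E_nonneg[of w] sgn(1)[of "w + a"] \<open>y \<le> a\<close> by (auto simp: indicator_def r_def)
      next
        case False
        then show ?thesis
          using E_nonpos[of w] sgn(2)[of "w + a"] \<open>y \<le> a\<close> a
          by (auto simp: indicator_def r_def zero_le_mult_iff)
      qed
    qed
  next
    case False
    then have y: "a < y" "r = y" by (auto simp: r_def)
    have "indicator {..y} w = (indicator {..<- y} w + indicator {- y..y} w :: real)" for w
      using y a by (auto simp: indicator_def)
    then have "(\<integral>w. indicator {..y} w * (dloss (w + a) * E w) \<partial>lborel) =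
        (\<integral>w. indicator {..<- y} w * (dloss (w + a) * E w) \<partial>lborel) +
        (\<integral>w. indicator {- y..y} w * (dloss (w + a) * E w) \<partial>lborel)"
      by (subst Bochner_Integration.integral_add[symmetric]) (auto intro!: int simp: distrib_right)
    moreover have "(\<integral>w. indicator {..<- y} w * (dloss (w + a) * E w) \<partial>lborel) \<ge> 0"
    proof (intro Bochner_Integration.integral_nonneg)
      fix w show "0 \<le> indicator {..<- y} w * (dloss (w + a) * E w)"
        using mult_nonpos_nonpos[OF sgn(2)[of "w + a"] E_nonpos[of w]] y a by (auto simp: indicator_def)
    qed
    moreover have "(\<integral>w. indicator {- y..y} w * (dloss (w + a) * E w) \<partial>lborel) \<ge> 0"
    proof -
      let ?h = "\<lambda>w. indicator {- y..y} w * (dloss (w + a) * E w)"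
      have ih: "integrable lborel ?h" by (rule int) auto
      have "integrable lborel (\<lambda>w. ?h (0 + (- 1) * w))"
        by (rule lborel_integrable_real_affine[OF ih]) simp
      then have ih': "integrable lborel (\<lambda>w. ?h (- w))" by simp
      have "2 * (\<integral>w. ?h w \<partial>lborel) = (\<integral>w. ?h w + ?h (- w) \<partial>lborel)"
        using integral_reflect_lborel[of ?h]
        by (subst Bochner_Integration.integral_add[OF ih ih']) simp
      also have "\<dots> \<ge> 0"
      proof (intro Bochner_Integration.integral_nonneg)
        fix w
        \<comment> \<open>Oddness turns the folded factor into the increment of the monotone
          \<open>dloss\<close> from w - a to w + a, nonnegative because a \<ge> 0.\<close>
        have "dloss (w + a) + dloss (- w + a) \<ge> 0"
          using dloss_mono[of "w - a" "w + a"] odd[of "w - a"] a by simp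
        then have "(dloss (w + a) + dloss (- w + a)) * E w \<ge> 0" if "\<bar>w\<bar> \<le> y"
          using E_nonneg[of w] that y by (intro mult_nonneg_nonneg) auto
        then show "0 \<le> ?h w + ?h (- w)"
          by (auto simp: indicator_def E_even distrib_right)
      qed
      finally show ?thesis by simp
    qed
    ultimately show ?thesis by simp
  qed
  finally show ?thesis .
qed

lemma foc_root_le:
  assumes "asym_power_loss c c p" and \<kappa>: "\<kappa> \<ge> p + 2" and l: "l \<ge> 0" and a: "a \<ge> 0"
    and root: "asym_power_loss.foc c c p \<kappa> {..y} a = 0" "asym_power_loss.foc c c p (\<kappa> + l) {..y} b = 0"
  shows "b \<le> a"
proof (rule ccontr)
  interpret asym_power_loss c c p by fact
  assume "\<not> b \<le> a"
  then have "foc (\<kappa> + l) {..y} a < foc (\<kappa> + l) {..y} b"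
    using \<kappa> l foc_root_gt[OF \<kappa> root(1)] by (intro foc_strict_mono) auto
  then show False
    using foc_nonneg_of_root[OF assms(1) \<kappa> l a root(1)] root(2) by simp
qed

section \<open>Changes of variables\<close>

text \<open>\<open>radial_moment F m\<close> is the constant that splits off when an integral over the half plane is
  written in the coordinates \<open>w = u / v\<close> and \<open>r = sqrt (u\<^sup>2 + v\<^sup>2)\<close>.\<close>

definition radial_moment :: "(real \<Rightarrow> real) \<Rightarrow> real \<Rightarrow> ennreal" where
  "radial_moment F m = (\<integral>\<^sup>+r\<in>{0<..}. ennreal (r powr m * F (r\<^sup>2)) \<partial>lborel)"

lemma nn_integral_Ioi_scale:
  assumes [measurable]: "H \<in> borel_measurable borel" and "q > 0"
  shows "(\<integral>\<^sup>+r\<in>{0<..}. H (r :: real) \<partial>lborel) = ennreal q * (\<integral>\<^sup>+r\<in>{0<..}. H (q * r) \<partial>lborel)"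
  using assms(2) by (subst nn_integral_real_affine[where c = q and t = 0])
    (auto simp: indicator_def zero_less_mult_iff intro!: arg_cong2[where f = "(*)"] nn_integral_cong)

lemma nn_integral_lborel_swap:
  assumes "case_prod h \<in> borel_measurable (borel \<Otimes>\<^sub>M borel)"
  shows "(\<integral>\<^sup>+(v::real). \<integral>\<^sup>+(u::real). h u v \<partial>lborel \<partial>lborel) = (\<integral>\<^sup>+u. \<integral>\<^sup>+v. h u v \<partial>lborel \<partial>lborel)"
  using assms by (intro lborel_pair.Fubini') simp

text \<open>First u = v w, which contributes a factor v; then v = q r with q = (1 + w^2)^(-1/2), for
  which u^2 + v^2 = r^2 and which contributes q^(m + 1), that is, the kernel. As \<open>G\<close> is
  any function of the ratio, indicators of half lines in w are included.\<close>

lemma nn_integral_polar: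
  assumes [measurable]: "F \<in> borel_measurable borel" "G \<in> borel_measurable borel"
    and F: "\<And>t. F t \<ge> (0::real)"
  shows "(\<integral>\<^sup>+v\<in>{0<..}. (\<integral>\<^sup>+u. G (u / v) * ennreal (v powr (m - 1) * F (u\<^sup>2 + v\<^sup>2)) \<partial>lborel) \<partial>lborel)
    = radial_moment F m * (\<integral>\<^sup>+w. G w * ennreal (kern (m + 1) w) \<partial>lborel)"
proof -
  have "(\<integral>\<^sup>+v\<in>{0<..}. (\<integral>\<^sup>+u. G (u / v) * ennreal (v powr (m - 1) * F (u\<^sup>2 + v\<^sup>2)) \<partial>lborel) \<partial>lborel)
    = (\<integral>\<^sup>+v. (\<integral>\<^sup>+w. G w * ennreal (v powr m * F (v\<^sup>2 * (1 + w\<^sup>2))) * indicator {0<..} v \<partial>lborel) \<partial>lborel)"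
  proof (intro nn_integral_cong)
    fix v :: real
    show "(\<integral>\<^sup>+u. G (u / v) * ennreal (v powr (m - 1) * F (u\<^sup>2 + v\<^sup>2)) \<partial>lborel) * indicator {0<..} v
      = (\<integral>\<^sup>+w. G w * ennreal (v powr m * F (v\<^sup>2 * (1 + w\<^sup>2))) * indicator {0<..} v \<partial>lborel)"
    proof (cases "v > 0")
      case True
      have "(\<integral>\<^sup>+u. G (u / v) * ennreal (v powr (m - 1) * F (u\<^sup>2 + v\<^sup>2)) \<partial>lborel)
        = ennreal v * (\<integral>\<^sup>+w. G w * ennreal (v powr (m - 1) * F ((v * w)\<^sup>2 + v\<^sup>2)) \<partial>lborel)"
        using True by (subst nn_integral_real_affine[where c = v and t = 0]) auto
      also have "\<dots> = (\<integral>\<^sup>+w. ennreal v * (G w * ennreal (v powr (m - 1) * F ((v * w)\<^sup>2 + v\<^sup>2))) \<partial>lborel)"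
        by (rule nn_integral_cmult[symmetric]) measurable
      also have "\<dots> = (\<integral>\<^sup>+w. G w * ennreal (v powr m * F (v\<^sup>2 * (1 + w\<^sup>2))) \<partial>lborel)"
      proof (intro nn_integral_cong)
        fix w
        have "v powr m = v * v powr (m - 1)"
          using powr_mult_base[of v "m - 1"] True by simp
        then have "v powr m * F (v\<^sup>2 * (1 + w\<^sup>2)) = v * (v powr (m - 1) * F ((v * w)\<^sup>2 + v\<^sup>2))"
          by (simp add: algebra_simps power_mult_distrib)
        then show "ennreal v * (G w * ennreal (v powr (m - 1) * F ((v * w)\<^sup>2 + v\<^sup>2)))
            = G w * ennreal (v powr m * F (v\<^sup>2 * (1 + w\<^sup>2)))"
          using True by (simp add: ennreal_mult' mult_ac)
      qed
      finally show ?thesis using True by simp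
    qed simp
  qed
  also have "\<dots> = (\<integral>\<^sup>+w. (\<integral>\<^sup>+v. G w * ennreal (v powr m * F (v\<^sup>2 * (1 + w\<^sup>2))) * indicator {0<..} v \<partial>lborel) \<partial>lborel)"
    by (rule nn_integral_lborel_swap) measurable
  also have "\<dots> = (\<integral>\<^sup>+w. radial_moment F m * (G w * ennreal (kern (m + 1) w)) \<partial>lborel)"
  proof (intro nn_integral_cong)
    fix w :: real
    define q where "q = (1 + w\<^sup>2) powr (- 1 / 2)"
    have q: "q > 0" by (simp add: q_def)
    have "q\<^sup>2 = (1 + w\<^sup>2) powr (- 1)"
      by (simp add: q_def powr_powr flip: powr_numeral)
    then have "q\<^sup>2 * (1 + w\<^sup>2) = 1" by (simp add: powr_minus)
    then have q2: "(q * r)\<^sup>2 * (1 + w\<^sup>2) = r\<^sup>2" for r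
      by (simp only: power_mult_distrib mult_ac) simp
    have "- (m + 1) / 2 = (- 1 / 2) * (m + 1)" by (simp add: field_simps)
    then have "kern (m + 1) w = q powr (m + 1)"
      unfolding q_def kern_def powr_powr by (rule arg_cong)
    also have "\<dots> = q * q powr m" using powr_mult_base[of q m] q by (simp add: add.commute)
    finally have k: "kern (m + 1) w = q * q powr m" .
    have "(\<integral>\<^sup>+v. G w * ennreal (v powr m * F (v\<^sup>2 * (1 + w\<^sup>2))) * indicator {0<..} v \<partial>lborel)
      = G w * (\<integral>\<^sup>+v\<in>{0<..}. ennreal (v powr m * F (v\<^sup>2 * (1 + w\<^sup>2))) \<partial>lborel)"
      by (subst nn_integral_cmult[symmetric]) (auto simp: mult.assoc)
    also have "(\<integral>\<^sup>+v\<in>{0<..}. ennreal (v powr m * F (v\<^sup>2 * (1 + w\<^sup>2))) \<partial>lborel)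
      = ennreal q * (\<integral>\<^sup>+r\<in>{0<..}. ennreal ((q * r) powr m * F (r\<^sup>2)) \<partial>lborel)"
      using q by (subst nn_integral_Ioi_scale[of _ q]) (auto simp: q2)
    also have "(\<integral>\<^sup>+r\<in>{0<..}. ennreal ((q * r) powr m * F (r\<^sup>2)) \<partial>lborel)
        = (\<integral>\<^sup>+r. ennreal (q powr m) * (ennreal (r powr m * F (r\<^sup>2)) * indicator {0<..} r) \<partial>lborel)"
      using q by (intro nn_integral_cong) (auto simp: indicator_def powr_mult ennreal_mult'[symmetric] mult_ac)
    also have "\<dots> = ennreal (q powr m) * radial_moment F m"
      unfolding radial_moment_def by (rule nn_integral_cmult) measurable
    finally show "(\<integral>\<^sup>+v. G w * ennreal (v powr m * F (v\<^sup>2 * (1 + w\<^sup>2))) * indicator {0<..} v \<partial>lborel)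
        = radial_moment F m * (G w * ennreal (kern (m + 1) w))"
      using q by (simp add: k ennreal_mult' mult_ac)
  qed
  also have "\<dots> = radial_moment F m * (\<integral>\<^sup>+w. G w * ennreal (kern (m + 1) w) \<partial>lborel)"
    by (rule nn_integral_cmult) measurable
  finally show ?thesis .
qed

text \<open>The posterior integral over the scale parameter produces \<open>radial_moment\<close> after inversion.\<close>

lemma nn_integral_Ioi_inverse:
  fixes H :: "real \<Rightarrow> real"
  assumes H: "\<And>t. H t \<ge> 0" and [measurable]: "H \<in> borel_measurable borel"
    and fin: "(\<integral>\<^sup>+t\<in>{0<..}. ennreal (inverse (t\<^sup>2) * H (inverse t)) \<partial>lborel) \<noteq> \<infinity>"
  shows "(\<integral>\<^sup>+t\<in>{0<..}. ennreal (H t) \<partial>lborel) = (\<integral>\<^sup>+t\<in>{0<..}. ennreal (inverse (t\<^sup>2) * H (inverse t)) \<partial>lborel)"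
proof -
  define K where "K t = \<bar>- inverse (t\<^sup>2)\<bar> * H (inverse t)" for t
  have [measurable]: "K \<in> borel_measurable borel" unfolding K_def by measurable
  have K: "K t \<ge> 0" for t using H by (simp add: K_def)
  obtain b where b: "b \<ge> 0" "(\<integral>\<^sup>+t\<in>{0<..}. ennreal (K t) \<partial>lborel) = ennreal b"
    using fin by (cases "\<integral>\<^sup>+t\<in>{0<..}. ennreal (K t) \<partial>lborel") (auto simp: K_def)
  \<comment> \<open>The change of variables theorem speaks of absolute integrability, so a finite
    extended integral of a nonnegative function is translated into it and back. This is the purpose
    of the hypothesis \<open>fin\<close>.\<close>
  have nn: "(\<integral>\<^sup>+t\<in>{0<..}. ennreal (f t) \<partial>lborel) = ennreal r \<longleftrightarrow>
      f absolutely_integrable_on {0<..} \<and> integral {0<..} f = r"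
    if "r \<ge> 0" "\<And>t. f t \<ge> 0" "f \<in> borel_measurable borel" for f :: "real \<Rightarrow> real" and r
  proof -
    have e: "(\<integral>\<^sup>+t\<in>{0<..}. ennreal (f t) \<partial>lborel) = (\<integral>\<^sup>+t. ennreal (indicator {0<..} t * f t) \<partial>lborel)"
      by (intro nn_integral_cong) (auto simp: indicator_def)
    have ae: "f absolutely_integrable_on {0<..} \<longleftrightarrow> f integrable_on {0<..}"
      using that by (auto intro: nonnegative_absolutely_integrable_1 absolutely_integrable_on_def[THEN iffD1, THEN conjunct1]
          simp: absolutely_integrable_on_def)
    show ?thesis
    proof
      assume "(\<integral>\<^sup>+t\<in>{0<..}. ennreal (f t) \<partial>lborel) = ennreal r"
      then have "((\<lambda>t. indicator {0<..} t * f t) has_integral r) UNIV"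
        unfolding e using that by (intro nn_integral_has_integral) auto
      moreover have "(\<lambda>t. indicator {0<..} t * f t) = (\<lambda>t. if t \<in> {0<..} then f t else 0)"
        by (auto simp: fun_eq_iff indicator_def)
      ultimately have "(f has_integral r) {0<..}" by (simp only: has_integral_restrict_UNIV)
      then show "f absolutely_integrable_on {0<..} \<and> integral {0<..} f = r"
        unfolding ae by (auto simp: integral_unique)
    next
      assume "f absolutely_integrable_on {0<..} \<and> integral {0<..} f = r"
      then have "(f has_integral r) {0<..}" unfolding ae by (simp add: has_integral_iff)
      then show "(\<integral>\<^sup>+t\<in>{0<..}. ennreal (f t) \<partial>lborel) = ennreal r"
        unfolding e using that by (intro nn_integral_has_integral_lebesgue) auto
    qed
  qed
  have img: "inverse ` {0::real<..} = {0<..}"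
    by (auto intro!: image_eqI[of _ inverse "inverse _"])
  have "H absolutely_integrable_on (inverse ` {0<..}) \<and> integral (inverse ` {0<..}) H = b"
  proof (subst has_absolute_integral_change_of_variables_1'[symmetric])
    show "(inverse has_field_derivative - inverse (x\<^sup>2)) (at x within {0<..})" if "x \<in> {0<..}" for x :: real
      using that by (auto intro!: derivative_eq_intros simp: power2_eq_square)
    show "(\<lambda>x. \<bar>- inverse (x\<^sup>2)\<bar> * H (inverse x)) absolutely_integrable_on {0<..} \<and>
        integral {0<..} (\<lambda>x. \<bar>- inverse (x\<^sup>2)\<bar> * H (inverse x)) = b"
      using nn[of b K] b K by (simp add: K_def[abs_def])
  qed (auto simp: inj_on_def)
  then have "(\<integral>\<^sup>+t\<in>{0<..}. ennreal (H t) \<partial>lborel) = ennreal b"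
    unfolding img using nn[of b H] b H by simp
  also have "\<dots> = (\<integral>\<^sup>+t\<in>{0<..}. ennreal (inverse (t\<^sup>2) * H (inverse t)) \<partial>lborel)"
    using b by (simp add: K_def)
  finally show ?thesis .
qed

lemma measurable_likelihood [measurable]:
  assumes [measurable]: "F \<in> borel_measurable borel" "g \<in> borel_measurable M" "h \<in> borel_measurable M"
    "k \<in> borel_measurable M" "j \<in> borel_measurable M"
  shows "(\<lambda>x. likelihood n F (g x) (h x) (j x) (k x)) \<in> borel_measurable M"
  unfolding likelihood_def by measurable

text \<open>Multiplication by an extended factor is monotone even for 0 and infinity, so a strict
  inequality between products must come from one between the factors.\<close>

lemma unique_minimizer_cmult:
  assumes "unique_minimizer (\<lambda>b. c * F b) a"
  shows "unique_minimizer F a"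
  using assms unfolding unique_minimizer_def by (meson mult_left_mono not_le zero_le)

section \<open>Bayes criterion, risk and posterior loss as weighted losses\<close>

context asym_power_loss
begin

text \<open>The loss is homogeneous of degree p, so v^p comes out and a function of u / v remains;
  hence the order n + l + p of the moment.\<close>

lemma bayes_criterion_eq:
  assumes F[measurable]: "F \<in> borel_measurable borel" and F0: "\<And>t. F t \<ge> 0"
  shows "bayes_criterion n F c1 c2 p c0 l y g =
    radial_moment F (real n + l + p) * crit (real n + l + p + 1) {..y} (c0 + g)"
proof -
  define G where "G w = ennreal (\<rho> (w + (c0 + g))) * indicator {..y} w" for w
  have [measurable]: "G \<in> borel_measurable borel" unfolding G_def by measurable
  have "bayes_criterion n F c1 c2 p c0 l y g =
    (\<integral>\<^sup>+v\<in>{0<..}. (\<integral>\<^sup>+u. G (u / v) * ennreal (v powr (real n + l + p - 1) * F (u\<^sup>2 + v\<^sup>2)) \<partial>lborel) \<partial>lborel)"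
    unfolding bayes_criterion_def
  proof (intro nn_integral_cong)
    fix v :: real
    have "ennreal (\<rho> (u + c0 * v + g * v) * F (u\<^sup>2 + v\<^sup>2) * v powr (real n + l - 1)) * indicator {..v * y} u
      = G (u / v) * ennreal (v powr (real n + l + p - 1) * F (u\<^sup>2 + v\<^sup>2))" if v: "v > 0" for u
    proof -
      have "\<rho> (u + c0 * v + g * v) = v powr p * \<rho> (u / v + (c0 + g))"
        using loss_scale[OF v, of "u / v + (c0 + g)"] v by (simp add: algebra_simps)
      moreover have "v powr (real n + l + p - 1) = v powr (real n + l - 1) * v powr p"
        by (simp flip: powr_add add: algebra_simps)
      moreover have "u \<le> v * y \<longleftrightarrow> u / v \<le> y" using v by (simp add: field_simps)
      ultimately show ?thesis using F0
        by (simp add: G_def indicator_def ennreal_mult'[symmetric] mult_ac)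
    qed
    then show "(\<integral>\<^sup>+u\<in>{..v * y}. ennreal (\<rho> (u + c0 * v + g * v) * F (u\<^sup>2 + v\<^sup>2) * v powr (real n + l - 1)) \<partial>lborel)
        * indicator {0<..} v =
      (\<integral>\<^sup>+u. G (u / v) * ennreal (v powr (real n + l + p - 1) * F (u\<^sup>2 + v\<^sup>2)) \<partial>lborel) * indicator {0<..} v"
      by (cases "v > 0") (auto intro!: nn_integral_cong)
  qed
  also have "\<dots> = radial_moment F (real n + l + p) * (\<integral>\<^sup>+w. G w * ennreal (kern (real n + l + p + 1) w) \<partial>lborel)"
    using F0 by (subst nn_integral_polar) auto
  also have "(\<integral>\<^sup>+w. G w * ennreal (kern (real n + l + p + 1) w) \<partial>lborel) = crit (real n + l + p + 1) {..y} (c0 + g)"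
    unfolding crit_def G_def
    by (intro nn_integral_cong) (simp add: ennreal_mult' mult_ac)
  finally show ?thesis .
qed

text \<open>The substitution x = \<mu> + \<sigma> u, s = \<sigma> v, whose Jacobian \<sigma>^2
  cancels the powers of \<sigma> in the likelihood.\<close>

lemma risk_eq:
  assumes n: "n \<ge> 1" and F[measurable]: "F \<in> borel_measurable borel" and F0: "\<And>t. F t \<ge> 0"
    and \<sigma>: "\<sigma> > 0" and \<delta>[measurable]: "case_prod \<delta> \<in> borel_measurable (borel \<Otimes>\<^sub>M borel)"
  shows "risk n F c1 c2 p \<mu> \<sigma> \<delta> = (\<integral>\<^sup>+v\<in>{0<..}. (\<integral>\<^sup>+u.
     ennreal (\<rho> ((\<delta> (\<mu> + \<sigma> * u) (\<sigma> * v) - \<mu>) / \<sigma>)) * ennreal (v powr (real n - 1) * F (u\<^sup>2 + v\<^sup>2))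
     \<partial>lborel) \<partial>lborel)"
proof -
  have [measurable]: "(\<lambda>x. \<delta> (g x) (h x)) \<in> borel_measurable M"
    if "g \<in> borel_measurable M" "h \<in> borel_measurable M" for g h and M :: "'x measure"
    using measurable_compose[OF measurable_Pair[OF that] \<delta>] by simp
  have m: "(\<lambda>(x, s). indicator {0<..} s * ennreal (likelihood n F \<mu> \<sigma> x s)) \<in> borel_measurable lborel"
    unfolding lborel_prod[symmetric] by measurable
  have m2: "(\<lambda>(x, s). ennreal (\<rho> ((\<delta> x s - \<mu>) / \<sigma>))) \<in> borel_measurable lborel"
    unfolding lborel_prod[symmetric] by measurable
  define H where "H x s = indicator {0<..} s * (ennreal (likelihood n F \<mu> \<sigma> x s) * ennreal (\<rho> ((\<delta> x s - \<mu>) / \<sigma>)))" for x s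
  have [measurable]: "(\<lambda>x. H (g x) (h x)) \<in> borel_measurable M"
    if [measurable]: "g \<in> borel_measurable M" "h \<in> borel_measurable M" for g h and M :: "'x measure"
    unfolding H_def by measurable
  have "risk n F c1 c2 p \<mu> \<sigma> \<delta> = (\<integral>\<^sup>+(x, s). H x s \<partial>lborel)"
    unfolding risk_def model_def
    by (subst nn_integral_density[OF m m2]) (auto intro!: nn_integral_cong simp: H_def mult.assoc)
  also have "\<dots> = (\<integral>\<^sup>+s. \<integral>\<^sup>+x. H x s \<partial>lborel \<partial>lborel)"
    unfolding lborel_prod[symmetric]
    by (subst lborel_pair.nn_integral_snd[symmetric]) auto
  also have "\<dots> = ennreal \<sigma> * (\<integral>\<^sup>+v. \<integral>\<^sup>+x. H x (\<sigma> * v) \<partial>lborel \<partial>lborel)"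
    using \<sigma> by (subst nn_integral_real_affine[where c = \<sigma> and t = 0]) auto
  also have "\<dots> = ennreal \<sigma> * (\<integral>\<^sup>+v. ennreal \<sigma> * (\<integral>\<^sup>+u. H (\<mu> + \<sigma> * u) (\<sigma> * v) \<partial>lborel) \<partial>lborel)"
    using \<sigma> by (subst nn_integral_real_affine[where c = \<sigma> and t = \<mu>]) auto
  also have "\<dots> = (\<integral>\<^sup>+v. \<integral>\<^sup>+u. ennreal \<sigma> * (ennreal \<sigma> * H (\<mu> + \<sigma> * u) (\<sigma> * v)) \<partial>lborel \<partial>lborel)"
    by (simp add: nn_integral_cmult)
  also have "\<dots> = (\<integral>\<^sup>+v\<in>{0<..}. (\<integral>\<^sup>+u.
     ennreal (\<rho> ((\<delta> (\<mu> + \<sigma> * u) (\<sigma> * v) - \<mu>) / \<sigma>)) * ennreal (v powr (real n - 1) * F (u\<^sup>2 + v\<^sup>2))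
     \<partial>lborel) \<partial>lborel)"
  proof (intro nn_integral_cong)
    fix v :: real
    have "ennreal \<sigma> * (ennreal \<sigma> * H (\<mu> + \<sigma> * u) (\<sigma> * v)) =
        ennreal (\<rho> ((\<delta> (\<mu> + \<sigma> * u) (\<sigma> * v) - \<mu>) / \<sigma>)) * ennreal (v powr (real n - 1) * F (u\<^sup>2 + v\<^sup>2))"
      if v: "v > 0" for u
    proof -
      have "((\<mu> + \<sigma> * u - \<mu>)\<^sup>2 + (\<sigma> * v)\<^sup>2) / \<sigma>\<^sup>2 = u\<^sup>2 + v\<^sup>2"
        using \<sigma> by (simp add: power_mult_distrib field_simps)
      moreover have "v powr (real n - 1) = v ^ (n - 1)"
        using n v by (simp add: powr_realpow[symmetric] of_nat_diff)
      moreover have "\<sigma> * (\<sigma> * ((\<sigma> * v) ^ (n - 1) / \<sigma> ^ (n + 1))) = v ^ (n - 1)"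
        using \<sigma> n by (cases n) (auto simp: power_mult_distrib)
      ultimately have "\<sigma> * (\<sigma> * likelihood n F \<mu> \<sigma> (\<mu> + \<sigma> * u) (\<sigma> * v)) = v powr (real n - 1) * F (u\<^sup>2 + v\<^sup>2)"
        unfolding likelihood_def by (metis mult.assoc)
      then show ?thesis using \<sigma> v
        by (simp add: H_def ennreal_mult'[symmetric] mult.assoc[symmetric])
          (simp add: ennreal_mult' F0 mult_ac)
    qed
    then show "(\<integral>\<^sup>+u. ennreal \<sigma> * (ennreal \<sigma> * H (\<mu> + \<sigma> * u) (\<sigma> * v)) \<partial>lborel) = (\<integral>\<^sup>+u.
     ennreal (\<rho> ((\<delta> (\<mu> + \<sigma> * u) (\<sigma> * v) - \<mu>) / \<sigma>)) * ennreal (v powr (real n - 1) * F (u\<^sup>2 + v\<^sup>2))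
     \<partial>lborel) * indicator {0<..} v"
      using \<sigma> by (cases "v > 0") (auto simp: H_def zero_less_mult_iff)
  qed
  finally show ?thesis .
qed

text \<open>The kernel exponent is that of the Bayes criterion with l = 0. This singles out the
  prior with l = 0: \<open>c0\<close> is the whole-line limit of its half-line roots, which is why
  its Bayes function tends to 0.\<close>

lemma risk_equivariant_eq:
  assumes n: "n \<ge> 1" and F[measurable]: "F \<in> borel_measurable borel" and F0: "\<And>t. F t \<ge> 0"
    and \<sigma>: "\<sigma> > 0"
  shows "risk n F c1 c2 p \<mu> \<sigma> (equivariant_est c) = radial_moment F (real n + p) * crit (real n + p + 1) UNIV c"
proof -
  have m: "case_prod (equivariant_est c) \<in> borel_measurable (borel \<Otimes>\<^sub>M borel)"
    unfolding equivariant_est_def[abs_def] by measurable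
  have "risk n F c1 c2 p \<mu> \<sigma> (equivariant_est c) =
    (\<integral>\<^sup>+v\<in>{0<..}. (\<integral>\<^sup>+u. ennreal (\<rho> (u / v + c)) * ennreal (v powr (real n + p - 1) * F (u\<^sup>2 + v\<^sup>2)) \<partial>lborel) \<partial>lborel)"
    unfolding risk_eq[OF n F F0 \<sigma> m]
  proof (rule set_nn_integral_cong[OF refl refl], rule nn_integral_cong)
    fix v u :: real assume "v \<in> space lborel \<inter> {0<..}"
    then have v: "v > 0" by simp
    have "(equivariant_est c (\<mu> + \<sigma> * u) (\<sigma> * v) - \<mu>) / \<sigma> = v * (u / v + c)"
      using v \<sigma> by (simp add: equivariant_est_def field_simps)
    then have "\<rho> ((equivariant_est c (\<mu> + \<sigma> * u) (\<sigma> * v) - \<mu>) / \<sigma>) = v powr p * \<rho> (u / v + c)"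
      using loss_scale[OF v] by simp
    moreover have "v powr (real n + p - 1) = v powr (real n - 1) * v powr p"
      by (simp flip: powr_add add: algebra_simps)
    ultimately show "ennreal (\<rho> ((equivariant_est c (\<mu> + \<sigma> * u) (\<sigma> * v) - \<mu>) / \<sigma>)) * ennreal (v powr (real n - 1) * F (u\<^sup>2 + v\<^sup>2))
      = ennreal (\<rho> (u / v + c)) * ennreal (v powr (real n + p - 1) * F (u\<^sup>2 + v\<^sup>2))"
      using F0 by (simp add: ennreal_mult'[symmetric] mult_ac)
  qed
  also have "\<dots> = radial_moment F (real n + p) * (\<integral>\<^sup>+w. ennreal (\<rho> (w + c)) * ennreal (kern (real n + p + 1) w) \<partial>lborel)"
    using F0 by (intro nn_integral_polar[of F "\<lambda>w. ennreal (\<rho> (w + c))"]) auto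
  also have "\<dots> = radial_moment F (real n + p) * crit (real n + p + 1) UNIV c"
    by (simp add: crit_def ennreal_mult')
  finally show ?thesis .
qed

text \<open>With \<mu> = x - s w the constraint \<mu> \<ge> 0 becomes w \<le> x / s, and rescaling
  \<sigma> by q = sqrt ((x - \<mu>)^2 + s^2) separates the scale integral from w. That integral is
  left uninverted, since \<open>nn_integral_Ioi_inverse\<close> applies only once its finiteness is
  known.\<close>

lemma posterior_loss_eq:
  assumes n: "n \<ge> 1" and F[measurable]: "F \<in> borel_measurable borel" and F0: "\<And>t. F t \<ge> 0" and s: "s > 0"
  shows "posterior_loss n F c1 c2 p (prior l) x s d =
    ennreal (s powr (- l - 1)) *
    (\<integral>\<^sup>+\<sigma>\<in>{0<..}. ennreal (\<sigma> powr (- (real n + l + p + 2)) * F (1 / \<sigma>\<^sup>2)) \<partial>lborel) *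
    crit (real n + l + p + 1) {..x / s} ((d - x) / s)"
proof -
  define m where "m = real n + l + p"
  define B where "B = (\<integral>\<^sup>+\<sigma>\<in>{0<..}. ennreal (\<sigma> powr (- (m + 2)) * F (1 / \<sigma>\<^sup>2)) \<partial>lborel)"
  define a where "a = (d - x) / s"
  define H where "H \<mu> \<sigma> = ennreal (\<rho> ((d - \<mu>) / \<sigma>) * likelihood n F \<mu> \<sigma> x s * prior l \<mu> \<sigma>)" for \<mu> \<sigma>
  have [measurable]: "(\<lambda>x. H (g x) (h x)) \<in> borel_measurable M"
    if [measurable]: "g \<in> borel_measurable M" "h \<in> borel_measurable M" for g h and M :: "'x measure"
    unfolding H_def prior_def by measurable
  have "posterior_loss n F c1 c2 p (prior l) x s d = (\<integral>\<^sup>+(\<mu>, \<sigma>). H \<mu> \<sigma> \<partial>lborel)"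
    by (simp add: posterior_loss_def H_def)
  also have "\<dots> = (\<integral>\<^sup>+\<sigma>. \<integral>\<^sup>+\<mu>. H \<mu> \<sigma> \<partial>lborel \<partial>lborel)"
    unfolding lborel_prod[symmetric]
    by (subst lborel_pair.nn_integral_snd[symmetric]) auto
  also have "\<dots> = (\<integral>\<^sup>+\<sigma>. ennreal s * (\<integral>\<^sup>+w. H (x - s * w) \<sigma> \<partial>lborel) \<partial>lborel)"
    using s by (subst nn_integral_real_affine[where c = "- s" and t = x]) auto
  also have "\<dots> = (\<integral>\<^sup>+\<sigma>. \<integral>\<^sup>+w. ennreal s * H (x - s * w) \<sigma> \<partial>lborel \<partial>lborel)"
    by (simp add: nn_integral_cmult)
  also have "\<dots> = (\<integral>\<^sup>+w. \<integral>\<^sup>+\<sigma>. ennreal s * H (x - s * w) \<sigma> \<partial>lborel \<partial>lborel)"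
    by (rule nn_integral_lborel_swap) measurable
  also have "\<dots> = (\<integral>\<^sup>+w. (ennreal (s powr (- l - 1)) * B) * (ennreal (\<rho> (w + a) * kern (m + 1) w) * indicator {..x / s} w) \<partial>lborel)"
  proof (intro nn_integral_cong)
    fix w :: real
    define q where "q = s * (1 + w\<^sup>2) powr (1 / 2)"
    have q: "q > 0" using s by (simp add: q_def)
    have q2: "q\<^sup>2 = s\<^sup>2 * (1 + w\<^sup>2)"
      by (simp add: q_def power_mult_distrib powr_powr flip: powr_numeral)
    define I :: ennreal where "I = ennreal (\<rho> (w + a)) * indicator {..x / s} w"
    have H: "ennreal s * H (x - s * w) \<sigma> = ennreal (s powr (p + real n)) * I * (ennreal (\<sigma> powr (- (m + 2)) * F (q\<^sup>2 / \<sigma>\<^sup>2)) * indicator {0<..} \<sigma>)" for \<sigma>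
    proof (cases "\<sigma> > 0")
      case True
      have "(d - (x - s * w)) / \<sigma> = (s / \<sigma>) * (w + a)" using s True by (simp add: a_def field_simps)
      then have 1: "\<rho> ((d - (x - s * w)) / \<sigma>) = (s / \<sigma>) powr p * \<rho> (w + a)"
        using loss_scale[of "s / \<sigma>" "w + a"] s True by simp
      have 2: "likelihood n F (x - s * w) \<sigma> x s = s ^ (n - 1) / \<sigma> ^ (n + 1) * F (q\<^sup>2 / \<sigma>\<^sup>2)"
        by (simp add: likelihood_def q2 power_mult_distrib algebra_simps)
      have 3: "prior l (x - s * w) \<sigma> = \<sigma> powr (- (l + 1)) * indicator {..x / s} w"
        using True s by (auto simp: prior_def indicator_def field_simps)
      have 4: "s * ((s / \<sigma>) powr p * (s ^ (n - 1) / \<sigma> ^ (n + 1)) * \<sigma> powr (- (l + 1)))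
        = s powr (p + real n) * \<sigma> powr (- (m + 2))"
      proof -
        have "s * s ^ (n - 1) = s powr real n"
          using s n by (simp add: powr_realpow power_eq_if)
        moreover have "- (m + 2) = - p + - real (n + 1) + - (l + 1)" by (simp add: m_def)
        then have "\<sigma> powr (- (m + 2)) = \<sigma> powr (- p) * \<sigma> powr (- real (n + 1)) * \<sigma> powr (- (l + 1))"
          by (simp only: powr_add)
        moreover have "\<sigma> powr (- real (n + 1)) = inverse (\<sigma> ^ (n + 1))"
          using True by (simp add: powr_minus powr_realpow del: of_nat_add of_nat_Suc)
        moreover have "(s / \<sigma>) powr p = s powr p * \<sigma> powr (- p)"
          using s True by (simp add: powr_divide powr_minus field_simps)
        ultimately show ?thesis
          by (simp add: powr_add divide_inverse mult_ac)
      qed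
      have "s * (\<rho> ((d - (x - s * w)) / \<sigma>) * likelihood n F (x - s * w) \<sigma> x s * prior l (x - s * w) \<sigma>)
        = (s * ((s / \<sigma>) powr p * (s ^ (n - 1) / \<sigma> ^ (n + 1)) * \<sigma> powr (- (l + 1)))) * F (q\<^sup>2 / \<sigma>\<^sup>2) * \<rho> (w + a) * indicator {..x / s} w"
        unfolding 1 2 3 by (simp add: mult_ac)
      also have "\<dots> = s powr (p + real n) * (\<rho> (w + a) * indicator {..x / s} w) * (\<sigma> powr (- (m + 2)) * F (q\<^sup>2 / \<sigma>\<^sup>2))"
        unfolding 4 by (simp add: mult_ac)
      finally show ?thesis
        using True s F0 by (simp add: H_def I_def ennreal_mult'[symmetric] ennreal_indicator[symmetric]) 
    next
      case False
      then show ?thesis by (simp add: H_def prior_def)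
    qed
    have "(\<integral>\<^sup>+\<sigma>. ennreal s * H (x - s * w) \<sigma> \<partial>lborel) =
      ennreal (s powr (p + real n)) * I * (\<integral>\<^sup>+\<sigma>\<in>{0<..}. ennreal (\<sigma> powr (- (m + 2)) * F (q\<^sup>2 / \<sigma>\<^sup>2)) \<partial>lborel)"
      unfolding H by (rule nn_integral_cmult) measurable
    also have "(\<integral>\<^sup>+\<sigma>\<in>{0<..}. ennreal (\<sigma> powr (- (m + 2)) * F (q\<^sup>2 / \<sigma>\<^sup>2)) \<partial>lborel)
      = ennreal q * (\<integral>\<^sup>+\<sigma>\<in>{0<..}. ennreal ((q * \<sigma>) powr (- (m + 2)) * F (q\<^sup>2 / (q * \<sigma>)\<^sup>2)) \<partial>lborel)"
      using q by (intro nn_integral_Ioi_scale) auto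
    also have "(\<integral>\<^sup>+\<sigma>\<in>{0<..}. ennreal ((q * \<sigma>) powr (- (m + 2)) * F (q\<^sup>2 / (q * \<sigma>)\<^sup>2)) \<partial>lborel)
      = (\<integral>\<^sup>+\<sigma>. ennreal (q powr (- (m + 2))) * (ennreal (\<sigma> powr (- (m + 2)) * F (1 / \<sigma>\<^sup>2)) * indicator {0<..} \<sigma>) \<partial>lborel)"
      using q F0 by (intro nn_integral_cong)
        (auto simp: indicator_def powr_mult power_mult_distrib ennreal_mult'[symmetric] mult_ac)
    also have "\<dots> = ennreal (q powr (- (m + 2))) * B"
      unfolding B_def by (rule nn_integral_cmult) measurable
    also have "ennreal q * (ennreal (q powr (- (m + 2))) * B) = ennreal (q powr (- (m + 1))) * B"
    proof -
      have "q * q powr (- (m + 2)) = q powr (- (m + 1))"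
        using powr_mult_base[of q "- (m + 2)"] q by (simp add: algebra_simps)
      then show ?thesis using q by (simp add: mult.assoc[symmetric] ennreal_mult'[symmetric])
    qed
    also have "ennreal (s powr (p + real n)) * I * (ennreal (q powr (- (m + 1))) * B) =
      (ennreal (s powr (- l - 1)) * B) * (ennreal (\<rho> (w + a) * kern (m + 1) w) * indicator {..x / s} w)"
    proof -
      have "q powr (- (m + 1)) = s powr (- (m + 1)) * kern (m + 1) w"
        using s by (simp add: q_def powr_mult kern_def powr_powr)
      moreover have "(p + real n) + (- (m + 1)) = - l - 1" by (simp add: m_def)
      then have "s powr (p + real n) * s powr (- (m + 1)) = s powr (- l - 1)"
        by (metis powr_add)
      ultimately have "s powr (p + real n) * q powr (- (m + 1)) = s powr (- l - 1) * kern (m + 1) w"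
        by (metis mult.assoc)
      then have *: "ennreal (s powr (p + real n)) * ennreal (q powr (- (m + 1))) = ennreal (s powr (- l - 1)) * ennreal (kern (m + 1) w)"
        by (simp add: ennreal_mult'[symmetric])
      have "ennreal (s powr (p + real n)) * I * (ennreal (q powr (- (m + 1))) * B)
        = (ennreal (s powr (p + real n)) * ennreal (q powr (- (m + 1)))) * (I * B)"
        by (simp only: mult_ac)
      also have "\<dots> = (ennreal (s powr (- l - 1)) * B) * (ennreal (\<rho> (w + a)) * ennreal (kern (m + 1) w) * indicator {..x / s} w)"
        unfolding * I_def by (simp only: mult_ac)
      finally show ?thesis by (simp add: ennreal_mult')
    qed
    finally show "(\<integral>\<^sup>+\<sigma>. ennreal s * H (x - s * w) \<sigma> \<partial>lborel) =
      (ennreal (s powr (- l - 1)) * B) * (ennreal (\<rho> (w + a) * kern (m + 1) w) * indicator {..x / s} w)" .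
  qed
  also have "\<dots> = (ennreal (s powr (- l - 1)) * B) * crit (m + 1) {..x / s} a"
    unfolding crit_def by (rule nn_integral_cmult) measurable
  finally show ?thesis by (simp add: m_def B_def a_def)
qed

end

section \<open>Single crossing in the scale\<close>

text \<open>The crossing is the infimum of the points with positive value; \<open>b\<close> makes
  this set nonempty. The value at the infimum itself stays unspecified.\<close>

lemma single_crossing_point:
  fixes \<Psi> :: "real \<Rightarrow> real"
  assumes "\<And>z z'. m \<le> z \<Longrightarrow> z < z' \<Longrightarrow> \<Psi> z > 0 \<Longrightarrow> \<Psi> z' \<ge> 0" and "m \<le> b" "\<Psi> b > 0"
  obtains z1 where "m \<le> z1" "\<And>z. m \<le> z \<Longrightarrow> z < z1 \<Longrightarrow> \<Psi> z \<le> 0" "\<And>z. z1 < z \<Longrightarrow> \<Psi> z \<ge> 0"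
proof
  define S where "S = {z. m \<le> z \<and> \<Psi> z > 0}"
  have S: "b \<in> S" "bdd_below S" using assms by (auto simp: S_def)
  show "m \<le> Inf S" using S by (intro cInf_greatest) (auto simp: S_def)
  show "\<Psi> z \<le> 0" if "m \<le> z" "z < Inf S" for z
    using that cInf_lower[OF _ S(2), of z] by (force simp: S_def)
  show "\<Psi> z \<ge> 0" if "Inf S < z" for z
    using cInf_lessD[OF _ that] S assms(1) by (auto simp: S_def)
qed

lemma integral_nonpos_real:
  fixes f :: "'a \<Rightarrow> real"
  assumes "\<And>x. f x \<le> 0"
  shows "(\<integral>x. f x \<partial>M) \<le> 0"
  using Bochner_Integration.integral_nonneg[of M "\<lambda>x. - f x"] assms by simp

text \<open>Reflection at c / 2 pairs the points of {0<..<c}. A point from c on has its mirror image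
  outside the open half line and is estimated alone, which explains the case distinction in
  \<open>le\<close>; for c = 0 nothing is folded.\<close>

lemma integral_fold_nonpos:
  fixes \<psi> E :: "real \<Rightarrow> real"
  assumes int: "integrable lborel (\<lambda>z. indicator {0<..} z * (\<psi> z * E z))" and c: "c \<ge> 0"
    and E: "\<And>z. 0 < z \<Longrightarrow> z < c \<Longrightarrow> E (c - z) = E z"
    and le: "\<And>z. 0 < z \<Longrightarrow> c / 2 \<le> z \<Longrightarrow> (\<psi> z + (if z < c then \<psi> (c - z) else 0)) * E z \<le> 0"
  shows "(\<integral>z. indicator {0<..} z * (\<psi> z * E z) \<partial>lborel) \<le> 0"
proof -
  let ?f = "\<lambda>z. indicator {0<..<c} z * (\<psi> z * E z)"
  let ?g = "\<lambda>z. indicator {0<..} z * (indicator {c..} z * (\<psi> z * E z))"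
  have eq: "indicator {0<..} z * (\<psi> z * E z) = ?f z + ?g z" for z
    using c by (auto simp: indicator_def)
  have "integrable lborel (\<lambda>z. indicator {0<..<c} z * (indicator {0<..} z * (\<psi> z * E z)))"
    using integrable_mult_indicator[OF _ int, of "{0<..<c}"] by simp
  moreover have "(\<lambda>z. indicator {0<..<c} z * (indicator {0<..} z * (\<psi> z * E z))) = ?f"
    by (auto simp: fun_eq_iff indicator_def)
  ultimately have f: "integrable lborel ?f" by simp
  have "integrable lborel (\<lambda>z. indicator {c..} z * (indicator {0<..} z * (\<psi> z * E z)))"
    using integrable_mult_indicator[OF _ int, of "{c..}"] by simp
  then have g: "integrable lborel ?g" by (simp add: mult.left_commute)
  have "integrable lborel (\<lambda>z. ?f (c + (- 1) * z))"
    by (rule lborel_integrable_real_affine[OF f]) simp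
  then have f': "integrable lborel (\<lambda>z. ?f (c - z))" by simp
  have "2 * (\<integral>z. ?f z \<partial>lborel) = (\<integral>z. ?f z + ?f (c - z) \<partial>lborel)"
    using lborel_integral_real_affine[of "- 1" ?f c]
    by (subst Bochner_Integration.integral_add[OF f f']) simp
  also have "\<dots> \<le> 0"
  proof (intro integral_nonpos_real)
    fix z
    have "(\<psi> z + \<psi> (c - z)) * E z \<le> 0" if z: "0 < z" "z < c"
    proof (cases "c / 2 \<le> z")
      case True then show ?thesis using le[of z] z by simp
    next
      case False
      then show ?thesis using le[of "c - z"] z E[of z] by (simp add: add.commute)
    qed
    then show "?f z + ?f (c - z) \<le> 0"
      using E[of z] by (auto simp: indicator_def distrib_right)
  qed
  finally have "(\<integral>z. ?f z \<partial>lborel) \<le> 0" by simp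
  moreover have "(\<integral>z. ?g z \<partial>lborel) \<le> 0"
  proof (intro integral_nonpos_real)
    fix z show "?g z \<le> 0" using le[of z] c by (auto simp: indicator_def)
  qed
  ultimately show ?thesis unfolding eq using f g by simp
qed

text \<open>The derivative of ln f (\<beta> x) - ln f (\<alpha> x) is 1 / x times the increment of t
  f' t / f t from \<alpha> x to \<beta> x, hence nonpositive. The conclusion is the decrease of f
  (\<beta> x) / f (\<alpha> x), cleared of denominators.\<close>

lemma log_derivative_antimono_imp_mlr:
  fixes f :: "real \<Rightarrow> real"
  assumes f_pos: "\<And>t. t > 0 \<Longrightarrow> f t > 0"
    and f_diff: "\<And>t. t > 0 \<Longrightarrow> f differentiable (at t)"
    and f_ratio: "antimono_on {0<..} (\<lambda>t. t * deriv f t / f t)"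
    and \<alpha>: "0 < \<alpha>" "\<alpha> \<le> \<beta>" and A: "0 < A" "A \<le> B"
  shows "f (\<beta> * B) * f (\<alpha> * A) \<le> f (\<beta> * A) * f (\<alpha> * B)"
proof -
  define h where "h x = ln (f (\<beta> * x)) - ln (f (\<alpha> * x))" for x
  have "h B \<le> h A"
  proof (rule DERIV_nonpos_imp_nonincreasing[OF A(2)])
    fix x assume "A \<le> x"
    then have x: "x > 0" "\<alpha> * x > 0" "\<beta> * x > 0" using A \<alpha> by auto
    have D: "(f has_real_derivative deriv f t) (at t)" if "t > 0" for t
      using f_diff[OF that] by (metis DERIV_deriv_iff_real_differentiable)
    have "(h has_real_derivative deriv f (\<beta> * x) * \<beta> / f (\<beta> * x) - deriv f (\<alpha> * x) * \<alpha> / f (\<alpha> * x)) (at x)"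
      unfolding h_def
      by (rule derivative_eq_intros DERIV_chain2[where f = f, OF D] f_pos x | simp add: divide_inverse)+
    moreover have "deriv f (\<beta> * x) * \<beta> / f (\<beta> * x) - deriv f (\<alpha> * x) * \<alpha> / f (\<alpha> * x) \<le> 0"
    proof -
      have "\<beta> * x * deriv f (\<beta> * x) / f (\<beta> * x) \<le> \<alpha> * x * deriv f (\<alpha> * x) / f (\<alpha> * x)"
        using f_ratio x \<alpha> by (auto simp: monotone_on_def)
      then have "x * (deriv f (\<beta> * x) * \<beta> / f (\<beta> * x)) \<le> x * (deriv f (\<alpha> * x) * \<alpha> / f (\<alpha> * x))"
        by (simp only: mult_ac times_divide_eq_right)
      then show ?thesis using x by (simp only: mult_le_cancel_left_pos diff_le_0_iff_le)
    qed
    ultimately show "\<exists>y. (h has_real_derivative y) (at x) \<and> y \<le> 0" by blast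
  qed
  moreover have "0 < f (\<beta> * B)" "0 < f (\<beta> * A)" "0 < f (\<alpha> * B)" "0 < f (\<alpha> * A)"
    using \<alpha> A by (auto intro!: f_pos)
  ultimately have "ln (f (\<beta> * B) * f (\<alpha> * A)) \<le> ln (f (\<beta> * A) * f (\<alpha> * B))"
    by (simp add: h_def ln_mult)
  then show ?thesis
    using \<open>0 < f (\<beta> * B)\<close> \<open>0 < f (\<beta> * A)\<close> \<open>0 < f (\<alpha> * B)\<close> \<open>0 < f (\<alpha> * A)\<close> by simp
qed

context asym_power_loss
begin

lemma dloss_pos_eq: "t > 0 \<Longrightarrow> dloss t = c2 * p * t powr (p - 1)"
  and dloss_neg_eq: "t < 0 \<Longrightarrow> dloss t = - (c1 * p * (- t) powr (p - 1))"
  by (auto simp: dloss_def dpos_def dneg_def pos_powr_simps)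

text \<open>The positive term at z' has to keep dominating the negative one at c - z'. Moving from z
  to z' adds the same e to the arguments X and Y of the two power functions, so a ratio Y / X above
  1 decreases; the weights z^k and (c - z)^k move in the favourable direction as well.\<close>

lemma fold_single_crossing:
  assumes b: "b > 0" and k: "k \<ge> 0" and c: "c \<ge> 0" and z: "c / 2 \<le> z" "z < z'"
    and \<psi>: "\<And>z. \<psi> z = dloss (b * z - 1) * z powr k"
    and pos: "\<psi> z + (if z < c then \<psi> (c - z) else 0) > 0"
  shows "\<psi> z' + (if z' < c then \<psi> (c - z') else 0) \<ge> 0"
proof -
  have nonpos: "\<psi> x \<le> 0" if "b * x \<le> 1" for x
    using dloss_mono[of "b * x - 1" 0] that by (auto simp: \<psi> mult_le_0_iff)
  have nonneg: "\<psi> x \<ge> 0" if "b * x \<ge> 1" for x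
    using dloss_mono[of 0 "b * x - 1"] that by (auto simp: \<psi>)
  \<comment> \<open>Otherwise z, and with it c - z \<le> z, lies on the nonpositive side of the
    kink, and the sum could not be positive.\<close>
  have bz: "b * z > 1"
  proof (rule ccontr)
    assume "\<not> b * z > 1"
    moreover have "b * (c - z) \<le> b * z" using b z by (intro mult_left_mono) auto
    ultimately show False using pos nonpos[of z] nonpos[of "c - z"] by (auto split: if_splits)
  qed
  have bz': "b * z' > b * z" using b z by simp
  show ?thesis
  proof (cases "z' < c \<and> b * (c - z') < 1")
    case False
    then show ?thesis using nonneg[of z'] nonneg[of "c - z'"] bz bz' by auto
  next
    case True
    define q where "q = p - 1"
    have q: "q \<ge> 0" using p by (simp add: q_def)
    have eq_pos: "\<psi> x = p * (c2 * (b * x - 1) powr q * x powr k)" if "b * x > 1" for x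
      using that by (simp add: \<psi> q_def dloss_pos_eq)
    have eq_neg: "\<psi> x = - (p * (c1 * (1 - b * x) powr q * x powr k))" if "b * x < 1" for x
      using that by (simp add: \<psi> q_def dloss_neg_eq)
    define X Y e where "X = b * z - 1" and "Y = 1 - b * (c - z)" and "e = b * (z' - z)"
    have e: "e \<ge> 0" using b z by (simp add: e_def)
    have XY: "b * z' - 1 = X + e" "1 - b * (c - z') = Y + e" by (simp_all add: X_def Y_def e_def algebra_simps)
    have X: "X > 0" using bz by (simp add: X_def)
    have yz: "0 < c - z'" "c - z' \<le> c - z" "c - z' \<le> z'" "z \<le> z'" "0 < z" "0 < c - z" "c - z \<le> z"
      using True z c by auto
    have Y': "Y + e > 0" using True XY by auto
    have "c1 * (Y + e) powr q * (c - z') powr k \<le> c2 * (X + e) powr q * z' powr k"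
    \<comment> \<open>For Y \<le> X the claim holds outright, by c1 \<le> c2 and c - z' \<le> z'.
      For X < Y the point c - z was on the negative side already, and the inequality known at z is
      transported by (Y + e) / (X + e) \<le> Y / X.\<close>
    proof (cases "Y \<le> X")
      case True
      show ?thesis
        using c1 c12 q k yz Y' True by (intro mult_mono powr_mono2) auto
    next
      case False
      then have Y: "Y > X" "Y > 0" using X by auto
      have "c1 * Y powr q * (c - z) powr k < c2 * X powr q * z powr k"
      proof -
        have "b * (c - z) < 1" using Y by (simp add: Y_def)
        moreover have "z < c" using yz by simp
        ultimately have "p * (c1 * Y powr q * (c - z) powr k) < p * (c2 * X powr q * z powr k)"
          using pos eq_pos[OF bz] eq_neg[of "c - z"] unfolding X_def Y_def by simp
        then show ?thesis using p by simp
      qed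
      moreover have "(Y + e) powr q * X powr q \<le> (X + e) powr q * Y powr q"
      proof -
        have "(Y + e) * X \<le> (X + e) * Y" using mult_right_mono[of X Y e] e Y by (simp add: algebra_simps)
        then have "((Y + e) * X) powr q \<le> ((X + e) * Y) powr q"
          using q X Y e by (intro powr_mono2) auto
        then show ?thesis using X Y e by (simp add: powr_mult)
      qed
      ultimately have "(c1 * (Y + e) powr q * (c - z) powr k) * X powr q \<le> c2 * (X + e) powr q * z powr k * X powr q"
      proof -
        assume 1: "c1 * Y powr q * (c - z) powr k < c2 * X powr q * z powr k"
          and 2: "(Y + e) powr q * X powr q \<le> (X + e) powr q * Y powr q"
        have "(c1 * (Y + e) powr q * (c - z) powr k) * X powr q = (c1 * (c - z) powr k) * ((Y + e) powr q * X powr q)"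
          by (simp add: mult_ac)
        also have "\<dots> \<le> (c1 * (c - z) powr k) * ((X + e) powr q * Y powr q)"
          using 2 c1 by (intro mult_left_mono) auto
        also have "\<dots> = (X + e) powr q * (c1 * Y powr q * (c - z) powr k)" by (simp add: mult_ac)
        also have "\<dots> \<le> (X + e) powr q * (c2 * X powr q * z powr k)"
          using 1 by (intro mult_left_mono) auto
        finally show ?thesis by (simp add: mult_ac)
      qed
      then have "c1 * (Y + e) powr q * (c - z) powr k \<le> c2 * (X + e) powr q * z powr k"
        using X by simp
      moreover have "c1 * (Y + e) powr q * (c - z') powr k \<le> c1 * (Y + e) powr q * (c - z) powr k"
        using c1 k yz by (intro mult_left_mono powr_mono2) auto
      moreover have "c2 * (X + e) powr q * z powr k \<le> c2 * (X + e) powr q * z' powr k"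
        using c1 c12 k yz by (intro mult_left_mono powr_mono2) auto
      ultimately show ?thesis by linarith
    qed
    then have "p * (c1 * (Y + e) powr q * (c - z') powr k) \<le> p * (c2 * (X + e) powr q * z' powr k)"
      using p by (intro mult_left_mono) auto
    then show ?thesis
      using True bz bz' eq_pos[of z'] eq_neg[of "c - z'"] XY by simp
  qed
qed

text \<open>The sign change argument for a monotone likelihood ratio: with r the ratio at the
  crossing point, F (\<beta> A) - r F (\<alpha> A) has everywhere the sign opposite to that of the
  folded factor. Hence the integral at \<beta> is at most r times the integral at \<alpha>.\<close>

lemma crossing_in_scale:
  assumes F[measurable]: "F \<in> borel_measurable borel" and Fpos: "\<And>t. t > 0 \<Longrightarrow> F t > (0::real)"
    and mlr: "\<And>\<alpha> \<beta> A B. 0 < \<alpha> \<Longrightarrow> \<alpha> \<le> \<beta> \<Longrightarrow> 0 < A \<Longrightarrow> A \<le> B \<Longrightarrow> F (\<beta> * B) * F (\<alpha> * A) \<le> F (\<beta> * A) * F (\<alpha> * B)"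
    and b: "b > 0" and k: "k \<ge> 0" and \<alpha>: "0 < \<alpha>" "\<alpha> \<le> \<beta>"
    and A: "\<And>z. A z = (t * z - 1)\<^sup>2 + z\<^sup>2"
    and int: "integrable lborel (\<lambda>z. indicator {0<..} z * (dloss (b * z - 1) * z powr k * F (\<alpha> * A z)))"
      "integrable lborel (\<lambda>z. indicator {0<..} z * (dloss (b * z - 1) * z powr k * F (\<beta> * A z)))"
    and le: "(\<integral>z. indicator {0<..} z * (dloss (b * z - 1) * z powr k * F (\<alpha> * A z)) \<partial>lborel) \<le> 0"
  shows "(\<integral>z. indicator {0<..} z * (dloss (b * z - 1) * z powr k * F (\<beta> * A z)) \<partial>lborel) \<le> 0"
proof -
  define \<psi> where "\<psi> z = dloss (b * z - 1) * z powr k" for z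
  \<comment> \<open>Twice the minimizer t / (1 + t^2) of \<open>A\<close>, so that z and c - z have
    the same value of \<open>A\<close>. For t < 0 the minimizer lies left of the half line,
    \<open>A\<close> increases on it, and c = 0 switches the folding off.\<close>
  define c where "c = max 0 (2 * t / (1 + t\<^sup>2))"
  have c_cases: "c = (if t \<ge> 0 then 2 * t / (1 + t\<^sup>2) else 0)"
    using divide_nonpos_pos[of "2 * t" "1 + t\<^sup>2"] divide_nonneg_pos[of "2 * t" "1 + t\<^sup>2"]
    by (cases "t \<ge> 0") (simp_all add: c_def)
  have c: "c \<ge> 0" "(1 + t\<^sup>2) * c \<ge> 2 * t" and c_eq: "c > 0 \<Longrightarrow> (1 + t\<^sup>2) * c = 2 * t"
    by (auto simp: c_cases split: if_splits)
  have A_pos: "A z > 0" for z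
  proof (cases "z = 0")
    case False
    then show ?thesis by (simp add: A add_nonneg_pos)
  qed (simp add: A)
  have A_diff: "A z' - A z = (z' - z) * ((1 + t\<^sup>2) * (z + z') - 2 * t)" for z z'
    by (simp add: A power2_eq_square algebra_simps)
  have A_mono: "A z \<le> A z'" if "c / 2 \<le> z" "z \<le> z'" for z z'
  proof -
    have "2 * t \<le> (1 + t\<^sup>2) * c" by (rule c)
    also have "\<dots> \<le> (1 + t\<^sup>2) * (z + z')" using that by (intro mult_left_mono) auto
    finally have "0 \<le> A z' - A z" unfolding A_diff using that by (intro mult_nonneg_nonneg) auto
    then show ?thesis by simp
  qed
  have A_fold: "A (c - z) = A z" if "c > 0" for z
    using A_diff[of "c - z" z] c_eq[OF that] by simp
  define \<Psi> where "\<Psi> z = \<psi> z + (if z < c then \<psi> (c - z) else 0)" for z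
  obtain z1 where z1: "c / 2 \<le> z1" "\<And>z. c / 2 \<le> z \<Longrightarrow> z < z1 \<Longrightarrow> \<Psi> z \<le> 0" "\<And>z. z1 < z \<Longrightarrow> \<Psi> z \<ge> 0"
  \<comment> \<open>At the witness \<open>max c (2 / b)\<close> there is no mirror image left, and b
    z \<ge> 2 makes the remaining term positive.\<close>
  proof (rule single_crossing_point[of "c / 2" \<Psi> "max c (2 / b)"])
    show "\<Psi> z' \<ge> 0" if "c / 2 \<le> z" "z < z'" "\<Psi> z > 0" for z z'
      using fold_single_crossing[OF b k c(1) that(1,2) \<psi>_def] that(3) by (simp add: \<Psi>_def)
    have "b * max c (2 / b) \<ge> 2"
      using b by (auto simp: max_def field_simps)
    moreover have "max c (2 / b) > 0" using b by (simp add: less_max_iff_disj)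
    ultimately show "\<Psi> (max c (2 / b)) > 0"
      by (auto simp: \<Psi>_def \<psi>_def intro!: mult_pos_pos dloss_pos)
  qed (use c in auto)
  define r where "r = F (\<beta> * A z1) / F (\<alpha> * A z1)"
  have F\<alpha>: "F (\<alpha> * A z) > 0" and F\<beta>: "F (\<beta> * A z) > 0" for z
    using \<alpha> A_pos by (auto intro!: Fpos)
  have r: "r > 0" unfolding r_def using F\<alpha> F\<beta> by simp
  define E where "E z = F (\<beta> * A z) - r * F (\<alpha> * A z)" for z
  have E_nonneg: "E z \<ge> 0" if "A z \<le> A z1" for z
    using mlr[OF \<alpha> A_pos that] F\<alpha>[of z1] by (simp add: E_def r_def field_simps)
  have E_nonpos: "E z \<le> 0" if "A z1 \<le> A z" for z
    using mlr[OF \<alpha> A_pos that] F\<alpha>[of z1] by (simp add: E_def r_def field_simps)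
  have E0: "E z1 = 0" using E_nonneg[of z1] E_nonpos[of z1] by simp
  have split: "indicator {0<..} z * (\<psi> z * E z) = indicator {0<..} z * (\<psi> z * F (\<beta> * A z))
      - r * (indicator {0<..} z * (\<psi> z * F (\<alpha> * A z)))" for z
    by (simp add: E_def algebra_simps)
  note int' = int[folded \<psi>_def]
  have "(\<integral>z. indicator {0<..} z * (\<psi> z * E z) \<partial>lborel) \<le> 0"
  proof (rule integral_fold_nonpos[OF _ c(1)])
    show "integrable lborel (\<lambda>z. indicator {0<..} z * (\<psi> z * E z))"
      unfolding split using int' by (intro Bochner_Integration.integrable_diff integrable_mult_right) auto
    show "E (c - z) = E z" if "0 < z" "z < c" for z
      using A_fold[of z] that by (simp add: E_def)
    show "(\<psi> z + (if z < c then \<psi> (c - z) else 0)) * E z \<le> 0" if "0 < z" "c / 2 \<le> z" for z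
    proof -
      consider "z < z1" | "z = z1" | "z1 < z" by linarith
      then have "\<Psi> z * E z \<le> 0"
      proof cases
        case 1
        then show ?thesis using z1(2)[of z] E_nonneg[of z] A_mono[of z z1] that by (simp add: mult_le_0_iff)
      next
        case 3
        then show ?thesis using z1(3)[of z] E_nonpos[of z] A_mono[of z1 z] z1(1) by (simp add: mult_le_0_iff)
      qed (simp add: E0)
      then show ?thesis by (simp add: \<Psi>_def)
    qed
  qed
  also have "(\<integral>z. indicator {0<..} z * (\<psi> z * E z) \<partial>lborel) = (\<integral>z. indicator {0<..} z * (\<psi> z * F (\<beta> * A z)) \<partial>lborel)
      - r * (\<integral>z. indicator {0<..} z * (\<psi> z * F (\<alpha> * A z)) \<partial>lborel)"
    unfolding split using int' by (subst Bochner_Integration.integral_diff) auto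
  finally have "(\<integral>z. indicator {0<..} z * (\<psi> z * F (\<beta> * A z)) \<partial>lborel)
      \<le> r * (\<integral>z. indicator {0<..} z * (\<psi> z * F (\<alpha> * A z)) \<partial>lborel)" by simp
  also have "\<dots> \<le> 0" using r le by (simp add: mult_le_0_iff \<psi>_def)
  finally show ?thesis by (simp add: \<psi>_def)
qed

end

text \<open>With \<open>\<eta> = v t - u\<close> and \<open>v = \<eta> z\<close> the wedge \<open>u \<le> v t - \<nu>\<close> is swept by the lines
  \<open>\<eta> = const\<close>, \<open>\<eta> \<ge> \<nu>\<close>; the total over all \<open>\<eta> > 0\<close> is a first-order condition.\<close>

definition wedge_integral ::
  "real \<Rightarrow> (real \<Rightarrow> real) \<Rightarrow> (real \<Rightarrow> real) \<Rightarrow> real \<Rightarrow> real \<Rightarrow> real \<Rightarrow> ennreal" where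
  "wedge_integral k F \<phi> a t \<nu> =
    (\<integral>\<^sup>+v\<in>{0<..}. (\<integral>\<^sup>+u\<in>{..v * t - \<nu>}. ennreal (\<phi> (u + a * v) * (v powr k * F (u\<^sup>2 + v\<^sup>2))) \<partial>lborel) \<partial>lborel)"

definition line_integral ::
  "real \<Rightarrow> (real \<Rightarrow> real) \<Rightarrow> (real \<Rightarrow> real) \<Rightarrow> real \<Rightarrow> real \<Rightarrow> real \<Rightarrow> ennreal" where
  "line_integral k F \<phi> a t \<eta> =
    (\<integral>\<^sup>+z\<in>{0<..}. ennreal (\<phi> ((t + a) * z - 1) * z powr k * F (\<eta>\<^sup>2 * ((t * z - 1)\<^sup>2 + z\<^sup>2))) \<partial>lborel)"

text \<open>The weight collects \<eta>^k from v^k, \<eta>^q from the homogeneity of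
  \<open>\<phi>\<close>, and one more \<eta> from dv = \<eta> dz. The line \<eta> = 0 is discarded
  as a null set.\<close>

lemma wedge_integral_eq_lines:
  assumes F[measurable]: "F \<in> borel_measurable borel" and \<phi>[measurable]: "\<phi> \<in> borel_measurable borel"
    and F0: "\<And>t. F t \<ge> 0" and \<phi>0: "\<And>t. \<phi> t \<ge> 0"
    and scale: "\<And>v t. v > 0 \<Longrightarrow> \<phi> (v * t) = v powr q * \<phi> t" and \<nu>: "\<nu> \<ge> 0"
  shows "wedge_integral k F \<phi> a t \<nu> =
    (\<integral>\<^sup>+\<eta>\<in>{\<nu>..}. ennreal (\<eta> powr (k + q + 1)) * line_integral k F \<phi> a t \<eta> \<partial>lborel)"
proof -
  define h where "h v \<eta> = ennreal (\<phi> (v * t - \<eta> + a * v) * (v powr k * F ((v * t - \<eta>)\<^sup>2 + v\<^sup>2)))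
     * indicator {\<nu>..} \<eta> * indicator {0<..} v" for v \<eta>
  have "wedge_integral k F \<phi> a t \<nu> = (\<integral>\<^sup>+v. \<integral>\<^sup>+\<eta>. h v \<eta> \<partial>lborel \<partial>lborel)"
    unfolding wedge_integral_def
  proof (rule nn_integral_cong)
    fix v :: real
    have "(\<integral>\<^sup>+u\<in>{..v * t - \<nu>}. ennreal (\<phi> (u + a * v) * (v powr k * F (u\<^sup>2 + v\<^sup>2))) \<partial>lborel)
      = (\<integral>\<^sup>+\<eta>. ennreal (\<phi> (v * t - \<eta> + a * v) * (v powr k * F ((v * t - \<eta>)\<^sup>2 + v\<^sup>2))) * indicator {\<nu>..} \<eta> \<partial>lborel)"
      by (subst nn_integral_real_affine[where c = "- 1" and t = "v * t"])
        (auto simp: indicator_def intro!: nn_integral_cong)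
    then show "(\<integral>\<^sup>+u\<in>{..v * t - \<nu>}. ennreal (\<phi> (u + a * v) * (v powr k * F (u\<^sup>2 + v\<^sup>2))) \<partial>lborel) * indicator {0<..} v
        = (\<integral>\<^sup>+\<eta>. h v \<eta> \<partial>lborel)"
      by (simp add: h_def nn_integral_multc)
  qed
  also have "\<dots> = (\<integral>\<^sup>+\<eta>. \<integral>\<^sup>+v. h v \<eta> \<partial>lborel \<partial>lborel)"
    unfolding h_def by (rule nn_integral_lborel_swap[symmetric]) measurable
  also have "\<dots> = (\<integral>\<^sup>+\<eta>\<in>{\<nu>..}. ennreal (\<eta> powr (k + q + 1)) * line_integral k F \<phi> a t \<eta> \<partial>lborel)"
    using AE_lborel_singleton[of "0::real"]
  proof (intro nn_integral_cong_AE, eventually_elim)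
    fix \<eta> :: real assume "\<eta> \<noteq> 0"
    show "(\<integral>\<^sup>+v. h v \<eta> \<partial>lborel) = ennreal (\<eta> powr (k + q + 1)) * line_integral k F \<phi> a t \<eta> * indicator {\<nu>..} \<eta>"
    proof (cases "\<eta> \<ge> \<nu>")
      case True
      then have \<eta>: "\<eta> > 0" using \<nu> \<open>\<eta> \<noteq> 0\<close> by auto
      define H where "H v = ennreal (\<phi> (v * t - \<eta> + a * v) * (v powr k * F ((v * t - \<eta>)\<^sup>2 + v\<^sup>2)))" for v
      have "(\<integral>\<^sup>+v. h v \<eta> \<partial>lborel) = (\<integral>\<^sup>+v\<in>{0<..}. H v \<partial>lborel)"
        using True by (simp add: h_def H_def)
      also have "\<dots> = ennreal \<eta> * (\<integral>\<^sup>+z\<in>{0<..}. H (\<eta> * z) \<partial>lborel)"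
        using \<eta> unfolding H_def by (intro nn_integral_Ioi_scale) auto
      also have "\<dots> = (\<integral>\<^sup>+z. ennreal \<eta> * (H (\<eta> * z) * indicator {0<..} z) \<partial>lborel)"
        unfolding H_def by (rule nn_integral_cmult[symmetric]) measurable
      also have "\<dots> = (\<integral>\<^sup>+z. ennreal (\<eta> powr (k + q + 1)) * (ennreal (\<phi> ((t + a) * z - 1) * z powr k *
          F (\<eta>\<^sup>2 * ((t * z - 1)\<^sup>2 + z\<^sup>2))) * indicator {0<..} z) \<partial>lborel)"
      proof (intro nn_integral_cong)
        fix z :: real
        show "ennreal \<eta> * (H (\<eta> * z) * indicator {0<..} z) = ennreal (\<eta> powr (k + q + 1)) *
          (ennreal (\<phi> ((t + a) * z - 1) * z powr k * F (\<eta>\<^sup>2 * ((t * z - 1)\<^sup>2 + z\<^sup>2))) * indicator {0<..} z)"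
        proof (cases "z > 0")
          case z: True
          have "\<eta> * z * t - \<eta> + a * (\<eta> * z) = \<eta> * ((t + a) * z - 1)" by (simp add: algebra_simps)
          then have 1: "\<phi> (\<eta> * z * t - \<eta> + a * (\<eta> * z)) = \<eta> powr q * \<phi> ((t + a) * z - 1)"
            using scale[OF \<eta>] by simp
          have 2: "(\<eta> * z * t - \<eta>)\<^sup>2 + (\<eta> * z)\<^sup>2 = \<eta>\<^sup>2 * ((t * z - 1)\<^sup>2 + z\<^sup>2)"
            by (simp add: power2_eq_square algebra_simps)
          have 3: "\<eta> powr (k + q + 1) = \<eta> * (\<eta> powr k * \<eta> powr q)"
            using \<eta> by (simp add: powr_add)
          have "\<eta> * (\<phi> (\<eta> * z * t - \<eta> + a * (\<eta> * z)) * ((\<eta> * z) powr k * F ((\<eta> * z * t - \<eta>)\<^sup>2 + (\<eta> * z)\<^sup>2)))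
            = \<eta> powr (k + q + 1) * (\<phi> ((t + a) * z - 1) * z powr k * F (\<eta>\<^sup>2 * ((t * z - 1)\<^sup>2 + z\<^sup>2)))"
            unfolding 1 2 3 using \<eta> z by (simp add: powr_mult mult_ac)
          then show ?thesis using z \<eta> F0 \<phi>0 by (simp add: H_def ennreal_mult'[symmetric])
        qed simp
      qed
      also have "\<dots> = ennreal (\<eta> powr (k + q + 1)) * line_integral k F \<phi> a t \<eta>"
        unfolding line_integral_def by (rule nn_integral_cmult) measurable
      finally show ?thesis using True by simp
    qed (simp add: h_def)
  qed
  finally show ?thesis .
qed

lemma nn_integral_le_iff_integral_diff_le:
  fixes f g :: "'a \<Rightarrow> real"
  assumes "integrable M f" "integrable M g" "\<And>x. f x \<ge> 0" "\<And>x. g x \<ge> 0"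
  shows "(\<integral>\<^sup>+x. ennreal (f x) \<partial>M) \<le> (\<integral>\<^sup>+x. ennreal (g x) \<partial>M) \<longleftrightarrow> (\<integral>x. f x - g x \<partial>M) \<le> 0"
  using assms by (simp add: nn_integral_eq_integral integral_nonneg_AE)

section \<open>The two parts of the derivative on a wedge\<close>

context asym_power_loss
begin

text \<open>For \<nu> = 0 the wedge is the cone u / v \<le> t with apex at the origin, so polar
  coordinates apply and the parts of the first-order condition appear with a common radial
  factor.\<close>

lemma wedge_integral_0:
  assumes F[measurable]: "F \<in> borel_measurable borel" and \<phi>[measurable]: "\<phi> \<in> borel_measurable borel"
    and F0: "\<And>t. F t \<ge> 0" and \<phi>0: "\<And>t. \<phi> t \<ge> 0"
    and scale: "\<And>v t. v > 0 \<Longrightarrow> \<phi> (v * t) = v powr q * \<phi> t"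
  shows "wedge_integral k F \<phi> a t 0 = radial_moment F (k + q + 1) *
    (\<integral>\<^sup>+w. ennreal (indicator {..t} w * (\<phi> (w + a) * kern (k + q + 2) w)) \<partial>lborel)"
proof -
  define G where "G w = ennreal (indicator {..t} w * \<phi> (w + a))" for w
  have [measurable]: "G \<in> borel_measurable borel" unfolding G_def by measurable
  have "wedge_integral k F \<phi> a t 0 =
    (\<integral>\<^sup>+v\<in>{0<..}. (\<integral>\<^sup>+u. G (u / v) * ennreal (v powr (k + q + 1 - 1) * F (u\<^sup>2 + v\<^sup>2)) \<partial>lborel) \<partial>lborel)"
    unfolding wedge_integral_def
  proof (rule set_nn_integral_cong[OF refl refl], rule nn_integral_cong)
    fix v u :: real assume "v \<in> space lborel \<inter> {0<..}"
    then have v: "v > 0" by simp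
    have "\<phi> (u + a * v) = v powr q * \<phi> (u / v + a)"
      using scale[OF v, of "u / v + a"] v by (simp add: algebra_simps)
    moreover have "u \<le> v * t \<longleftrightarrow> u / v \<le> t" using v by (simp add: field_simps)
    ultimately show "ennreal (\<phi> (u + a * v) * (v powr k * F (u\<^sup>2 + v\<^sup>2))) * indicator {..v * t - 0} u
      = G (u / v) * ennreal (v powr (k + q + 1 - 1) * F (u\<^sup>2 + v\<^sup>2))"
      using \<phi>0 by (simp add: G_def indicator_def powr_add ennreal_mult'[symmetric] mult_ac)
  qed
  also have "\<dots> = radial_moment F (k + q + 1) * (\<integral>\<^sup>+w. G w * ennreal (kern (k + q + 1 + 1) w) \<partial>lborel)"
    using F0 by (intro nn_integral_polar) auto
  also have "(\<integral>\<^sup>+w. G w * ennreal (kern (k + q + 1 + 1) w) \<partial>lborel) =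
      (\<integral>\<^sup>+w. ennreal (indicator {..t} w * (\<phi> (w + a) * kern (k + q + 1 + 1) w)) \<partial>lborel)"
    using \<phi>0 by (intro nn_integral_cong) (simp add: G_def ennreal_mult'[symmetric] mult.assoc)
  also have "k + q + 1 + 1 = k + q + 2" by simp
  finally show ?thesis .
qed

text \<open>\<open>crossing_in_scale\<close> in terms of extended integrals; finiteness of the line
  integrals lets the two parts be recombined into \<open>dloss\<close>.\<close>

lemma line_integral_crossing:
  assumes F[measurable]: "F \<in> borel_measurable borel" and F0: "\<And>t. F t \<ge> 0" and Fpos: "\<And>t. t > 0 \<Longrightarrow> F t > 0"
    and mlr: "\<And>\<alpha> \<beta> A B. 0 < \<alpha> \<Longrightarrow> \<alpha> \<le> \<beta> \<Longrightarrow> 0 < A \<Longrightarrow> A \<le> B \<Longrightarrow> F (\<beta> * B) * F (\<alpha> * A) \<le> F (\<beta> * A) * F (\<alpha> * B)"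
    and b: "t + a > 0" and k: "k \<ge> 0" and \<alpha>: "0 < \<alpha>" "\<alpha> \<le> \<beta>"
    and fin: "line_integral k F dpos a t \<alpha> < \<infinity>" "line_integral k F dneg a t \<alpha> < \<infinity>"
      "line_integral k F dpos a t \<beta> < \<infinity>" "line_integral k F dneg a t \<beta> < \<infinity>"
    and le: "line_integral k F dpos a t \<alpha> \<le> line_integral k F dneg a t \<alpha>"
  shows "line_integral k F dpos a t \<beta> \<le> line_integral k F dneg a t \<beta>"
proof -
  define g where "g \<phi> \<eta> z = indicator {0<..} z * (\<phi> ((t + a) * z - 1) * z powr k * F (\<eta>\<^sup>2 * ((t * z - 1)\<^sup>2 + z\<^sup>2)))"
    for \<phi> \<eta> and z :: real
  have eq: "line_integral k F \<phi> a t \<eta> = (\<integral>\<^sup>+z. ennreal (g \<phi> \<eta> z) \<partial>lborel)" for \<phi> \<eta>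
    unfolding line_integral_def g_def by (intro nn_integral_cong) (auto simp: indicator_def)
  have g0: "g dpos \<eta> z \<ge> 0" "g dneg \<eta> z \<ge> 0" for \<eta> z using F0 by (auto simp: g_def)
  have [measurable]: "g dpos \<eta> \<in> borel_measurable borel" "g dneg \<eta> \<in> borel_measurable borel" for \<eta>
    unfolding g_def by measurable
  have int: "integrable lborel (g dpos \<alpha>)" "integrable lborel (g dneg \<alpha>)"
      "integrable lborel (g dpos \<beta>)" "integrable lborel (g dneg \<beta>)"
    using fin unfolding eq by (auto intro!: integrableI_nonneg simp: g0)
  have diff: "g dpos \<eta> z - g dneg \<eta> z = indicator {0<..} z *
      (dloss ((t + a) * z - 1) * z powr k * F (\<eta>\<^sup>2 * ((t * z - 1)\<^sup>2 + z\<^sup>2)))" for \<eta> z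
    by (simp add: g_def dloss_def algebra_simps)
  have "(\<integral>z. g dpos \<alpha> z - g dneg \<alpha> z \<partial>lborel) \<le> 0"
    using le int unfolding eq by (subst (asm) nn_integral_le_iff_integral_diff_le) (auto simp: g0)
  then have "(\<integral>z. g dpos \<beta> z - g dneg \<beta> z \<partial>lborel) \<le> 0"
    unfolding diff
    using Bochner_Integration.integrable_diff[OF int(1,2)] Bochner_Integration.integrable_diff[OF int(3,4)] \<alpha>
    by (intro crossing_in_scale[OF F Fpos mlr b k, of "\<alpha>\<^sup>2" "\<beta>\<^sup>2" "\<lambda>z. (t * z - 1)\<^sup>2 + z\<^sup>2" t])
      (auto simp: diff intro!: power_mono)
  then show ?thesis
    unfolding eq using int by (subst nn_integral_le_iff_integral_diff_le) (auto simp: g0)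
qed

lemma wedge_integral_le:
  assumes F[measurable]: "F \<in> borel_measurable borel" and F0: "\<And>t. F t \<ge> 0" and Fpos: "\<And>t. t > 0 \<Longrightarrow> F t > 0"
    and mlr: "\<And>\<alpha> \<beta> A B. 0 < \<alpha> \<Longrightarrow> \<alpha> \<le> \<beta> \<Longrightarrow> 0 < A \<Longrightarrow> A \<le> B \<Longrightarrow> F (\<beta> * B) * F (\<alpha> * A) \<le> F (\<beta> * A) * F (\<alpha> * B)"
    and k: "k \<ge> 1" and M: "radial_moment F (k + p) < \<infinity>" and root: "foc (k + p + 1) {..t} a = 0"
    and \<nu>: "\<nu> \<ge> 0"
  shows "wedge_integral k F dpos a t \<nu> \<le> wedge_integral k F dneg a t \<nu>"
proof -
  have \<kappa>: "k + p + 1 \<ge> p + 2" using k by simp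
  note b = foc_root_gt[OF \<kappa> root]
  define h where "h \<phi> \<eta> = ennreal (\<eta> powr (k + (p - 1) + 1)) * line_integral k F \<phi> a t \<eta>" for \<phi> \<eta>
  have [measurable]: "h dpos \<in> borel_measurable borel" "h dneg \<in> borel_measurable borel"
    unfolding h_def line_integral_def by measurable
  have lines: "wedge_integral k F dpos a t \<nu> = (\<integral>\<^sup>+\<eta>\<in>{\<nu>..}. h dpos \<eta> \<partial>lborel)"
    "wedge_integral k F dneg a t \<nu> = (\<integral>\<^sup>+\<eta>\<in>{\<nu>..}. h dneg \<eta> \<partial>lborel)" if "\<nu> \<ge> 0" for \<nu>
    unfolding h_def
    by (rule wedge_integral_eq_lines[OF F measurable_loss(2) F0 dpos_nonneg dpos_scale that]
        wedge_integral_eq_lines[OF F measurable_loss(3) F0 dneg_nonneg dneg_scale that]; assumption)+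
  have int: "integrable lborel (\<lambda>w. indicator {..t} w * (dpos (w + a) * kern (k + p + 1) w))"
     "integrable lborel (\<lambda>w. indicator {..t} w * (dneg (w + a) * kern (k + p + 1) w))"
    using \<kappa> by (auto intro!: integrable_dpos_kern integrable_dneg_kern)
  have "(\<integral>w. indicator {..t} w * (dpos (w + a) * kern (k + p + 1) w) \<partial>lborel) -
    (\<integral>w. indicator {..t} w * (dneg (w + a) * kern (k + p + 1) w) \<partial>lborel) = foc (k + p + 1) {..t} a"
    unfolding foc_def dloss_def using int
    by (subst Bochner_Integration.integral_diff[symmetric]) (auto simp: left_diff_distrib right_diff_distrib)
  then have "(\<integral>w. indicator {..t} w * (dpos (w + a) * kern (k + p + 1) w) \<partial>lborel) =
    (\<integral>w. indicator {..t} w * (dneg (w + a) * kern (k + p + 1) w) \<partial>lborel)"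
    using root by simp
  then have eq: "(\<integral>\<^sup>+w. ennreal (indicator {..t} w * (dpos (w + a) * kern (k + p + 1) w)) \<partial>lborel) =
    (\<integral>\<^sup>+w. ennreal (indicator {..t} w * (dneg (w + a) * kern (k + p + 1) w)) \<partial>lborel)"
    using int by (simp add: nn_integral_eq_integral)
  have less: "(\<integral>\<^sup>+w. ennreal (indicator {..t} w * (dneg (w + a) * kern (k + p + 1) w)) \<partial>lborel) < \<infinity>"
    using int by (simp add: nn_integral_eq_integral)
  have e: "k + (p - 1) + 1 = k + p" "k + (p - 1) + 2 = k + p + 1" by auto
  have w0: "wedge_integral k F dpos a t 0 = radial_moment F (k + p) *
      (\<integral>\<^sup>+w. ennreal (indicator {..t} w * (dpos (w + a) * kern (k + p + 1) w)) \<partial>lborel)"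
    by (rule wedge_integral_0[OF F measurable_loss(2) F0 dpos_nonneg dpos_scale, of k a t, unfolded e])
  have w0': "wedge_integral k F dneg a t 0 = radial_moment F (k + p) *
      (\<integral>\<^sup>+w. ennreal (indicator {..t} w * (dneg (w + a) * kern (k + p + 1) w)) \<partial>lborel)"
    by (rule wedge_integral_0[OF F measurable_loss(3) F0 dneg_nonneg dneg_scale, of k a t, unfolded e])
  have total: "wedge_integral k F dpos a t 0 = wedge_integral k F dneg a t 0"
    unfolding w0 w0' eq ..
  have fin: "wedge_integral k F dneg a t 0 < \<infinity>"
    unfolding w0' using M less by (simp add: ennreal_mult_less_top)
  have AEfin: "AE \<eta> in lborel. \<eta> \<ge> 0 \<longrightarrow> h \<phi> \<eta> \<noteq> \<infinity>" if "\<phi> = dpos \<or> \<phi> = dneg" for \<phi>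
  proof -
    have "AE \<eta> in lborel. h \<phi> \<eta> * indicator {0..} \<eta> \<noteq> \<infinity>"
      using that fin total lines[of 0] by (intro nn_integral_PInf_AE) auto
    then show ?thesis by eventually_elim (auto simp: indicator_def)
  qed
  \<comment> \<open>Lines with an infinite contribution cannot be compared by subtraction; the
    finite total excludes them almost everywhere.\<close>
  define good where "good \<eta> \<longleftrightarrow> \<eta> > 0 \<and> h dpos \<eta> < \<infinity> \<and> h dneg \<eta> < \<infinity>" for \<eta>
  have good: "AE \<eta> in lborel. \<eta> \<ge> 0 \<longrightarrow> good \<eta>"
    using AEfin[of dpos, simplified] AEfin[of dneg, simplified] AE_lborel_singleton[of "0::real"]
    by eventually_elim (auto simp: good_def less_top)
  have cross: "h dpos \<beta> \<le> h dneg \<beta>"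
    if "good \<alpha>" "good \<beta>" "\<alpha> \<le> \<beta>" "h dpos \<alpha> \<le> h dneg \<alpha>" for \<alpha> \<beta>
  proof -
    have lt: "line_integral k F dpos a t \<eta> < \<infinity>" "line_integral k F dneg a t \<eta> < \<infinity>" if "good \<eta>" for \<eta>
    proof -
      have "ennreal (\<eta> powr (k + (p - 1) + 1)) \<noteq> 0" using that by (simp add: good_def)
      then show "line_integral k F dpos a t \<eta> < \<infinity>" "line_integral k F dneg a t \<eta> < \<infinity>"
        using that by (auto simp only: good_def h_def ennreal_mult_less_top infinity_ennreal_def ennreal_zero_less_top)
    qed
    have le: "line_integral k F dpos a t \<alpha> \<le> line_integral k F dneg a t \<alpha>"
    proof (rule ccontr)
      assume "\<not> line_integral k F dpos a t \<alpha> \<le> line_integral k F dneg a t \<alpha>"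
      then have "h dneg \<alpha> < h dpos \<alpha>"
        unfolding h_def using \<open>good \<alpha>\<close> by (intro ennreal_mult_strict_left_mono) (auto simp: good_def)
      then show False using that(4) by simp
    qed
    have "line_integral k F dpos a t \<beta> \<le> line_integral k F dneg a t \<beta>"
    proof (rule line_integral_crossing[of F t a k \<alpha> \<beta>])
      show "0 < t + a" "0 \<le> k" using b k by auto
      show "0 < \<alpha>" "\<alpha> \<le> \<beta>" using that by (auto simp: good_def)
    qed (fact F F0 le | rule lt, fact that | rule Fpos mlr, assumption+)+
    then show ?thesis by (auto simp: h_def intro!: mult_left_mono)
  qed
  show ?thesis
  \<comment> \<open>Either some line below \<nu> is already nonpositive, and then so is every later
    one; or all good lines below \<nu> are positive, and the balance of the totals makes the rest
    nonpositive. The second case cancels the head, which is finite.\<close>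
  proof (cases "\<exists>\<alpha>. good \<alpha> \<and> \<alpha> < \<nu> \<and> h dpos \<alpha> \<le> h dneg \<alpha>")
    case True
    then obtain \<alpha> where \<alpha>: "good \<alpha>" "\<alpha> < \<nu>" "h dpos \<alpha> \<le> h dneg \<alpha>" by blast
    have "(\<integral>\<^sup>+\<eta>\<in>{\<nu>..}. h dpos \<eta> \<partial>lborel) \<le> (\<integral>\<^sup>+\<eta>\<in>{\<nu>..}. h dneg \<eta> \<partial>lborel)"
      using good
    proof (intro nn_integral_mono_AE, eventually_elim)
      fix \<eta> assume "0 \<le> \<eta> \<longrightarrow> good \<eta>"
      then show "h dpos \<eta> * indicator {\<nu>..} \<eta> \<le> h dneg \<eta> * indicator {\<nu>..} \<eta>"
        using cross[OF \<alpha>(1) _ _ \<alpha>(3), of \<eta>] \<alpha>(2) \<nu> by (auto simp: indicator_def)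
    qed
    then show ?thesis using lines \<nu> by simp
  next
    case False
    have split: "(\<integral>\<^sup>+\<eta>\<in>{0..}. H \<eta> \<partial>lborel) = (\<integral>\<^sup>+\<eta>\<in>{0..<\<nu>}. H \<eta> \<partial>lborel) + (\<integral>\<^sup>+\<eta>\<in>{\<nu>..}. H \<eta> \<partial>lborel)"
      if [measurable]: "H \<in> borel_measurable borel" for H
      using \<nu> by (subst nn_integral_add[symmetric]) (auto intro!: nn_integral_cong simp: indicator_def)
    have "(\<integral>\<^sup>+\<eta>\<in>{0..<\<nu>}. h dneg \<eta> \<partial>lborel) \<le> (\<integral>\<^sup>+\<eta>\<in>{0..<\<nu>}. h dpos \<eta> \<partial>lborel)"
      using good
    proof (intro nn_integral_mono_AE, eventually_elim)
      fix \<eta> assume "0 \<le> \<eta> \<longrightarrow> good \<eta>"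
      then show "h dneg \<eta> * indicator {0..<\<nu>} \<eta> \<le> h dpos \<eta> * indicator {0..<\<nu>} \<eta>"
        using False by (auto simp: indicator_def)
    qed
    then have "(\<integral>\<^sup>+\<eta>\<in>{0..<\<nu>}. h dneg \<eta> \<partial>lborel) + (\<integral>\<^sup>+\<eta>\<in>{\<nu>..}. h dpos \<eta> \<partial>lborel)
      \<le> (\<integral>\<^sup>+\<eta>\<in>{0..}. h dpos \<eta> \<partial>lborel)"
      by (subst split) (auto intro: add_mono)
    also have "\<dots> = (\<integral>\<^sup>+\<eta>\<in>{0..}. h dneg \<eta> \<partial>lborel)"
      using total lines[of 0] by simp
    also have "\<dots> = (\<integral>\<^sup>+\<eta>\<in>{0..<\<nu>}. h dneg \<eta> \<partial>lborel) + (\<integral>\<^sup>+\<eta>\<in>{\<nu>..}. h dneg \<eta> \<partial>lborel)"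
      by (rule split) measurable
    finally have *: "(\<integral>\<^sup>+\<eta>\<in>{0..<\<nu>}. h dneg \<eta> \<partial>lborel) + (\<integral>\<^sup>+\<eta>\<in>{\<nu>..}. h dpos \<eta> \<partial>lborel)
      \<le> (\<integral>\<^sup>+\<eta>\<in>{0..<\<nu>}. h dneg \<eta> \<partial>lborel) + (\<integral>\<^sup>+\<eta>\<in>{\<nu>..}. h dneg \<eta> \<partial>lborel)" .
    have "(\<integral>\<^sup>+\<eta>\<in>{0..<\<nu>}. h dneg \<eta> \<partial>lborel) \<le> (\<integral>\<^sup>+\<eta>\<in>{0..}. h dneg \<eta> \<partial>lborel)"
      by (intro nn_integral_mono) (auto simp: indicator_def)
    also have "\<dots> < \<infinity>" using fin lines[of 0] by simp
    finally show ?thesis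
      using * lines \<nu> by (auto simp: ennreal_add_left_cancel_le)
  qed
qed

lemma wedge_integral_mono:
  assumes "\<And>s. F s \<ge> 0" "a \<le> a'"
  shows "wedge_integral k F dpos a t \<nu> \<le> wedge_integral k F dpos a' t \<nu>"
    and "wedge_integral k F dneg a' t \<nu> \<le> wedge_integral k F dneg a t \<nu>"
proof -
  have *: "a * v \<le> a' * v" if "v > 0" for v using assms that by (intro mult_right_mono) auto
  show "wedge_integral k F dpos a t \<nu> \<le> wedge_integral k F dpos a' t \<nu>"
    unfolding wedge_integral_def
  proof (intro nn_integral_mono)
    fix v :: real
    show "(\<integral>\<^sup>+u\<in>{..v * t - \<nu>}. ennreal (dpos (u + a * v) * (v powr k * F (u\<^sup>2 + v\<^sup>2))) \<partial>lborel) * indicator {0<..} v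
      \<le> (\<integral>\<^sup>+u\<in>{..v * t - \<nu>}. ennreal (dpos (u + a' * v) * (v powr k * F (u\<^sup>2 + v\<^sup>2))) \<partial>lborel) * indicator {0<..} v"
      using assms * by (cases "v > 0") (auto intro!: nn_integral_mono mult_right_mono ennreal_leI dpos_mono)
  qed
  show "wedge_integral k F dneg a' t \<nu> \<le> wedge_integral k F dneg a t \<nu>"
    unfolding wedge_integral_def
  proof (intro nn_integral_mono)
    fix v :: real
    show "(\<integral>\<^sup>+u\<in>{..v * t - \<nu>}. ennreal (dneg (u + a' * v) * (v powr k * F (u\<^sup>2 + v\<^sup>2))) \<partial>lborel) * indicator {0<..} v
      \<le> (\<integral>\<^sup>+u\<in>{..v * t - \<nu>}. ennreal (dneg (u + a * v) * (v powr k * F (u\<^sup>2 + v\<^sup>2))) \<partial>lborel) * indicator {0<..} v"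
      using assms * by (cases "v > 0") (auto intro!: nn_integral_mono mult_right_mono ennreal_leI dneg_antimono)
  qed
qed

end

section \<open>Risk comparison\<close>

text \<open>Continuity makes the superlevel set closed, so it contains its supremum; the bound from
  above comes from the limit 0 < h.\<close>

lemma superlevel_set_antimono:
  fixes g :: "real \<Rightarrow> real"
  assumes g: "antimono g" "\<And>x. isCont g x" "(g \<longlongrightarrow> 0) at_top" and h: "h > 0" "h \<le> g t0"
  obtains \<tau> where "\<And>t. h \<le> g t \<longleftrightarrow> t \<le> \<tau>"
proof -
  define S where "S = {t. h \<le> g t}"
  have "closed S"
    unfolding S_def using g(2) by (intro closed_Collect_le continuous_at_imp_continuous_on) auto
  moreover have "bdd_above S"
  proof -
    obtain B where "g B < h"
      using order_tendstoD(2)[OF g(3) h(1)] by (auto simp: eventually_at_top_linorder)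
    have "t \<le> B" if "t \<in> S" for t
    proof (rule ccontr)
      assume "\<not> t \<le> B"
      then have "g t \<le> g B" by (intro antimonoD[OF g(1)]) simp
      then show False using that \<open>g B < h\<close> by (simp add: S_def)
    qed
    then show ?thesis by (intro bdd_aboveI[of _ B])
  qed
  moreover have "S \<noteq> {}" using h by (auto simp: S_def)
  ultimately have "Sup S \<in> S" by (intro closed_contains_Sup)
  have "h \<le> g t \<longleftrightarrow> t \<le> Sup S" for t
  proof
    assume "h \<le> g t"
    then show "t \<le> Sup S" by (intro cSup_upper \<open>bdd_above S\<close>) (simp add: S_def)
  next
    assume "t \<le> Sup S"
    then have "g (Sup S) \<le> g t" by (rule antimonoD[OF g(1)])
    then show "h \<le> g t" using \<open>Sup S \<in> S\<close> by (simp add: S_def)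
  qed
  then show ?thesis by (rule that)
qed

context asym_power_loss
begin

text \<open>The increment of the loss is integrated along the shift, with the negative half moved to
  the other side because extended values cannot be subtracted. The second claim bounds the moved
  term, so that it can be cancelled after integration.\<close>

lemma loss_layer:
  assumes v: "v > 0" and y: "y \<ge> 0"
  shows "ennreal (\<rho> (q + y * v)) + (\<integral>\<^sup>+h\<in>{0..y}. ennreal (v * dneg (q + h * v)) \<partial>lborel) =
      ennreal (\<rho> q) + (\<integral>\<^sup>+h\<in>{0..y}. ennreal (v * dpos (q + h * v)) \<partial>lborel)"
    and "(\<integral>\<^sup>+h\<in>{0..y}. ennreal (v * dneg (q + h * v)) \<partial>lborel) \<le> ennreal (\<rho> q)"
proof -
  have p0: "p > 0" using p by simp
  define P N where "P = pos_powr p (q + y * v) - pos_powr p q" and "N = pos_powr p (- q) - pos_powr p (- (q + y * v))"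
  have P: "P \<ge> 0" and N: "N \<ge> 0"
    using p v y by (auto simp: P_def N_def intro!: pos_powr_mono)
  have "(\<integral>\<^sup>+h\<in>{0..y}. ennreal (v * dpos (q + h * v)) \<partial>lborel) =
    (\<integral>\<^sup>+h. ennreal c2 * (ennreal (v * (p * pos_powr (p - 1) (q + h * v))) * indicator {0..y} h) \<partial>lborel)"
    using c1 c12 p v by (intro nn_integral_cong)
      (simp add: dpos_def indicator_def ennreal_mult'[symmetric] mult_ac)
  also have "\<dots> = ennreal c2 * ennreal P"
    unfolding P_def nn_integral_pos_powr(1)[OF p0 v y, symmetric] by (rule nn_integral_cmult) measurable
  finally have dp: "(\<integral>\<^sup>+h\<in>{0..y}. ennreal (v * dpos (q + h * v)) \<partial>lborel) = ennreal (c2 * P)"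
    using c1 c12 P by (simp add: ennreal_mult')
  have "(\<integral>\<^sup>+h\<in>{0..y}. ennreal (v * dneg (q + h * v)) \<partial>lborel) =
    (\<integral>\<^sup>+h. ennreal c1 * (ennreal (v * (p * pos_powr (p - 1) (- (q + h * v)))) * indicator {0..y} h) \<partial>lborel)"
    using c1 c12 p v by (intro nn_integral_cong)
      (simp add: dneg_def indicator_def ennreal_mult'[symmetric] mult_ac)
  also have "\<dots> = ennreal c1 * ennreal N"
    unfolding N_def nn_integral_pos_powr(2)[OF p0 v y, symmetric] by (rule nn_integral_cmult) measurable
  finally have dn: "(\<integral>\<^sup>+h\<in>{0..y}. ennreal (v * dneg (q + h * v)) \<partial>lborel) = ennreal (c1 * N)"
    using c1 N by (simp add: ennreal_mult')
  have "\<rho> (q + y * v) + c1 * N = \<rho> q + c2 * P"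
    by (simp add: loss_eq P_def N_def algebra_simps)
  then show "ennreal (\<rho> (q + y * v)) + (\<integral>\<^sup>+h\<in>{0..y}. ennreal (v * dneg (q + h * v)) \<partial>lborel) =
      ennreal (\<rho> q) + (\<integral>\<^sup>+h\<in>{0..y}. ennreal (v * dpos (q + h * v)) \<partial>lborel)"
    unfolding dp dn using c1 c12 P N by (simp flip: ennreal_plus)
  have "c1 * N \<le> c1 * pos_powr p (- q)" using c1 by (simp add: N_def)
  also have "\<dots> \<le> \<rho> q" using c1 c12 by (simp add: loss_eq)
  finally show "(\<integral>\<^sup>+h\<in>{0..y}. ennreal (v * dneg (q + h * v)) \<partial>lborel) \<le> ennreal (\<rho> q)"
    unfolding dn by (rule ennreal_leI)
qed

lemma layer_integral_swap:
  assumes [measurable]: "F \<in> borel_measurable borel" "g \<in> borel_measurable borel" "\<phi> \<in> borel_measurable borel"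
  shows "(\<integral>\<^sup>+v\<in>{0<..}. (\<integral>\<^sup>+u. (\<integral>\<^sup>+h\<in>{0..g ((u + \<nu>) / v)}. ennreal (v * \<phi> (u + c0 * v + h * v)) \<partial>lborel)
       * ennreal (v powr (k - 1) * F (u\<^sup>2 + v\<^sup>2)) \<partial>lborel) \<partial>lborel) =
    (\<integral>\<^sup>+h. (\<integral>\<^sup>+v\<in>{0<..}. (\<integral>\<^sup>+u. ennreal (v * \<phi> (u + c0 * v + h * v)) * (if 0 \<le> h \<and> h \<le> g ((u + \<nu>) / v) then 1 else 0)
       * ennreal (v powr (k - 1) * F (u\<^sup>2 + v\<^sup>2)) \<partial>lborel) \<partial>lborel) \<partial>lborel)"
proof -
  define B :: "real \<Rightarrow> real \<Rightarrow> real \<Rightarrow> ennreal" where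
    "B h v u = ennreal (v * \<phi> (u + c0 * v + h * v)) * (if 0 \<le> h \<and> h \<le> g ((u + \<nu>) / v) then 1 else 0)
       * ennreal (v powr (k - 1) * F (u\<^sup>2 + v\<^sup>2))" for h v u
  have [measurable]: "(\<lambda>x. B (f1 x) (f2 x) (f3 x)) \<in> borel_measurable M"
    if [measurable]: "f1 \<in> borel_measurable M" "f2 \<in> borel_measurable M" "f3 \<in> borel_measurable M"
    for f1 f2 f3 and M :: "'x measure"
    unfolding B_def by measurable
  have "(\<integral>\<^sup>+u. (\<integral>\<^sup>+h\<in>{0..g ((u + \<nu>) / v)}. ennreal (v * \<phi> (u + c0 * v + h * v)) \<partial>lborel)
       * ennreal (v powr (k - 1) * F (u\<^sup>2 + v\<^sup>2)) \<partial>lborel) = (\<integral>\<^sup>+u. \<integral>\<^sup>+h. B h v u \<partial>lborel \<partial>lborel)" for v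
    by (subst nn_integral_multc[symmetric]) (auto simp: B_def indicator_def intro!: nn_integral_cong)
  also have "(\<integral>\<^sup>+u. \<integral>\<^sup>+h. B h v u \<partial>lborel \<partial>lborel) = (\<integral>\<^sup>+h. \<integral>\<^sup>+u. B h v u \<partial>lborel \<partial>lborel)" for v
    by (rule nn_integral_lborel_swap) measurable
  finally have "(\<integral>\<^sup>+v\<in>{0<..}. (\<integral>\<^sup>+u. (\<integral>\<^sup>+h\<in>{0..g ((u + \<nu>) / v)}. ennreal (v * \<phi> (u + c0 * v + h * v)) \<partial>lborel)
       * ennreal (v powr (k - 1) * F (u\<^sup>2 + v\<^sup>2)) \<partial>lborel) \<partial>lborel) =
    (\<integral>\<^sup>+v. (\<integral>\<^sup>+h. (\<integral>\<^sup>+u. B h v u \<partial>lborel) \<partial>lborel) * indicator {0<..} v \<partial>lborel)"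
    by simp
  also have "\<dots> = (\<integral>\<^sup>+v. (\<integral>\<^sup>+h. (\<integral>\<^sup>+u. B h v u \<partial>lborel) * indicator {0<..} v \<partial>lborel) \<partial>lborel)"
    by (subst nn_integral_multc) auto
  also have "\<dots> = (\<integral>\<^sup>+h. (\<integral>\<^sup>+v. (\<integral>\<^sup>+u. B h v u \<partial>lborel) * indicator {0<..} v \<partial>lborel) \<partial>lborel)"
    by (rule nn_integral_lborel_swap) measurable
  finally show ?thesis by (simp add: B_def)
qed

lemma risk_est_le:
  assumes n: "n \<ge> 1" and F[measurable]: "F \<in> borel_measurable borel" and F0: "\<And>t. F t \<ge> 0"
    and Fpos: "\<And>t. t > 0 \<Longrightarrow> F t > 0"
    and mlr: "\<And>\<alpha> \<beta> A B. 0 < \<alpha> \<Longrightarrow> \<alpha> \<le> \<beta> \<Longrightarrow> 0 < A \<Longrightarrow> A \<le> B \<Longrightarrow> F (\<beta> * B) * F (\<alpha> * A) \<le> F (\<beta> * A) * F (\<alpha> * B)"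
    and M: "radial_moment F (real n + p) < \<infinity>" and root: "\<And>t. foc (real n + p + 1) {..t} (c0 + g0 t) = 0"
    and gC: "g \<in> class_C" and le: "\<And>t. g t \<le> g0 t" and \<mu>: "\<mu> \<ge> 0" and \<sigma>: "\<sigma> > 0"
  shows "risk n F c1 c2 p \<mu> \<sigma> (est c0 g) \<le> risk n F c1 c2 p \<mu> \<sigma> (equivariant_est c0)"
proof -
  define \<nu> where "\<nu> = \<mu> / \<sigma>"
  have \<nu>: "\<nu> \<ge> 0" using \<mu> \<sigma> by (simp add: \<nu>_def)
  have anti: "antimono g" and lim: "(g \<longlongrightarrow> 0) at_top" and cont: "\<And>x. isCont g x"
    using gC abs_cont_imp_isCont[of g] by (auto simp: class_C_def)
  have [measurable]: "g \<in> borel_measurable borel"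
    using cont by (intro borel_measurable_continuous_onI continuous_at_imp_continuous_on) auto
  have g0: "g t \<ge> 0" for t
    using anti by (intro tendsto_upperbound[OF lim]) (auto simp: eventually_at_top_linorder antimono_def)
  define W where "W u v = ennreal (v powr (real n - 1) * F (u\<^sup>2 + v\<^sup>2))" for u v :: real
  define L where "L \<phi> = (\<integral>\<^sup>+v\<in>{0<..}. (\<integral>\<^sup>+u. (\<integral>\<^sup>+h\<in>{0..g ((u + \<nu>) / v)}. ennreal (v * \<phi> (u + c0 * v + h * v)) \<partial>lborel)
       * W u v \<partial>lborel) \<partial>lborel)" for \<phi> :: "real \<Rightarrow> real"
  have [measurable]: "(\<lambda>x. W (f1 x) (f2 x)) \<in> borel_measurable M'"
    if [measurable]: "f1 \<in> borel_measurable M'" "f2 \<in> borel_measurable M'" for f1 f2 and M' :: "'x measure"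
    unfolding W_def by measurable
  have [measurable]: "(\<lambda>x. \<integral>\<^sup>+h\<in>{0..g ((f1 x + \<nu>) / f2 x)}. ennreal (f2 x * \<phi> (f1 x + c0 * f2 x + h * f2 x)) \<partial>lborel) \<in> borel_measurable M'"
    if [measurable]: "f1 \<in> borel_measurable M'" "f2 \<in> borel_measurable M'" "\<phi> \<in> borel_measurable borel" for f1 f2 \<phi> and M' :: "'x measure"
    unfolding indicator_def atLeastAtMost_iff by measurable
  have R: "risk n F c1 c2 p \<mu> \<sigma> (est c0 g) =
      (\<integral>\<^sup>+v\<in>{0<..}. (\<integral>\<^sup>+u. ennreal (\<rho> ((u + c0 * v) + g ((u + \<nu>) / v) * v)) * W u v \<partial>lborel) \<partial>lborel)"
  proof (subst risk_eq[OF n F F0 \<sigma>])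
    show "(\<lambda>(x, s). est c0 g x s) \<in> borel_measurable (borel \<Otimes>\<^sub>M borel)"
      unfolding est_def equivariant_est_def by measurable
    show "(\<integral>\<^sup>+v\<in>{0<..}. (\<integral>\<^sup>+u.
     ennreal (\<rho> ((est c0 g (\<mu> + \<sigma> * u) (\<sigma> * v) - \<mu>) / \<sigma>)) * ennreal (v powr (real n - 1) * F (u\<^sup>2 + v\<^sup>2))
     \<partial>lborel) \<partial>lborel) =
      (\<integral>\<^sup>+v\<in>{0<..}. (\<integral>\<^sup>+u. ennreal (\<rho> ((u + c0 * v) + g ((u + \<nu>) / v) * v)) * W u v \<partial>lborel) \<partial>lborel)"
    proof (rule set_nn_integral_cong[OF refl refl], rule nn_integral_cong)
      fix v u :: real assume "v \<in> space lborel \<inter> {0<..}"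
      then have v: "v > 0" by simp
      have "(\<mu> + \<sigma> * u) / (\<sigma> * v) = (u + \<nu>) / v"
        using \<sigma> v by (simp add: \<nu>_def field_simps)
      then have "(est c0 g (\<mu> + \<sigma> * u) (\<sigma> * v) - \<mu>) / \<sigma> = (u + c0 * v) + g ((u + \<nu>) / v) * v"
        using \<sigma> by (simp add: est_def equivariant_est_def field_simps)
      then show "ennreal (\<rho> ((est c0 g (\<mu> + \<sigma> * u) (\<sigma> * v) - \<mu>) / \<sigma>)) * ennreal (v powr (real n - 1) * F (u\<^sup>2 + v\<^sup>2))
         = ennreal (\<rho> ((u + c0 * v) + g ((u + \<nu>) / v) * v)) * W u v"
        by (simp add: W_def)
    qed
  qed
  have R0: "risk n F c1 c2 p \<mu> \<sigma> (equivariant_est c0) =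
      (\<integral>\<^sup>+v\<in>{0<..}. (\<integral>\<^sup>+u. ennreal (\<rho> (u + c0 * v)) * W u v \<partial>lborel) \<partial>lborel)"
  proof (subst risk_eq[OF n F F0 \<sigma>])
    show "(\<lambda>(x, s). equivariant_est c0 x s) \<in> borel_measurable (borel \<Otimes>\<^sub>M borel)"
      unfolding equivariant_est_def by measurable
    show "(\<integral>\<^sup>+v\<in>{0<..}. (\<integral>\<^sup>+u.
     ennreal (\<rho> ((equivariant_est c0 (\<mu> + \<sigma> * u) (\<sigma> * v) - \<mu>) / \<sigma>)) * ennreal (v powr (real n - 1) * F (u\<^sup>2 + v\<^sup>2))
     \<partial>lborel) \<partial>lborel) =
      (\<integral>\<^sup>+v\<in>{0<..}. (\<integral>\<^sup>+u. ennreal (\<rho> (u + c0 * v)) * W u v \<partial>lborel) \<partial>lborel)"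
    proof (rule set_nn_integral_cong[OF refl refl], rule nn_integral_cong)
      fix v u :: real
      have "(equivariant_est c0 (\<mu> + \<sigma> * u) (\<sigma> * v) - \<mu>) / \<sigma> = u + c0 * v"
        using \<sigma> by (simp add: equivariant_est_def field_simps)
      then show "ennreal (\<rho> ((equivariant_est c0 (\<mu> + \<sigma> * u) (\<sigma> * v) - \<mu>) / \<sigma>)) * ennreal (v powr (real n - 1) * F (u\<^sup>2 + v\<^sup>2))
         = ennreal (\<rho> (u + c0 * v)) * W u v"
        by (simp add: W_def)
    qed
  qed
  have \<kappa>: "real n + p + 1 \<ge> p + 2" using n by simp
  have R0_fin: "risk n F c1 c2 p \<mu> \<sigma> (equivariant_est c0) < \<infinity>"
    using M \<kappa> by (simp add: risk_equivariant_eq[OF n F F0 \<sigma>] crit_eq_real ennreal_mult_less_top)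
  have N_le: "L dneg \<le> risk n F c1 c2 p \<mu> \<sigma> (equivariant_est c0)"
    unfolding R0 L_def
  proof (intro nn_integral_mono)
    fix v :: real
    show "(\<integral>\<^sup>+u. (\<integral>\<^sup>+h\<in>{0..g ((u + \<nu>) / v)}. ennreal (v * dneg (u + c0 * v + h * v)) \<partial>lborel) * W u v \<partial>lborel) * indicator {0<..} v
      \<le> (\<integral>\<^sup>+u. ennreal (\<rho> (u + c0 * v)) * W u v \<partial>lborel) * indicator {0<..} v"
      using loss_layer(2)[OF _ g0] by (cases "v > 0") (auto intro!: nn_integral_mono mult_right_mono)
  qed
  have sum: "(\<integral>\<^sup>+v\<in>{0<..}. (\<integral>\<^sup>+u. X u v * W u v \<partial>lborel) \<partial>lborel) + (\<integral>\<^sup>+v\<in>{0<..}. (\<integral>\<^sup>+u. Y u v * W u v \<partial>lborel) \<partial>lborel) =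
     (\<integral>\<^sup>+v\<in>{0<..}. (\<integral>\<^sup>+u. (X u v + Y u v) * W u v \<partial>lborel) \<partial>lborel)"
    if [measurable]: "case_prod X \<in> borel_measurable (borel \<Otimes>\<^sub>M borel)" "case_prod Y \<in> borel_measurable (borel \<Otimes>\<^sub>M borel)"
    for X Y :: "real \<Rightarrow> real \<Rightarrow> ennreal"
    by (simp add: distrib_right nn_integral_add)
  have eq: "risk n F c1 c2 p \<mu> \<sigma> (est c0 g) + L dneg = risk n F c1 c2 p \<mu> \<sigma> (equivariant_est c0) + L dpos"
    unfolding R R0 L_def
  proof (subst (1 2) sum)
    show "(\<integral>\<^sup>+v\<in>{0<..}. (\<integral>\<^sup>+u. (ennreal (\<rho> ((u + c0 * v) + g ((u + \<nu>) / v) * v)) +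
        (\<integral>\<^sup>+h\<in>{0..g ((u + \<nu>) / v)}. ennreal (v * dneg (u + c0 * v + h * v)) \<partial>lborel)) * W u v \<partial>lborel) \<partial>lborel) =
      (\<integral>\<^sup>+v\<in>{0<..}. (\<integral>\<^sup>+u. (ennreal (\<rho> (u + c0 * v)) +
        (\<integral>\<^sup>+h\<in>{0..g ((u + \<nu>) / v)}. ennreal (v * dpos (u + c0 * v + h * v)) \<partial>lborel)) * W u v \<partial>lborel) \<partial>lborel)"
      by (rule set_nn_integral_cong[OF refl refl], rule nn_integral_cong) (simp only: loss_layer(1)[OF _ g0] Int_iff greaterThan_iff)
  qed measurable
  have L_le: "L dpos \<le> L dneg"
  proof -
    define S where "S \<phi> h = (\<integral>\<^sup>+v\<in>{0<..}. (\<integral>\<^sup>+u. ennreal (v * \<phi> (u + c0 * v + h * v)) * (if 0 \<le> h \<and> h \<le> g ((u + \<nu>) / v) then 1 else 0)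
       * W u v \<partial>lborel) \<partial>lborel)" for \<phi> h
    have LS: "L \<phi> = (\<integral>\<^sup>+h. S \<phi> h \<partial>lborel)" if "\<phi> \<in> borel_measurable borel" for \<phi>
      unfolding L_def S_def W_def using that by (intro layer_integral_swap) auto
    have "(\<integral>\<^sup>+h. S dpos h \<partial>lborel) \<le> (\<integral>\<^sup>+h. S dneg h \<partial>lborel)"
      using AE_lborel_singleton[of "0::real"]
    proof (intro nn_integral_mono_AE, eventually_elim)
      fix h :: real assume "h \<noteq> 0"
      show "S dpos h \<le> S dneg h"
      \<comment> \<open>A layer with h < 0, or one that no value of \<open>g\<close> reaches, is
        empty.\<close>
      proof (cases "0 < h \<and> (\<exists>t. h \<le> g t)")
        case False
        then have "S dpos h = 0" using \<open>h \<noteq> 0\<close> by (auto simp: S_def)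
        then show ?thesis by simp
      next
        case True
        then obtain \<tau> where \<tau>: "\<And>t. h \<le> g t \<longleftrightarrow> t \<le> \<tau>"
          using superlevel_set_antimono[OF anti cont lim] by blast
        \<comment> \<open>The threshold on (u + \<nu>) / v describes a wedge, and the factor v of
          the layer raises the power n - 1 of the density to n.\<close>
        have S_eq: "S \<phi> h = wedge_integral (real n) F \<phi> (c0 + h) \<tau> \<nu>" if \<phi>: "\<And>t. \<phi> t \<ge> 0" for \<phi>
          unfolding S_def wedge_integral_def
        proof (rule set_nn_integral_cong[OF refl refl], rule nn_integral_cong)
          fix v u :: real assume "v \<in> space lborel \<inter> {0<..}"
          then have v: "v > 0" by simp
          have e1: "(u + \<nu>) / v \<le> \<tau> \<longleftrightarrow> u \<le> v * \<tau> - \<nu>" using v by (simp add: field_simps)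
          have e2: "u + c0 * v + h * v = u + (c0 + h) * v" by (simp add: algebra_simps)
          have e3: "v powr real n = v * v powr (real n - 1)"
            using powr_mult_base[of v "real n - 1"] v by simp
          show "ennreal (v * \<phi> (u + c0 * v + h * v)) * (if 0 \<le> h \<and> h \<le> g ((u + \<nu>) / v) then 1 else 0) * W u v
            = ennreal (\<phi> (u + (c0 + h) * v) * (v powr real n * F (u\<^sup>2 + v\<^sup>2))) * indicator {..v * \<tau> - \<nu>} u"
            unfolding e2 e3 \<tau> e1 W_def using True v \<phi>[of "u + (c0 + h) * v"]
            by (simp add: indicator_def ennreal_mult'[symmetric] mult_ac)
        qed
        \<comment> \<open>Here h \<le> g \<tau> \<le> g0 \<tau>. A smaller shift lowers the positive
          part and raises the negative one, so the comparison at the Bayes root for {..\<tau>} is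
          enough.\<close>
        have ch: "c0 + h \<le> c0 + g0 \<tau>" using \<tau>[of \<tau>] le[of \<tau>] by simp
        have "wedge_integral (real n) F dpos (c0 + h) \<tau> \<nu> \<le> wedge_integral (real n) F dpos (c0 + g0 \<tau>) \<tau> \<nu>"
          by (rule wedge_integral_mono(1)[where F = F, OF F0 ch])
        also have "\<dots> \<le> wedge_integral (real n) F dneg (c0 + g0 \<tau>) \<tau> \<nu>"
        proof (rule wedge_integral_le)
          show "1 \<le> real n" using n by simp
        qed (fact F F0 M root \<nu> | rule Fpos mlr, assumption+)+
        also have "\<dots> \<le> wedge_integral (real n) F dneg (c0 + h) \<tau> \<nu>"
          by (rule wedge_integral_mono(2)[where F = F, OF F0 ch])
        finally show ?thesis
          by (simp only: S_eq[of dpos, OF dpos_nonneg] S_eq[of dneg, OF dneg_nonneg])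
      qed
    qed
    then show ?thesis by (simp only: LS[OF measurable_loss(2)] LS[OF measurable_loss(3)])
  qed
  have "risk n F c1 c2 p \<mu> \<sigma> (est c0 g) + L dneg \<le> risk n F c1 c2 p \<mu> \<sigma> (equivariant_est c0) + L dneg"
    unfolding eq by (rule add_left_mono[OF L_le])
  then have "L dneg + risk n F c1 c2 p \<mu> \<sigma> (est c0 g) \<le> L dneg + risk n F c1 c2 p \<mu> \<sigma> (equivariant_est c0)"
    unfolding add.commute[of "L dneg"] .
  then have cancel: "L dneg = \<infinity> \<or> risk n F c1 c2 p \<mu> \<sigma> (est c0 g) \<le> risk n F c1 c2 p \<mu> \<sigma> (equivariant_est c0)"
    unfolding ennreal_add_left_cancel_le infinity_ennreal_def .
  have "L dneg < \<infinity>" using N_le R0_fin by (rule le_less_trans)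
  then have "L dneg \<noteq> \<infinity>" by (rule less_imp_neq)
  with cancel show ?thesis by blast
qed

end

section \<open>From minimizers to estimators and moments\<close>

lemma unique_minimizer_unique: "unique_minimizer F a \<Longrightarrow> unique_minimizer F b \<Longrightarrow> a = b"
  unfolding unique_minimizer_def by (metis less_asym)

lemma unique_minimizer_affine:
  fixes F :: "real \<Rightarrow> ennreal"
  assumes "unique_minimizer (\<lambda>d. F ((d - x) / s)) d0" "s \<noteq> 0"
  shows "unique_minimizer F ((d0 - x) / s)"
  unfolding unique_minimizer_def
proof (intro allI impI)
  fix b assume "b \<noteq> (d0 - x) / s"
  then have "x + b * s \<noteq> d0" using assms(2) by (auto simp: field_simps)
  then have "F ((d0 - x) / s) < F ((x + b * s - x) / s)"
    using assms(1) by (auto simp: unique_minimizer_def)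
  then show "F ((d0 - x) / s) < F b" using assms(2) by simp
qed

lemma risk_cong:
  assumes "\<And>x s. s > 0 \<Longrightarrow> \<delta> x s = \<delta>' x s" and [measurable]: "F \<in> borel_measurable borel"
  shows "risk n F c1 c2 p \<mu> \<sigma> \<delta> = risk n F c1 c2 p \<mu> \<sigma> \<delta>'"
proof -
  have "(\<lambda>(x, s). indicator {0<..} s * ennreal (likelihood n F \<mu> \<sigma> x s)) \<in> borel_measurable lborel"
    unfolding lborel_prod[symmetric] by measurable
  then have "AE z in model n F \<mu> \<sigma>. snd z > 0"
    unfolding model_def by (subst AE_density) (auto simp: indicator_def split_beta)
  then show ?thesis
    unfolding risk_def by (intro nn_integral_cong_AE) (auto elim!: eventually_mono simp: assms(1))
qed

text \<open>Nothing is known about \<open>f\<close> at t \<le> 0. Cutting it off there makes it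
  Borel, and for s > 0 the likelihood evaluates it at positive arguments only.\<close>

lemma differentiable_imp_restricted_measurable:
  fixes f :: "real \<Rightarrow> real"
  assumes "\<And>t. t > 0 \<Longrightarrow> f differentiable (at t)"
  shows "(\<lambda>t. if t > 0 then f t else 0) \<in> borel_measurable borel"
proof -
  have "continuous_on {0<..} f"
    using assms differentiable_imp_continuous_within
    by (intro continuous_at_imp_continuous_on) auto
  then have "(\<lambda>t. indicator {0<..} t *\<^sub>R f t) \<in> borel_measurable borel"
    by (intro borel_measurable_continuous_on_indicator) auto
  moreover have "(\<lambda>t. indicator {0<..} t *\<^sub>R f t) = (\<lambda>t. if t > 0 then f t else 0)"
    by (auto simp: fun_eq_iff indicator_def)
  ultimately show ?thesis by simp
qed

context asym_power_loss
begin

text \<open>An interval left of both y and - a carries strictly positive loss.\<close>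

lemma crit_atMost_pos: "crit \<kappa> {..y} a \<noteq> 0"
proof
  assume "crit \<kappa> {..y} a = 0"
  then have "AE w in lborel. ennreal (\<rho> (w + a) * kern \<kappa> w) * indicator {..y} w = 0"
    unfolding crit_def by (subst (asm) nn_integral_0_iff_AE) auto
  then have "AE w in lborel. w \<notin> {min y (- a) - 1<..<min y (- a)}"
  proof eventually_elim
    case (elim w)
    have "\<rho> (w + a) > 0" if "w < - a"
      using that c1 by (simp add: loss_def)
    then show ?case using elim kern_pos[of \<kappa> w] by (force simp: indicator_def mult_le_0_iff)
  qed
  then have "emeasure lborel {min y (- a) - 1<..<min y (- a)} = 0"
    by (subst (asm) AE_iff_measurable[where N = "{min y (- a) - 1<..<min y (- a)}"]) auto
  then show False by (subst (asm) emeasure_lborel_Ioo) auto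
qed

lemma crit_UNIV_pos: "crit \<kappa> UNIV a \<noteq> 0"
proof -
  have "crit \<kappa> {..0} a \<le> crit \<kappa> UNIV a"
    unfolding crit_def by (intro nn_integral_mono) (auto simp: indicator_def)
  then show ?thesis using crit_atMost_pos[of \<kappa> 0 a] by auto
qed

text \<open>The strict inequality between the values at a and a + 1 excludes c = 0 and makes c G a
  finite; as G a is nonzero, c is finite. All finiteness of radial moments comes from here.\<close>

lemma unique_minimizer_cmult_factor:
  assumes "unique_minimizer (\<lambda>b. c * G b) a" "G a \<noteq> 0"
  shows "c \<noteq> 0" "c < \<infinity>"
proof -
  have "c * G a < c * G (a + 1)" using assms(1) by (auto simp: unique_minimizer_def)
  then have "c * G a < \<top>" "c \<noteq> 0"
    using order_less_le_trans[OF _ top_greatest] by auto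
  then show "c \<noteq> 0" "c < \<infinity>" using assms(2) by (auto simp: ennreal_mult_less_top)
qed

lemma unique_minimizer_cmult_intro:
  assumes "unique_minimizer F a" "c \<noteq> 0" "c < \<infinity>"
  shows "unique_minimizer (\<lambda>b. c * F b) a"
  using assms by (auto simp: unique_minimizer_def zero_less_iff_neq_zero intro!: ennreal_mult_strict_left_mono)

lemma unique_minimizer_shift:
  "unique_minimizer (\<lambda>g. F (c + g)) g0 \<longleftrightarrow> unique_minimizer F (c + (g0::real))"
  unfolding unique_minimizer_def
  by (metis add.commute add_diff_cancel_right' diff_add_cancel)

lemma generalized_bayes_unique_minimizer:
  assumes n: "n \<ge> 1" and F: "F \<in> borel_measurable borel" "\<And>t. F t \<ge> 0"
    and bayes: "generalized_bayes n F c1 c2 p (prior l) \<delta>" and s: "s > 0"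
  shows "unique_minimizer (crit (real n + l + p + 1) {..x / s}) ((\<delta> x s - x) / s)"
proof -
  have "unique_minimizer (posterior_loss n F c1 c2 p (prior l) x s) (\<delta> x s)"
    using bayes s by (auto simp: generalized_bayes_def)
  then have "unique_minimizer (\<lambda>d. crit (real n + l + p + 1) {..x / s} ((d - x) / s)) (\<delta> x s)"
    unfolding posterior_loss_eq[OF n F s, abs_def] by (rule unique_minimizer_cmult)
  then show ?thesis using s by (intro unique_minimizer_affine) auto
qed

text \<open>For l > 0 the moment of order n + l + p is not controlled by the risk of equivariant
  estimators. It is recovered from the posterior scale factor, finite because the Bayes estimator
  exists, by inverting \<sigma>.\<close>

lemma generalized_bayes_radial_moment:
  assumes n: "n \<ge> 1" and F[measurable]: "F \<in> borel_measurable borel" and F0: "\<And>t. F t \<ge> 0"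
    and bayes: "generalized_bayes n F c1 c2 p (prior l) \<delta>"
  shows "radial_moment F (real n + l + p) \<noteq> 0" "radial_moment F (real n + l + p) < \<infinity>"
proof -
  define m where "m = real n + l + p"
  define B where "B = (\<integral>\<^sup>+\<sigma>\<in>{0<..}. ennreal (\<sigma> powr (- (m + 2)) * F (1 / \<sigma>\<^sup>2)) \<partial>lborel)"
  have "unique_minimizer (posterior_loss n F c1 c2 p (prior l) 0 1) (\<delta> 0 1)"
    using bayes by (auto simp: generalized_bayes_def)
  moreover have "posterior_loss n F c1 c2 p (prior l) 0 1 = (\<lambda>d. B * crit (real n + l + p + 1) {..0} d)"
    using posterior_loss_eq[OF n F F0, of 1 l 0] by (simp add: fun_eq_iff B_def m_def)
  ultimately have "unique_minimizer (\<lambda>d. B * crit (real n + l + p + 1) {..0} d) (\<delta> 0 1)"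
    by simp
  then have B: "B \<noteq> 0" "B < \<infinity>"
    using unique_minimizer_cmult_factor crit_atMost_pos by blast+
  have eq: "t powr (- (m + 2)) * F (1 / t\<^sup>2) = inverse (t\<^sup>2) * (inverse t powr m * F ((inverse t)\<^sup>2))" if "t > 0" for t
  proof -
    have "- (m + 2) = - 2 + - m" by simp
    then have "t powr (- (m + 2)) = t powr (- 2) * t powr (- m)" by (simp only: powr_add)
    also have "t powr (- 2) = inverse (t\<^sup>2)" using that by (simp add: powr_minus)
    also have "t powr (- m) = inverse t powr m"
      using that by (simp add: powr_minus inverse_powr)
    finally show ?thesis by (simp add: inverse_eq_divide power_one_over)
  qed
  have B_eq: "B = (\<integral>\<^sup>+t\<in>{0<..}. ennreal (inverse (t\<^sup>2) * (inverse t powr m * F ((inverse t)\<^sup>2))) \<partial>lborel)"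
    unfolding B_def by (rule set_nn_integral_cong[OF refl refl]) (use eq in auto)
  have "radial_moment F m = B"
    unfolding radial_moment_def B_eq using B F0
    by (intro nn_integral_Ioi_inverse[of "\<lambda>t. t powr m * F (t\<^sup>2)"]) (auto simp: B_eq)
  then show "radial_moment F (real n + l + p) \<noteq> 0" "radial_moment F (real n + l + p) < \<infinity>"
    using B by (auto simp: m_def)
qed

lemma is_g_bayes_iff:
  assumes F: "F \<in> borel_measurable borel" "\<And>t. F t \<ge> 0"
    and M: "radial_moment F (real n + l + p) \<noteq> 0" "radial_moment F (real n + l + p) < \<infinity>"
  shows "is_g_bayes n F c1 c2 p c0 l g \<longleftrightarrow>
    (\<forall>y. unique_minimizer (crit (real n + l + p + 1) {..y}) (c0 + g y))"
proof -
  have "unique_minimizer (bayes_criterion n F c1 c2 p c0 l y) (g y) \<longleftrightarrow>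
      unique_minimizer (crit (real n + l + p + 1) {..y}) (c0 + g y)" for y
    unfolding bayes_criterion_eq[OF F, abs_def]
      unique_minimizer_shift[of "\<lambda>a. radial_moment F (real n + l + p) * crit (real n + l + p + 1) {..y} a" c0 "g y"]
    using M by (blast intro: unique_minimizer_cmult unique_minimizer_cmult_intro)
  then show ?thesis by (simp add: is_g_bayes_def)
qed

end

theorem theorem4:
  fixes n :: nat and f :: "real \<Rightarrow> real" and c1 c2 p c0 :: real
    and \<delta>\<^sub>0 :: "real \<Rightarrow> real \<Rightarrow> real" and g\<^sub>0 :: "real \<Rightarrow> real"
  assumes n: "n \<ge> 1"
    and f_pos: "\<And>t. t > 0 \<Longrightarrow> f t > 0"
    and f_diff: "\<And>t. t > 0 \<Longrightarrow> f differentiable (at t)"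
    and f_deriv_neg: "\<And>t. t > 0 \<Longrightarrow> deriv f t < 0"
    and f_ratio: "antimono_on {0<..} (\<lambda>t. t * deriv f t / f t)"
    and density: "\<And>\<mu> \<sigma>. \<mu> \<ge> 0 \<Longrightarrow> \<sigma> > 0 \<Longrightarrow> prob_space (model n f \<mu> \<sigma>)"
    and p: "p \<ge> 1"
    and c: "c1 > 0" "c2 \<ge> c1"
    and mre: "is_mre_constant n f c1 c2 p c0"
    and bayes_0: "generalized_bayes n f c1 c2 p (prior 0) \<delta>\<^sub>0"
    and g_bayes_0: "is_g_bayes n f c1 c2 p c0 0 g\<^sub>0"
  shows
    "(\<forall>g\<in>class_C. (\<forall>y. g y \<le> g\<^sub>0 y) \<longrightarrow> minimax n f c1 c2 p c0 (est c0 g)) \<and>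
     (g\<^sub>0 \<in> class_C \<and> (\<forall>x. \<forall>s>0. \<delta>\<^sub>0 x s = est c0 g\<^sub>0 x s) \<and> minimax n f c1 c2 p c0 \<delta>\<^sub>0) \<and>
     (c1 = c2 \<longrightarrow>
       (\<forall>l>0. \<forall>\<delta>. generalized_bayes n f c1 c2 p (prior l) \<delta> \<longrightarrow>
          (\<exists>g\<in>class_C. is_g_bayes n f c1 c2 p c0 l g \<and> (\<forall>y. g y \<le> g\<^sub>0 y) \<and>
             (\<forall>x. \<forall>s>0. \<delta> x s = est c0 g x s)) \<and>
          minimax n f c1 c2 p c0 \<delta>))"
proof -
  interpret asym_power_loss c1 c2 p
    using p c by unfold_locales auto
  define F where "F t = (if t > 0 then f t else 0)" for t
  have F: "F \<in> borel_measurable borel"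
    unfolding F_def[abs_def] by (rule differentiable_imp_restricted_measurable[OF f_diff])
  have F0: "F t \<ge> 0" and Fpos: "t > 0 \<Longrightarrow> F t > 0" for t
    using f_pos by (auto simp: F_def less_imp_le)
  have mlr: "F (\<beta> * B) * F (\<alpha> * A) \<le> F (\<beta> * A) * F (\<alpha> * B)"
    if "0 < \<alpha>" "\<alpha> \<le> \<beta>" "0 < A" "A \<le> B" for \<alpha> \<beta> A B
    using log_derivative_antimono_imp_mlr[OF f_pos f_diff f_ratio that] that by (simp add: F_def)
  have lik: "likelihood n f \<mu> \<sigma> x s = likelihood n F \<mu> \<sigma> x s" if "\<sigma> \<noteq> 0" "s > 0" for \<mu> \<sigma> x s
  proof -
    have "((x - \<mu>)\<^sup>2 + s\<^sup>2) / \<sigma>\<^sup>2 > 0" using that by (intro divide_pos_pos add_nonneg_pos) auto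
    then show ?thesis by (simp add: likelihood_def F_def)
  qed
  have risk_F: "risk n f c1 c2 p \<mu> \<sigma> \<delta> = risk n F c1 c2 p \<mu> \<sigma> \<delta>" if "\<sigma> > 0" for \<mu> \<sigma> \<delta>
  proof -
    have "(\<lambda>(x, s). indicator {0<..} s * ennreal (likelihood n f \<mu> \<sigma> x s)) =
        (\<lambda>(x, s). indicator {0<..} s * ennreal (likelihood n F \<mu> \<sigma> x s))"
      using that by (auto simp: fun_eq_iff indicator_def lik)
    then show ?thesis by (simp add: risk_def model_def)
  qed
  have bayes_F: "generalized_bayes n f c1 c2 p (prior l) \<delta> \<longleftrightarrow> generalized_bayes n F c1 c2 p (prior l) \<delta>" for l \<delta>
  proof -
    have "posterior_loss n f c1 c2 p (prior l) x s = posterior_loss n F c1 c2 p (prior l) x s" if "s > 0" for x s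
      unfolding posterior_loss_def
      by (intro ext nn_integral_cong) (auto simp: prior_def indicator_def lik that split: prod.splits)
    then show ?thesis by (simp add: generalized_bayes_def)
  qed
  have g_bayes_F: "is_g_bayes n f c1 c2 p c0 l g \<longleftrightarrow> is_g_bayes n F c1 c2 p c0 l g" for l g
  proof -
    have "bayes_criterion n f c1 c2 p c0 l y = bayes_criterion n F c1 c2 p c0 l y" for y
      unfolding bayes_criterion_def
    proof (intro ext set_nn_integral_cong refl)
      fix g u v :: real assume "v \<in> space lborel \<inter> {0<..}"
      then have "u\<^sup>2 + v\<^sup>2 > 0" by (intro add_nonneg_pos) auto
      then show "ennreal (loss c1 c2 p (u + c0 * v + g * v) * f (u\<^sup>2 + v\<^sup>2) * v powr (real n + l - 1)) =
        ennreal (loss c1 c2 p (u + c0 * v + g * v) * F (u\<^sup>2 + v\<^sup>2) * v powr (real n + l - 1))"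
        by (simp add: F_def)
    qed
    then show ?thesis by (simp add: is_g_bayes_def)
  qed
  have minimax_F: "minimax n f c1 c2 p c0 \<delta> \<longleftrightarrow> minimax n F c1 c2 p c0 \<delta>" for \<delta>
    by (simp add: minimax_def risk_F)

  define \<kappa> where "\<kappa> = real n + p + 1"
  have \<kappa>: "\<kappa> \<ge> p + 2" using n by (simp add: \<kappa>_def)
  have mre_min: "unique_minimizer (\<lambda>c. radial_moment F (real n + p) * crit \<kappa> UNIV c) c0"
    using mre by (simp add: is_mre_constant_def risk_F risk_equivariant_eq[OF n F F0] \<kappa>_def)
  \<comment> \<open>The existence of \<open>c0\<close> supplies the moment needed for l = 0.\<close>
  have M: "radial_moment F (real n + p) \<noteq> 0" "radial_moment F (real n + p) < \<infinity>"
    using unique_minimizer_cmult_factor[OF mre_min crit_UNIV_pos] by auto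
  have c0_min: "unique_minimizer (crit \<kappa> UNIV) c0"
    using mre_min by (rule unique_minimizer_cmult)
  have c0_root: "foc \<kappa> UNIV c0 = 0"
    using c0_min by (intro foc_eq_0 \<kappa>) auto
  have g0_min: "unique_minimizer (crit \<kappa> {..y}) (c0 + g\<^sub>0 y)" for y
    using is_g_bayes_iff[OF F F0, of n 0 c0 g\<^sub>0] M g_bayes_0 by (simp add: g_bayes_F \<kappa>_def)
  have g0_root: "foc \<kappa> {..y} (c0 + g\<^sub>0 y) = 0" for y
    using g0_min by (intro foc_eq_0 \<kappa>) auto
  have g0_C: "g\<^sub>0 \<in> class_C"
    by (rule foc_root_class_C[OF \<kappa> g0_root c0_root])

  have minimax_est: "minimax n F c1 c2 p c0 (est c0 g)" if "g \<in> class_C" "\<forall>y. g y \<le> g\<^sub>0 y" for g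
    unfolding minimax_def
    using risk_est_le[OF n F F0 Fpos mlr M(2) g0_root[unfolded \<kappa>_def] that(1)] that(2) by blast
  have minimax_cong: "minimax n F c1 c2 p c0 \<delta>"
    if "g \<in> class_C" "\<forall>y. g y \<le> g\<^sub>0 y" "\<forall>x. \<forall>s>0. \<delta> x s = est c0 g x s" for g \<delta>
  proof -
    have "risk n F c1 c2 p \<mu> \<sigma> \<delta> = risk n F c1 c2 p \<mu> \<sigma> (est c0 g)" for \<mu> \<sigma>
      using that(3) by (intro risk_cong F) auto
    then show ?thesis using minimax_est[OF that(1,2)] by (simp add: minimax_def)
  qed

  have \<delta>0: "\<delta>\<^sub>0 x s = est c0 g\<^sub>0 x s" if s: "s > 0" for x s
  proof -
    have "unique_minimizer (crit \<kappa> {..x / s}) ((\<delta>\<^sub>0 x s - x) / s)"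
      using generalized_bayes_unique_minimizer[OF n F F0 bayes_0[unfolded bayes_F] s, of x] by (simp add: \<kappa>_def)
    then have "(\<delta>\<^sub>0 x s - x) / s = c0 + g\<^sub>0 (x / s)"
      using g0_min by (rule unique_minimizer_unique)
    then show ?thesis using s by (simp add: est_def equivariant_est_def field_simps)
  qed

  have symmetric: "\<exists>g\<in>class_C. is_g_bayes n F c1 c2 p c0 l g \<and> (\<forall>y. g y \<le> g\<^sub>0 y) \<and>
      (\<forall>x. \<forall>s>0. \<delta> x s = est c0 g x s)"
    if c12': "c1 = c2" and l: "l > 0" and bayes: "generalized_bayes n F c1 c2 p (prior l) \<delta>" for l \<delta>
  proof -
    have loc: "asym_power_loss c1 c1 p" using p c by unfold_locales auto
    \<comment> \<open>The criterion is even in the shift for a symmetric loss, so uniqueness of the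
      minimizer forces c0 = 0.\<close>
    have sym: "crit \<kappa> UNIV (- c0) = crit \<kappa> UNIV c0"
      unfolding c12'[symmetric] by (rule crit_UNIV_minus[OF loc])
    have c0: "c0 = 0"
    proof (rule ccontr)
      assume "c0 \<noteq> 0"
      then have "crit \<kappa> UNIV c0 < crit \<kappa> UNIV (- c0)" using c0_min by (simp add: unique_minimizer_def)
      then show False using sym by simp
    qed
    have \<kappa>l: "real n + l + p + 1 = \<kappa> + l" "\<kappa> + l \<ge> p + 2" using \<kappa> l by (auto simp: \<kappa>_def)
    \<comment> \<open>Read off at s = 1, using c0 = 0; uniqueness of minimizers extends the formula
      to all s.\<close>
    define g where "g y = \<delta> y 1 - y" for y
    note bayes_min = generalized_bayes_unique_minimizer[OF n F F0 bayes, unfolded \<kappa>l(1)]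
    have g_min: "unique_minimizer (crit (\<kappa> + l) {..y}) (c0 + g y)" for y
      using bayes_min[of 1 y] by (simp add: g_def c0)
    have g_root: "foc (\<kappa> + l) {..y} (c0 + g y) = 0" for y
      using g_min \<kappa>l by (intro foc_eq_0) auto
    \<comment> \<open>By oddness 0 solves the whole-line condition for every exponent. Without this
      common root the Bayes function for l would tend to a nonzero limit relative to
      \<open>c0\<close>.\<close>
    have l_root: "foc (\<kappa> + l) UNIV c0 = 0"
      unfolding c12'[symmetric] c0 by (rule foc_UNIV_0[OF loc])
    have "g \<in> class_C"
      by (rule foc_root_class_C[OF \<kappa>l(2) g_root l_root])
    moreover have "is_g_bayes n F c1 c2 p c0 l g"
      using is_g_bayes_iff[OF F F0 generalized_bayes_radial_moment[OF n F F0 bayes]] g_min by (simp add: \<kappa>l)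
    moreover have "g y \<le> g\<^sub>0 y" for y
    proof -
      \<comment> \<open>With c0 = 0 this is the sign condition on which the folding in
        \<open>foc_nonneg_of_root\<close> relies.\<close>
      have "c0 \<le> c0 + g\<^sub>0 y" by (rule foc_root_ge[OF \<kappa> g0_root c0_root])
      then have "c0 + g y \<le> c0 + g\<^sub>0 y"
        using foc_root_le[OF loc \<kappa> less_imp_le[OF l], of "c0 + g\<^sub>0 y" y "c0 + g y"] g0_root[of y] g_root[of y]
        unfolding c12'[symmetric] c0 by simp
      then show ?thesis by simp
    qed
    moreover have "\<delta> x s = est c0 g x s" if s: "s > 0" for x s
    proof -
      have "(\<delta> x s - x) / s = c0 + g (x / s)"
        using bayes_min[OF s] g_min by (rule unique_minimizer_unique)
      then show ?thesis using s by (simp add: est_def equivariant_est_def field_simps)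
    qed
    ultimately show ?thesis by blast
  qed
  show ?thesis
    unfolding minimax_F bayes_F g_bayes_F
    using minimax_est minimax_cong[OF g0_C] g0_C \<delta>0 symmetric minimax_cong by blast
qed

end
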